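(* Let $\Gamma=(M^{(i)}_{(\alpha)\beta},N^{(i)}_{(\alpha)j})$ be a fixed nonlinear connection on $E=J^1(T,M)$. (i) Under a change of coordinates on $E$, the nine local components $$\nabla\Gamma=(\bar G^\alpha_{\beta\gamma},\ G^k_{i\gamma},\ G^{(i)(\beta)}_{(\alpha)(j)\gamma},\ \bar L^\alpha_{\beta j},\ L^k_{ij},\ L^{(i)(\beta)}_{(\alpha)(j)k},\ \bar C^{\alpha(\gamma)}_{\beta(k)},\ C^{j(\gamma)}_{i(k)},\ C^{(i)(\beta)(\gamma)}_{(\alpha)(j)(k)})$$ of a $\Gamma$-linear connection $\nabla$ on $E$ transform by the following rules. $(h_T)$: $$\bar G^\delta_{\alpha\beta}\frac{\partial\tilde t^\varepsilon}{\partial t^\delta}=\tilde{\bar G}^\varepsilon_{\mu\gamma}\frac{\partial\tilde t^\mu}{\partial t^\alpha}\frac{\partial\tilde t^\gamma}{\partial t^\beta}+\frac{\partial^2\tilde t^\varepsilon}{\partial t^\alpha\partial t^\beta},$$ $$G^k_{i\gamma}=\tilde G^m_{j\beta}\frac{\partial x^k}{\partial\tilde x^m}\frac{\partial\tilde x^j}{\partial x^i}\frac{\partial\tilde t^\beta}{\partial t^\gamma},$$ $$G^{(k)(\beta)}_{(\gamma)(i)\alpha}=\tilde G^{(p)(\eta)}_{(\varepsilon)(j)\mu}\frac{\partial x^k}{\partial\tilde x^p}\frac{\partial\tilde t^\varepsilon}{\partial t^\gamma}\frac{\partial\tilde x^j}{\partial x^i}\frac{\partial t^\beta}{\partial\tilde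 t^\eta}\frac{\partial\tilde t^\mu}{\partial t^\alpha}+\delta^k_i\frac{\partial\tilde t^\mu}{\partial t^\alpha}\frac{\partial\tilde t^\varepsilon}{\partial t^\gamma}\frac{\partial^2 t^\beta}{\partial\tilde t^\mu\partial\tilde t^\varepsilon};$$ $(h_M)$: $$\bar L^\gamma_{\beta j}\frac{\partial x^j}{\partial\tilde x^l}=\tilde{\bar L}^\eta_{\mu l}\frac{\partial t^\gamma}{\partial\tilde t^\eta}\frac{\partial\tilde t^\mu}{\partial t^\beta},$$ $$L^m_{ij}\frac{\partial\tilde x^r}{\partial x^m}=\tilde L^r_{pq}\frac{\partial\tilde x^p}{\partial x^i}\frac{\partial\tilde x^q}{\partial x^j}+\frac{\partial^2\tilde x^r}{\partial x^i\partial x^j},$$ $$L^{(k)(\beta)}_{(\gamma)(i)j}=\tilde L^{(r)(\eta)}_{(\nu)(p)l}\frac{\partial x^k}{\partial\tilde x^r}\frac{\partial\tilde t^\nu}{\partial t^\gamma}\frac{\partial\tilde x^p}{\partial x^i}\frac{\partial t^\beta}{\partial\tilde t^\eta}\frac{\partial\tilde x^l}{\partial x^j}+\delta^\beta_\gamma\frac{\partial x^k}{\partial\tilde x^r}\frac{\partial^2\tilde x^r}{\partial x^i\partial x^j};$$ $(v)$: $$\bar C^{\gamma(\alpha)}_{\beta(i)}=\tilde{\bar C}^{\mu(\delta)}_{\varepsilon(j)}\frac{\partial t^\gamma}{\partial\tilde t^\mu}\frac{\partial\tilde t^\varepsilon}{\partial t^\beta}\frac{\partial\tilde x^j}{\partial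 x^i}\frac{\partial t^\alpha}{\partial\tilde t^\delta},$$ $$C^{k(\alpha)}_{i(j)}=\tilde C^{s(\beta)}_{p(r)}\frac{\partial x^k}{\partial\tilde x^s}\frac{\partial\tilde x^p}{\partial x^i}\frac{\partial\tilde x^r}{\partial x^j}\frac{\partial t^\alpha}{\partial\tilde t^\beta},$$ $$C^{(k)(\beta)(\alpha)}_{(\gamma)(i)(j)}=\tilde C^{(r)(\mu)(\nu)}_{(\varepsilon)(p)(q)}\frac{\partial x^k}{\partial\tilde x^r}\frac{\partial\tilde t^\varepsilon}{\partial t^\gamma}\frac{\partial\tilde x^p}{\partial x^i}\frac{\partial t^\beta}{\partial\tilde t^\mu}\frac{\partial\tilde x^q}{\partial x^j}\frac{\partial t^\alpha}{\partial\tilde t^\nu}.$$ (ii) Conversely, giving a $\Gamma$-linear connection $\nabla$ on $E$ is equivalent to giving a set of nine local components $\nabla\Gamma$ (as listed above, in every coordinate chart) whose transformation laws are those of (i).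
   Context: $T$ and $M$ are smooth manifolds of dimensions $p$ and $n$, with local coordinates $(t^\alpha)$ and $(x^i)$; Greek indices run from $1$ to $p$, Latin indices from $1$ to $n$, and repeated indices are summed. $E=J^1(T,M)\to T\times M$ is the first-order jet bundle, with coordinates $(t^\alpha,x^i,x^i_\alpha)$; coordinate changes have the form $\tilde t^\alpha=\tilde t^\alpha(t)$, $\tilde x^i=\tilde x^i(x)$, $\tilde x^j_\beta=\frac{\partial\tilde x^j}{\partial x^i}\frac{\partial t^\alpha}{\partial\tilde t^\beta}x^i_\alpha$. $\mathcal X(E)$ denotes the vector fields on $E$. A nonlinear connection $\Gamma$ on $E$ is given by local functions $M^{(i)}_{(\alpha)\beta},N^{(i)}_{(\alpha)j}$ on $E$ with transformation rules $$\tilde M^{(j)}_{(\beta)\mu}\frac{\partial\tilde t^\mu}{\partial t^\alpha}=M^{(k)}_{(\gamma)\alpha}\frac{\partial\tilde x^j}{\partial x^k}\frac{\partial t^\gamma}{\partial\tilde t^\beta}-\frac{\partial\tilde x^j_\beta}{\partial t^\alpha},\qquad \tilde N^{(j)}_{(\beta)k}\frac{\partial\tilde x^k}{\partial x^i}=N^{(k)}_{(\gamma)i}\frac{\partial\tilde x^j}{\partial x^k}\frac{\partial t^\gamma}{\partial\tilde t^\beta}-\frac{\partial\tilde x^j_\beta}{\partial x^i}.$$ Its adapted basis of vector fields is $\frac{\delta}{\delta t^\alpha}=\frac{\partial}{\partial t^\alpha}-M^{(j)}_{(\beta)\alpha}\frac{\partial}{\partial x^j_\beta}$, $\frac{\delta}{\delta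 x^i}=\frac{\partial}{\partial x^i}-N^{(j)}_{(\beta)i}\frac{\partial}{\partial x^j_\beta}$, $\frac{\partial}{\partial x^i_\alpha}$. These span, respectively, three distributions whose direct sum is $TE$; $h_T,h_M,v$ denote the corresponding projections. A $\Gamma$-linear connection is a linear connection $\nabla:\mathcal X(E)\times\mathcal X(E)\to\mathcal X(E)$ with $\nabla h_T=0$, $\nabla h_M=0$, $\nabla v=0$ (i.e. $\nabla_X(h_TY)=h_T(\nabla_XY)$, and similarly for $h_M,v$). Its nine local components are defined by $$\nabla_{\frac{\delta}{\delta t^\gamma}}\frac{\delta}{\delta t^\beta}=\bar G^\alpha_{\beta\gamma}\frac{\delta}{\delta t^\alpha},\quad \nabla_{\frac{\delta}{\delta t^\gamma}}\frac{\delta}{\delta x^i}=G^k_{i\gamma}\frac{\delta}{\delta x^k},\quad \nabla_{\frac{\delta}{\delta t^\gamma}}\frac{\partial}{\partial x^i_\beta}=G^{(k)(\beta)}_{(\alpha)(i)\gamma}\frac{\partial}{\partial x^k_\alpha},$$ $$\nabla_{\frac{\delta}{\delta x^j}}\frac{\delta}{\delta t^\beta}=\bar L^\alpha_{\beta j}\frac{\delta}{\delta t^\alpha},\quad \nabla_{\frac{\delta}{\delta x^j}}\frac{\delta}{\delta x^i}=L^k_{ij}\frac{\delta}{\delta x^k},\quad \nabla_{\frac{\delta}{\delta x^j}}\frac{\partial}{\partial x^i_\beta}=L^{(k)(\beta)}_{(\alpha)(i)j}\frac{\partial}{\partial x^k_\alpha},$$ $$\nabla_{\frac{\partial}{\partial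 x^j_\gamma}}\frac{\delta}{\delta t^\beta}=\bar C^{\alpha(\gamma)}_{\beta(j)}\frac{\delta}{\delta t^\alpha},\quad \nabla_{\frac{\partial}{\partial x^j_\gamma}}\frac{\delta}{\delta x^i}=C^{k(\gamma)}_{i(j)}\frac{\delta}{\delta x^k},\quad \nabla_{\frac{\partial}{\partial x^j_\gamma}}\frac{\partial}{\partial x^i_\beta}=C^{(k)(\beta)(\gamma)}_{(\alpha)(i)(j)}\frac{\partial}{\partial x^k_\alpha}.$$ Tilded quantities are the same objects computed in the coordinates $(\tilde t^\alpha,\tilde x^i,\tilde x^i_\alpha)$. *)

theory Defs
  imports "HOL-Analysis.Analysis"
begin

section \<open>Smooth maps between normed spaces\<close>

text \<open>Only used for open \<open>S\<close>; on a finite-dimensional domain this is the usual class \<open>C\<^sup>k\<close>.\<close>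

primrec Ck_on :: "nat \<Rightarrow> 'a::real_normed_vector set \<Rightarrow> ('a \<Rightarrow> 'b::real_normed_vector) \<Rightarrow> bool" where
  "Ck_on 0 S f \<longleftrightarrow> continuous_on S f"
| "Ck_on (Suc k) S f \<longleftrightarrow>
     (\<forall>x\<in>S. f differentiable (at x)) \<and> (\<forall>v. Ck_on k S (\<lambda>x. frechet_derivative f (at x) v))"

definition smooth_on :: "'a::real_normed_vector set \<Rightarrow> ('a \<Rightarrow> 'b::real_normed_vector) \<Rightarrow> bool" where
  "smooth_on S f \<longleftrightarrow> (\<forall>k. Ck_on k S f)"

definition pdv :: "'k::finite \<Rightarrow> (real^'k \<Rightarrow> real) \<Rightarrow> real^'k \<Rightarrow> real" where
  "pdv i f x = frechet_derivative f (at x) (axis i 1)"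


section \<open>Smooth manifolds\<close>

text \<open>A chart is a pair of its domain and its coordinate map; the values of the map outside the
  domain are irrelevant. A manifold is given by an atlas (not required to be maximal), its set of
  points is the union of the chart domains, and its topology is the one generated by the
  charts.\<close>

type_synonym ('a, 'v) chart = "'a set \<times> ('a \<Rightarrow> 'v)"

definition cinv :: "('a, 'v) chart \<Rightarrow> 'v \<Rightarrow> 'a" where
  "cinv c = inv_into (fst c) (snd c)"

definition transition :: "('a, 'v) chart \<Rightarrow> ('a, 'w) chart \<Rightarrow> 'v \<Rightarrow> 'w" where
  "transition c d = (\<lambda>u. snd d (cinv c u))"

definition points :: "('a, 'v) chart set \<Rightarrow> 'a set" where
  "points A = (\<Union>c\<in>A. fst c)"

definition mtopology :: "('a, 'v::topological_space) chart set \<Rightarrow> 'a topology" where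
  "mtopology A = topology_generated_by {{q \<in> fst c. snd c q \<in> S} | c S. c \<in> A \<and> open S}"

definition smooth_atlas :: "('a, 'v::euclidean_space) chart set \<Rightarrow> bool" where
  "smooth_atlas A \<longleftrightarrow>
     (\<forall>c\<in>A. inj_on (snd c) (fst c) \<and> open (snd c ` fst c)) \<and>
     (\<forall>c\<in>A. \<forall>d\<in>A. open (snd c ` (fst c \<inter> fst d)) \<and>
                    smooth_on (snd c ` (fst c \<inter> fst d)) (transition c d))"

definition smooth_manifold :: "('a, 'v::euclidean_space) chart set \<Rightarrow> bool" where
  "smooth_manifold A \<longleftrightarrow>
     smooth_atlas A \<and> Hausdorff_space (mtopology A) \<and> second_countable (mtopology A)"

definition smooth_in_chart ::
  "('a, 'v::euclidean_space) chart \<Rightarrow> ('a \<Rightarrow> 'b::real_normed_vector) \<Rightarrow> bool" where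
  "smooth_in_chart c f \<longleftrightarrow> smooth_on (snd c ` fst c) (\<lambda>u. f (cinv c u))"

definition smooth_function :: "('a, 'v::euclidean_space) chart set \<Rightarrow> ('a \<Rightarrow> real) \<Rightarrow> bool" where
  "smooth_function A f \<longleftrightarrow> (\<forall>c\<in>A. smooth_in_chart c f)"

definition smooth_near ::
  "('a, 'v::euclidean_space) chart set \<Rightarrow> ('b, 'w::euclidean_space) chart set \<Rightarrow> 'a \<Rightarrow> ('a \<Rightarrow> 'b) \<Rightarrow> bool"
where
  "smooth_near A B q f \<longleftrightarrow>
     (\<exists>W. openin (mtopology A) W \<and> q \<in> W \<and>
          continuous_map (subtopology (mtopology A) W) (mtopology B) f \<and>
          (\<forall>c\<in>A. \<forall>d\<in>B. smooth_on (snd c ` {r \<in> W \<inter> fst c. f r \<in> fst d})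
                                (\<lambda>u. snd d (f (cinv c u)))))"


section \<open>Vector fields and linear connections\<close>

text \<open>A tangent vector at a point is the family of its components in all charts around that
  point, related by the Jacobians of the coordinate changes. Families are \<open>0\<close> at charts that do
  not contain the point, and vector fields are \<open>0\<close> off the manifold, so that equality of these
  objects is equality in HOL.\<close>

type_synonym ('a, 'v) tvec = "('a, 'v) chart \<Rightarrow> 'v"
type_synonym ('a, 'v) vfield = "'a \<Rightarrow> ('a, 'v) tvec"

definition tangent_space ::
  "('a, 'v::euclidean_space) chart set \<Rightarrow> 'a \<Rightarrow> ('a, 'v) tvec set" where
  "tangent_space A q =
     {v. (\<forall>c. \<not> (c \<in> A \<and> q \<in> fst c) \<longrightarrow> v c = 0) \<and>
         (\<forall>c\<in>A. \<forall>d\<in>A. q \<in> fst c \<inter> fst d \<longrightarrow>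
            v d = frechet_derivative (transition c d) (at (snd c q)) (v c))}"

definition vector_fields :: "('a, 'v::euclidean_space) chart set \<Rightarrow> ('a, 'v) vfield set" where
  "vector_fields A =
     {X. (\<forall>q. X q \<in> tangent_space A q) \<and> (\<forall>c\<in>A. smooth_in_chart c (\<lambda>q. X q c))}"

text \<open>The tangent vector at \<open>q\<close> with components \<open>w\<close> in the chart \<open>c\<close>, i.e. the
  value at \<open>q\<close> of the coordinate vector field in direction \<open>w\<close>.\<close>

definition coord_vec :: "('a, 'v::euclidean_space) chart set \<Rightarrow> ('a, 'v) chart \<Rightarrow> 'v \<Rightarrow> ('a, 'v) vfield"
where
  "coord_vec A c w q =
     (\<lambda>d. if d \<in> A \<and> q \<in> fst c \<inter> fst d
          then frechet_derivative (transition c d) (at (snd c q)) w else 0)"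

definition vf_zero :: "('a, 'v::euclidean_space) vfield" where
  "vf_zero = (\<lambda>q c. 0)"

definition vf_add :: "('a, 'v::euclidean_space) vfield \<Rightarrow> ('a, 'v) vfield \<Rightarrow> ('a, 'v) vfield" where
  "vf_add X Y = (\<lambda>q c. X q c + Y q c)"

definition vf_scale :: "('a \<Rightarrow> real) \<Rightarrow> ('a, 'v::euclidean_space) vfield \<Rightarrow> ('a, 'v) vfield" where
  "vf_scale f X = (\<lambda>q c. f q *\<^sub>R X q c)"

text \<open>The function \<open>X(f)\<close>; the value does not depend on the chart chosen around \<open>q\<close>.\<close>

definition vf_apply ::
  "('a, 'v::euclidean_space) chart set \<Rightarrow> ('a, 'v) vfield \<Rightarrow> ('a \<Rightarrow> real) \<Rightarrow> 'a \<Rightarrow> real" where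
  "vf_apply A X f q =
     (let c = (SOME c. c \<in> A \<and> q \<in> fst c)
      in frechet_derivative (\<lambda>u. f (cinv c u)) (at (snd c q)) (X q c))"

type_synonym ('a, 'v) conn = "('a, 'v) vfield \<Rightarrow> ('a, 'v) vfield \<Rightarrow> ('a, 'v) vfield"

text \<open>The last clause fixes the value at arguments which are not vector fields, so that a
  connection is determined by its restriction to vector fields. Linearity over the reals in
  the second argument is additivity together with the Leibniz rule for constant functions.\<close>

definition linear_connection ::
  "('a, 'v::euclidean_space) chart set \<Rightarrow> ('a, 'v) conn \<Rightarrow> bool" where
  "linear_connection A nab \<longleftrightarrow>
     (\<forall>X\<in>vector_fields A. \<forall>Y\<in>vector_fields A. nab X Y \<in> vector_fields A) \<and>
     (\<forall>X\<in>vector_fields A. \<forall>X'\<in>vector_fields A. \<forall>Y\<in>vector_fields A.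
        nab (vf_add X X') Y = vf_add (nab X Y) (nab X' Y)) \<and>
     (\<forall>f X Y. smooth_function A f \<and> X \<in> vector_fields A \<and> Y \<in> vector_fields A \<longrightarrow>
        nab (vf_scale f X) Y = vf_scale f (nab X Y)) \<and>
     (\<forall>X\<in>vector_fields A. \<forall>Y\<in>vector_fields A. \<forall>Y'\<in>vector_fields A.
        nab X (vf_add Y Y') = vf_add (nab X Y) (nab X Y')) \<and>
     (\<forall>f X Y. smooth_function A f \<and> X \<in> vector_fields A \<and> Y \<in> vector_fields A \<longrightarrow>
        nab X (vf_scale f Y) = vf_add (vf_scale (vf_apply A X f) Y) (vf_scale f (nab X Y))) \<and>
     (\<forall>X Y. X \<notin> vector_fields A \<or> Y \<notin> vector_fields A \<longrightarrow> nab X Y = vf_zero)"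

text \<open>A connection acts on vector fields that are only defined (and smooth) near \<open>q\<close> by
  extending their germs at \<open>q\<close> to global vector fields; the result at \<open>q\<close> does not
  depend on the extensions.\<close>

definition extends_germ ::
  "('a, 'v::euclidean_space) chart set \<Rightarrow> 'a \<Rightarrow> ('a, 'v) vfield \<Rightarrow> ('a, 'v) vfield \<Rightarrow> bool" where
  "extends_germ A q X X' \<longleftrightarrow> X' \<in> vector_fields A \<and>
     (\<exists>W. openin (mtopology A) W \<and> q \<in> W \<and> (\<forall>r\<in>W. X' r = X r))"

definition conn_local ::
  "('a, 'v::euclidean_space) chart set \<Rightarrow> ('a, 'v) conn \<Rightarrow> ('a, 'v) conn" where
  "conn_local A nab X Y q =
     nab (SOME X'. extends_germ A q X X') (SOME Y'. extends_germ A q Y Y') q"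


section \<open>The first-order jet bundle\<close>

text \<open>A jet is stored as \<open>(t, x, J)\<close> with \<open>J\<close> the class of all local smooth maps that send
  \<open>t\<close> to \<open>x\<close> and have the same first derivatives at \<open>t\<close>. In coordinates, the
  component \<open>x\<^sup>i\<^sub>\<alpha>\<close> is the entry \<open>$ i $ \<alpha>\<close> of the third component.\<close>

type_synonym ('t, 'm) jet_point = "'t \<times> 'm \<times> ('t \<Rightarrow> 'm) set"
type_synonym ('p, 'n) jet_coord = "(real^'p) \<times> (real^'n) \<times> (real^'p^'n)"

definition jet_class ::
  "('t, real^'p) chart set \<Rightarrow> ('m, real^'n) chart set \<Rightarrow> 't \<Rightarrow> ('t \<Rightarrow> 'm) \<Rightarrow> ('t \<Rightarrow> 'm) set" where
  "jet_class AT AM t f =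
     {g. smooth_near AT AM t g \<and> g t = f t \<and>
         (\<forall>a\<in>AT. \<forall>b\<in>AM. t \<in> fst a \<and> f t \<in> fst b \<longrightarrow>
            frechet_derivative (\<lambda>u. snd b (g (cinv a u))) (at (snd a t)) =
            frechet_derivative (\<lambda>u. snd b (f (cinv a u))) (at (snd a t)))}"

definition J1 ::
  "('t, real^'p) chart set \<Rightarrow> ('m, real^'n) chart set \<Rightarrow> ('t, 'm) jet_point set" where
  "J1 AT AM = {(t, f t, jet_class AT AM t f) | t f. t \<in> points AT \<and> smooth_near AT AM t f}"

definition jet_chart ::
  "('t, real^'p) chart set \<Rightarrow> ('m, real^'n) chart set \<Rightarrow> ('t, real^'p) chart \<times> ('m, real^'n) chart
   \<Rightarrow> (('t, 'm) jet_point, ('p, 'n) jet_coord) chart" where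
  "jet_chart AT AM ab =
     ({(t, x, J) \<in> J1 AT AM. t \<in> fst (fst ab) \<and> x \<in> fst (snd ab)},
      \<lambda>(t, x, J). (snd (fst ab) t, snd (snd ab) x,
        \<chi> i \<alpha>. pdv \<alpha> (\<lambda>u. snd (snd ab) ((SOME f. f \<in> J) (cinv (fst ab) u)) $ i)
                 (snd (fst ab) t)))"

definition jet_atlas ::
  "('t, real^'p) chart set \<Rightarrow> ('m, real^'n) chart set
   \<Rightarrow> (('t, 'm) jet_point, ('p, 'n) jet_coord) chart set" where
  "jet_atlas AT AM = jet_chart AT AM ` (AT \<times> AM)"

abbreviation base_t :: "('t, 'm) jet_point \<Rightarrow> 't" where "base_t e \<equiv> fst e"
abbreviation base_x :: "('t, 'm) jet_point \<Rightarrow> 'm" where "base_x e \<equiv> fst (snd e)"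

text \<open>First and second derivatives at \<open>q\<close> of the coordinate \<open>\<mu>\<close> of the chart \<open>c'\<close> with
  respect to the coordinates of \<open>c\<close>.\<close>

definition dcoord ::
  "('a, real^'k) chart \<Rightarrow> ('a, real^'k) chart \<Rightarrow> 'a \<Rightarrow> 'k::finite \<Rightarrow> 'k \<Rightarrow> real" where
  "dcoord c c' q \<mu> \<alpha> = pdv \<alpha> (\<lambda>u. transition c c' u $ \<mu>) (snd c q)"

definition d2coord ::
  "('a, real^'k) chart \<Rightarrow> ('a, real^'k) chart \<Rightarrow> 'a \<Rightarrow> 'k::finite \<Rightarrow> 'k \<Rightarrow> 'k \<Rightarrow> real" where
  "d2coord c c' q \<mu> \<alpha> \<beta> = pdv \<alpha> (pdv \<beta> (\<lambda>u. transition c c' u $ \<mu>)) (snd c q)"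

text \<open>The derivatives of the fibre coordinate \<open>(j, \<beta>)\<close> of the chart \<open>c'\<close> with respect to the
  coordinates \<open>t\<^sup>\<alpha>\<close> and \<open>x\<^sup>i\<close> of the chart \<open>c\<close> of the jet bundle.\<close>

definition dfib_t ::
  "('e, ('p::finite, 'n::finite) jet_coord) chart \<Rightarrow> ('e, ('p, 'n) jet_coord) chart \<Rightarrow> 'e
   \<Rightarrow> 'n \<Rightarrow> 'p \<Rightarrow> 'p \<Rightarrow> real" where
  "dfib_t c c' e j \<beta> \<alpha> =
     frechet_derivative (\<lambda>u. snd (snd (transition c c' u)) $ j $ \<beta>) (at (snd c e)) (axis \<alpha> 1, 0, 0)"

definition dfib_x ::
  "('e, ('p::finite, 'n::finite) jet_coord) chart \<Rightarrow> ('e, ('p, 'n) jet_coord) chart \<Rightarrow> 'e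
   \<Rightarrow> 'n \<Rightarrow> 'p \<Rightarrow> 'n \<Rightarrow> real" where
  "dfib_x c c' e j \<beta> i =
     frechet_derivative (\<lambda>u. snd (snd (transition c c' u)) $ j $ \<beta>) (at (snd c e)) (0, axis i 1, 0)"


section \<open>Nonlinear connections\<close>

text \<open>\<open>M ab e i \<alpha> \<beta>\<close> is \<open>M\<^bsup>(i)\<^esup>\<^bsub>(\<alpha>)\<beta>\<^esub>\<close> and \<open>N ab e i \<alpha> j\<close> is \<open>N\<^bsup>(i)\<^esup>\<^bsub>(\<alpha>)j\<^esub>\<close>, in the chart of the
  jet bundle induced by the pair \<open>ab\<close> of charts.\<close>

type_synonym ('t, 'm, 'p, 'n) cpair = "('t, real^'p) chart \<times> ('m, real^'n) chart"
type_synonym ('t, 'm, 'p, 'n) nlc_M =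
  "('t, 'm, 'p, 'n) cpair \<Rightarrow> ('t, 'm) jet_point \<Rightarrow> 'n \<Rightarrow> 'p \<Rightarrow> 'p \<Rightarrow> real"
type_synonym ('t, 'm, 'p, 'n) nlc_N =
  "('t, 'm, 'p, 'n) cpair \<Rightarrow> ('t, 'm) jet_point \<Rightarrow> 'n \<Rightarrow> 'p \<Rightarrow> 'n \<Rightarrow> real"

definition nonlinear_connection ::
  "('t, real^'p::finite) chart set \<Rightarrow> ('m, real^'n::finite) chart set
   \<Rightarrow> ('t, 'm, 'p, 'n) nlc_M \<Rightarrow> ('t, 'm, 'p, 'n) nlc_N \<Rightarrow> bool" where
  "nonlinear_connection AT AM M N \<longleftrightarrow>
     (\<forall>ab\<in>AT \<times> AM. \<forall>i \<alpha>.
        (\<forall>\<beta>. smooth_in_chart (jet_chart AT AM ab) (\<lambda>e. M ab e i \<alpha> \<beta>)) \<and>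
        (\<forall>j. smooth_in_chart (jet_chart AT AM ab) (\<lambda>e. N ab e i \<alpha> j))) \<and>
     (\<forall>a\<in>AT. \<forall>b\<in>AM. \<forall>a'\<in>AT. \<forall>b'\<in>AM.
        let c = jet_chart AT AM (a, b); c' = jet_chart AT AM (a', b') in
        \<forall>e\<in>fst c \<inter> fst c'.
          (\<forall>j \<beta> \<alpha>.
             (\<Sum>\<mu>\<in>UNIV. M (a', b') e j \<beta> \<mu> * dcoord a a' (base_t e) \<mu> \<alpha>) =
             (\<Sum>k\<in>UNIV. \<Sum>\<gamma>\<in>UNIV. M (a, b) e k \<gamma> \<alpha> * dcoord b b' (base_x e) j k
                                * dcoord a' a (base_t e) \<gamma> \<beta>)
             - dfib_t c c' e j \<beta> \<alpha>) \<and>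
          (\<forall>j \<beta> i.
             (\<Sum>k\<in>UNIV. N (a', b') e j \<beta> k * dcoord b b' (base_x e) k i) =
             (\<Sum>k\<in>UNIV. \<Sum>\<gamma>\<in>UNIV. N (a, b) e k \<gamma> i * dcoord b b' (base_x e) j k
                                * dcoord a' a (base_t e) \<gamma> \<beta>)
             - dfib_x c c' e j \<beta> i))"

text \<open>The adapted basis \<open>\<delta>/\<delta>t\<^sup>\<alpha>\<close>, \<open>\<delta>/\<delta>x\<^sup>i\<close>, \<open>\<partial>/\<partial>x\<^sup>i\<^sub>\<alpha>\<close> on the domain of the chart induced
  by \<open>ab\<close>.\<close>

definition basis_v ::
  "('t, real^'p::finite) chart set \<Rightarrow> ('m, real^'n::finite) chart set \<Rightarrow> ('t, 'm, 'p, 'n) cpair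
   \<Rightarrow> 'n \<Rightarrow> 'p \<Rightarrow> (('t, 'm) jet_point, ('p, 'n) jet_coord) vfield" where
  "basis_v AT AM ab i \<alpha> =
     coord_vec (jet_atlas AT AM) (jet_chart AT AM ab) (0, 0, axis i (axis \<alpha> 1))"

definition basis_t ::
  "('t, real^'p::finite) chart set \<Rightarrow> ('m, real^'n::finite) chart set \<Rightarrow> ('t, 'm, 'p, 'n) nlc_M
   \<Rightarrow> ('t, 'm, 'p, 'n) cpair \<Rightarrow> 'p \<Rightarrow> (('t, 'm) jet_point, ('p, 'n) jet_coord) vfield" where
  "basis_t AT AM M ab \<alpha> = (\<lambda>e d.
     coord_vec (jet_atlas AT AM) (jet_chart AT AM ab) (axis \<alpha> 1, 0, 0) e d
     - (\<Sum>j\<in>UNIV. \<Sum>\<beta>\<in>UNIV. M ab e j \<beta> \<alpha> *\<^sub>R basis_v AT AM ab j \<beta> e d))"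

definition basis_x ::
  "('t, real^'p::finite) chart set \<Rightarrow> ('m, real^'n::finite) chart set \<Rightarrow> ('t, 'm, 'p, 'n) nlc_N
   \<Rightarrow> ('t, 'm, 'p, 'n) cpair \<Rightarrow> 'n \<Rightarrow> (('t, 'm) jet_point, ('p, 'n) jet_coord) vfield" where
  "basis_x AT AM N ab i = (\<lambda>e d.
     coord_vec (jet_atlas AT AM) (jet_chart AT AM ab) (0, axis i 1, 0) e d
     - (\<Sum>j\<in>UNIV. \<Sum>\<beta>\<in>UNIV. N ab e j \<beta> i *\<^sub>R basis_v AT AM ab j \<beta> e d))"

text \<open>The three distributions; the span at \<open>e\<close> does not depend on the chart around \<open>e\<close>.\<close>

definition dist_T ::
  "('t, real^'p::finite) chart set \<Rightarrow> ('m, real^'n::finite) chart set \<Rightarrow> ('t, 'm, 'p, 'n) nlc_M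
   \<Rightarrow> ('t, 'm) jet_point \<Rightarrow> (('t, 'm) jet_point, ('p, 'n) jet_coord) tvec set" where
  "dist_T AT AM M e =
     {(\<lambda>d. \<Sum>\<alpha>\<in>UNIV. k \<alpha> *\<^sub>R basis_t AT AM M ab \<alpha> e d) | ab k.
        ab \<in> AT \<times> AM \<and> e \<in> fst (jet_chart AT AM ab)}"

definition dist_M ::
  "('t, real^'p::finite) chart set \<Rightarrow> ('m, real^'n::finite) chart set \<Rightarrow> ('t, 'm, 'p, 'n) nlc_N
   \<Rightarrow> ('t, 'm) jet_point \<Rightarrow> (('t, 'm) jet_point, ('p, 'n) jet_coord) tvec set" where
  "dist_M AT AM N e =
     {(\<lambda>d. \<Sum>i\<in>UNIV. k i *\<^sub>R basis_x AT AM N ab i e d) | ab k.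
        ab \<in> AT \<times> AM \<and> e \<in> fst (jet_chart AT AM ab)}"

definition dist_V ::
  "('t, real^'p::finite) chart set \<Rightarrow> ('m, real^'n::finite) chart set
   \<Rightarrow> ('t, 'm) jet_point \<Rightarrow> (('t, 'm) jet_point, ('p, 'n) jet_coord) tvec set" where
  "dist_V AT AM e =
     {(\<lambda>d. \<Sum>i\<in>UNIV. \<Sum>\<alpha>\<in>UNIV. k i \<alpha> *\<^sub>R basis_v AT AM ab i \<alpha> e d) | ab k.
        ab \<in> AT \<times> AM \<and> e \<in> fst (jet_chart AT AM ab)}"

text \<open>The summand in \<open>P\<close> of \<open>w\<close>, for a direct sum \<open>P \<oplus> Q \<oplus> R\<close>.\<close>

definition dsum_proj ::
  "('a, 'v::euclidean_space) tvec set \<Rightarrow> ('a, 'v) tvec set \<Rightarrow> ('a, 'v) tvec set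
   \<Rightarrow> ('a, 'v) tvec \<Rightarrow> ('a, 'v) tvec" where
  "dsum_proj P Q R w = (THE u. u \<in> P \<and> (\<exists>y\<in>Q. \<exists>z\<in>R. w = (\<lambda>d. u d + y d + z d)))"

definition proj_hT ::
  "('t, real^'p::finite) chart set \<Rightarrow> ('m, real^'n::finite) chart set \<Rightarrow> ('t, 'm, 'p, 'n) nlc_M
   \<Rightarrow> ('t, 'm, 'p, 'n) nlc_N \<Rightarrow> (('t, 'm) jet_point, ('p, 'n) jet_coord) vfield
   \<Rightarrow> (('t, 'm) jet_point, ('p, 'n) jet_coord) vfield" where
  "proj_hT AT AM M N X = (\<lambda>e. if e \<in> J1 AT AM
     then dsum_proj (dist_T AT AM M e) (dist_M AT AM N e) (dist_V AT AM e) (X e) else (\<lambda>d. 0))"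

definition proj_hM ::
  "('t, real^'p::finite) chart set \<Rightarrow> ('m, real^'n::finite) chart set \<Rightarrow> ('t, 'm, 'p, 'n) nlc_M
   \<Rightarrow> ('t, 'm, 'p, 'n) nlc_N \<Rightarrow> (('t, 'm) jet_point, ('p, 'n) jet_coord) vfield
   \<Rightarrow> (('t, 'm) jet_point, ('p, 'n) jet_coord) vfield" where
  "proj_hM AT AM M N X = (\<lambda>e. if e \<in> J1 AT AM
     then dsum_proj (dist_M AT AM N e) (dist_T AT AM M e) (dist_V AT AM e) (X e) else (\<lambda>d. 0))"

definition proj_v ::
  "('t, real^'p::finite) chart set \<Rightarrow> ('m, real^'n::finite) chart set \<Rightarrow> ('t, 'm, 'p, 'n) nlc_M
   \<Rightarrow> ('t, 'm, 'p, 'n) nlc_N \<Rightarrow> (('t, 'm) jet_point, ('p, 'n) jet_coord) vfield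
   \<Rightarrow> (('t, 'm) jet_point, ('p, 'n) jet_coord) vfield" where
  "proj_v AT AM M N X = (\<lambda>e. if e \<in> J1 AT AM
     then dsum_proj (dist_V AT AM e) (dist_T AT AM M e) (dist_M AT AM N e) (X e) else (\<lambda>d. 0))"


section \<open>Gamma-linear connections and their components\<close>

definition Gamma_linear_connection ::
  "('t, real^'p::finite) chart set \<Rightarrow> ('m, real^'n::finite) chart set \<Rightarrow> ('t, 'm, 'p, 'n) nlc_M
   \<Rightarrow> ('t, 'm, 'p, 'n) nlc_N \<Rightarrow> (('t, 'm) jet_point, ('p, 'n) jet_coord) conn \<Rightarrow> bool" where
  "Gamma_linear_connection AT AM M N nab \<longleftrightarrow>
     linear_connection (jet_atlas AT AM) nab \<and>
     (\<forall>X\<in>vector_fields (jet_atlas AT AM). \<forall>Y\<in>vector_fields (jet_atlas AT AM).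
        nab X (proj_hT AT AM M N Y) = proj_hT AT AM M N (nab X Y) \<and>
        nab X (proj_hM AT AM M N Y) = proj_hM AT AM M N (nab X Y) \<and>
        nab X (proj_v AT AM M N Y) = proj_v AT AM M N (nab X Y))"

text \<open>The fields ending in \<open>b\<close> are the barred components. The index arguments are listed with all
  upper indices first, each row from left to right: \<open>Gb w ab e \<alpha> \<beta> \<gamma>\<close> has upper index \<open>\<alpha>\<close> and lower
  indices \<open>\<beta>\<gamma>\<close>; \<open>Gm w ab e k i \<gamma>\<close> is \<open>G\<^bsup>k\<^esup>\<^bsub>i\<gamma>\<^esub>\<close>; \<open>Gv w ab e k \<beta> \<alpha> i \<gamma>\<close> is \<open>G\<^bsup>(k)(\<beta>)\<^esup>\<^bsub>(\<alpha>)(i)\<gamma>\<^esub>\<close>;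
  \<open>Cb w ab e \<alpha> \<gamma> \<beta> j\<close> has upper indices \<open>\<alpha>(\<gamma>)\<close> and lower indices \<open>\<beta>(j)\<close>; \<open>Cm w ab e k \<gamma> i j\<close> is
  \<open>C\<^bsup>k(\<gamma>)\<^esup>\<^bsub>i(j)\<^esub>\<close>; \<open>Cv w ab e k \<beta> \<gamma> \<alpha> i j\<close> is \<open>C\<^bsup>(k)(\<beta>)(\<gamma>)\<^esup>\<^bsub>(\<alpha>)(i)(j)\<^esub>\<close>; the \<open>L\<close> fields are like the
  \<open>G\<close> fields.\<close>

record ('c, 'e, 'p, 'n) nine_components =
  Gb :: "'c \<Rightarrow> 'e \<Rightarrow> 'p \<Rightarrow> 'p \<Rightarrow> 'p \<Rightarrow> real"
  Gm :: "'c \<Rightarrow> 'e \<Rightarrow> 'n \<Rightarrow> 'n \<Rightarrow> 'p \<Rightarrow> real"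
  Gv :: "'c \<Rightarrow> 'e \<Rightarrow> 'n \<Rightarrow> 'p \<Rightarrow> 'p \<Rightarrow> 'n \<Rightarrow> 'p \<Rightarrow> real"
  Lb :: "'c \<Rightarrow> 'e \<Rightarrow> 'p \<Rightarrow> 'p \<Rightarrow> 'n \<Rightarrow> real"
  Lm :: "'c \<Rightarrow> 'e \<Rightarrow> 'n \<Rightarrow> 'n \<Rightarrow> 'n \<Rightarrow> real"
  Lv :: "'c \<Rightarrow> 'e \<Rightarrow> 'n \<Rightarrow> 'p \<Rightarrow> 'p \<Rightarrow> 'n \<Rightarrow> 'n \<Rightarrow> real"
  Cb :: "'c \<Rightarrow> 'e \<Rightarrow> 'p \<Rightarrow> 'p \<Rightarrow> 'p \<Rightarrow> 'n \<Rightarrow> real"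
  Cm :: "'c \<Rightarrow> 'e \<Rightarrow> 'n \<Rightarrow> 'p \<Rightarrow> 'n \<Rightarrow> 'n \<Rightarrow> real"
  Cv :: "'c \<Rightarrow> 'e \<Rightarrow> 'n \<Rightarrow> 'p \<Rightarrow> 'p \<Rightarrow> 'p \<Rightarrow> 'n \<Rightarrow> 'n \<Rightarrow> real"

type_synonym ('t, 'm, 'p, 'n) ncomp =
  "(('t, 'm, 'p, 'n) cpair, ('t, 'm) jet_point, 'p, 'n) nine_components"

text \<open>The components in a chart are functions on the chart domain only; as HOL functions they are
  extended by \<open>0\<close>.\<close>

definition supported_on_charts ::
  "('t, real^'p::finite) chart set \<Rightarrow> ('m, real^'n::finite) chart set
   \<Rightarrow> ('t, 'm, 'p, 'n) ncomp \<Rightarrow> bool" where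
  "supported_on_charts AT AM w \<longleftrightarrow>
     (\<forall>ab e. \<not> (ab \<in> AT \<times> AM \<and> e \<in> fst (jet_chart AT AM ab)) \<longrightarrow>
        (\<forall>\<alpha> \<beta> \<gamma>. Gb w ab e \<alpha> \<beta> \<gamma> = 0) \<and>
        (\<forall>k i \<gamma>. Gm w ab e k i \<gamma> = 0) \<and>
        (\<forall>k \<beta> \<alpha> i \<gamma>. Gv w ab e k \<beta> \<alpha> i \<gamma> = 0) \<and>
        (\<forall>\<alpha> \<beta> j. Lb w ab e \<alpha> \<beta> j = 0) \<and>
        (\<forall>k i j. Lm w ab e k i j = 0) \<and>
        (\<forall>k \<beta> \<alpha> i j. Lv w ab e k \<beta> \<alpha> i j = 0) \<and>
        (\<forall>\<alpha> \<gamma> \<beta> j. Cb w ab e \<alpha> \<gamma> \<beta> j = 0) \<and>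
        (\<forall>k \<gamma> i j. Cm w ab e k \<gamma> i j = 0) \<and>
        (\<forall>k \<beta> \<gamma> \<alpha> i j. Cv w ab e k \<beta> \<gamma> \<alpha> i j = 0))"

definition smooth_components ::
  "('t, real^'p::finite) chart set \<Rightarrow> ('m, real^'n::finite) chart set
   \<Rightarrow> ('t, 'm, 'p, 'n) ncomp \<Rightarrow> bool" where
  "smooth_components AT AM w \<longleftrightarrow>
     (\<forall>ab\<in>AT \<times> AM. let sm = smooth_in_chart (jet_chart AT AM ab) in
        (\<forall>\<alpha> \<beta> \<gamma>. sm (\<lambda>e. Gb w ab e \<alpha> \<beta> \<gamma>)) \<and>
        (\<forall>k i \<gamma>. sm (\<lambda>e. Gm w ab e k i \<gamma>)) \<and>
        (\<forall>k \<beta> \<alpha> i \<gamma>. sm (\<lambda>e. Gv w ab e k \<beta> \<alpha> i \<gamma>)) \<and>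
        (\<forall>\<alpha> \<beta> j. sm (\<lambda>e. Lb w ab e \<alpha> \<beta> j)) \<and>
        (\<forall>k i j. sm (\<lambda>e. Lm w ab e k i j)) \<and>
        (\<forall>k \<beta> \<alpha> i j. sm (\<lambda>e. Lv w ab e k \<beta> \<alpha> i j)) \<and>
        (\<forall>\<alpha> \<gamma> \<beta> j. sm (\<lambda>e. Cb w ab e \<alpha> \<gamma> \<beta> j)) \<and>
        (\<forall>k \<gamma> i j. sm (\<lambda>e. Cm w ab e k \<gamma> i j)) \<and>
        (\<forall>k \<beta> \<gamma> \<alpha> i j. sm (\<lambda>e. Cv w ab e k \<beta> \<gamma> \<alpha> i j)))"

definition is_local_components ::
  "('t, real^'p::finite) chart set \<Rightarrow> ('m, real^'n::finite) chart set \<Rightarrow> ('t, 'm, 'p, 'n) nlc_M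
   \<Rightarrow> ('t, 'm, 'p, 'n) nlc_N \<Rightarrow> (('t, 'm) jet_point, ('p, 'n) jet_coord) conn
   \<Rightarrow> ('t, 'm, 'p, 'n) ncomp \<Rightarrow> bool" where
  "is_local_components AT AM M N nab w \<longleftrightarrow>
     supported_on_charts AT AM w \<and>
     (\<forall>ab\<in>AT \<times> AM. \<forall>e\<in>fst (jet_chart AT AM ab).
        let D = conn_local (jet_atlas AT AM) nab;
            dt = basis_t AT AM M ab; dx = basis_x AT AM N ab; dv = basis_v AT AM ab in
        (\<forall>\<gamma> \<beta>. D (dt \<gamma>) (dt \<beta>) e = (\<lambda>d. \<Sum>\<alpha>\<in>UNIV. Gb w ab e \<alpha> \<beta> \<gamma> *\<^sub>R dt \<alpha> e d)) \<and>
        (\<forall>\<gamma> i. D (dt \<gamma>) (dx i) e = (\<lambda>d. \<Sum>k\<in>UNIV. Gm w ab e k i \<gamma> *\<^sub>R dx k e d)) \<and>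
        (\<forall>\<gamma> i \<beta>. D (dt \<gamma>) (dv i \<beta>) e =
           (\<lambda>d. \<Sum>k\<in>UNIV. \<Sum>\<alpha>\<in>UNIV. Gv w ab e k \<beta> \<alpha> i \<gamma> *\<^sub>R dv k \<alpha> e d)) \<and>
        (\<forall>j \<beta>. D (dx j) (dt \<beta>) e = (\<lambda>d. \<Sum>\<alpha>\<in>UNIV. Lb w ab e \<alpha> \<beta> j *\<^sub>R dt \<alpha> e d)) \<and>
        (\<forall>j i. D (dx j) (dx i) e = (\<lambda>d. \<Sum>k\<in>UNIV. Lm w ab e k i j *\<^sub>R dx k e d)) \<and>
        (\<forall>j i \<beta>. D (dx j) (dv i \<beta>) e =
           (\<lambda>d. \<Sum>k\<in>UNIV. \<Sum>\<alpha>\<in>UNIV. Lv w ab e k \<beta> \<alpha> i j *\<^sub>R dv k \<alpha> e d)) \<and>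
        (\<forall>j \<gamma> \<beta>. D (dv j \<gamma>) (dt \<beta>) e =
           (\<lambda>d. \<Sum>\<alpha>\<in>UNIV. Cb w ab e \<alpha> \<gamma> \<beta> j *\<^sub>R dt \<alpha> e d)) \<and>
        (\<forall>j \<gamma> i. D (dv j \<gamma>) (dx i) e =
           (\<lambda>d. \<Sum>k\<in>UNIV. Cm w ab e k \<gamma> i j *\<^sub>R dx k e d)) \<and>
        (\<forall>j \<gamma> i \<beta>. D (dv j \<gamma>) (dv i \<beta>) e =
           (\<lambda>d. \<Sum>k\<in>UNIV. \<Sum>\<alpha>\<in>UNIV. Cv w ab e k \<beta> \<gamma> \<alpha> i j *\<^sub>R dv k \<alpha> e d)))"


section \<open>The transformation rules\<close>

text \<open>In each rule \<open>(a, b)\<close> gives the coordinates \<open>(t, x)\<close> and \<open>(a', b')\<close> the new (tilded)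
  coordinates. At the jet \<open>e\<close>, \<open>t' \<mu> \<alpha>\<close> is the derivative of the \<open>\<mu>\<close>-th new coordinate by
  \<open>t\<^sup>\<alpha>\<close>, \<open>t0 \<alpha> \<mu>\<close> is the derivative of \<open>t\<^sup>\<alpha>\<close> by the \<open>\<mu>\<close>-th new coordinate, and similarly
  \<open>x'\<close> and \<open>x0\<close>.\<close>

definition rules_hT ::
  "('t, 'm, 'p::finite, 'n::finite) ncomp \<Rightarrow> ('t, 'm, 'p, 'n) cpair \<Rightarrow> ('t, 'm, 'p, 'n) cpair
   \<Rightarrow> ('t, 'm) jet_point \<Rightarrow> bool" where
  "rules_hT w = (\<lambda>(a, b) (a', b') e.
     let t' = dcoord a a' (base_t e); t0 = dcoord a' a (base_t e);
         x' = dcoord b b' (base_x e); x0 = dcoord b' b (base_x e) in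
     (\<forall>\<alpha> \<beta> \<epsilon>.
        (\<Sum>\<delta>\<in>UNIV. Gb w (a, b) e \<delta> \<alpha> \<beta> * t' \<epsilon> \<delta>) =
        (\<Sum>\<mu>\<in>UNIV. \<Sum>\<gamma>\<in>UNIV. Gb w (a', b') e \<epsilon> \<mu> \<gamma> * t' \<mu> \<alpha> * t' \<gamma> \<beta>)
        + d2coord a a' (base_t e) \<epsilon> \<alpha> \<beta>) \<and>
     (\<forall>k i \<gamma>.
        Gm w (a, b) e k i \<gamma> =
        (\<Sum>m\<in>UNIV. \<Sum>j\<in>UNIV. \<Sum>\<beta>\<in>UNIV. Gm w (a', b') e m j \<beta> * x0 k m * x' j i * t' \<beta> \<gamma>)) \<and>
     (\<forall>k \<beta> \<gamma> i \<alpha>.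
        Gv w (a, b) e k \<beta> \<gamma> i \<alpha> =
        (\<Sum>p\<in>UNIV. \<Sum>\<eta>\<in>UNIV. \<Sum>\<epsilon>\<in>UNIV. \<Sum>j\<in>UNIV. \<Sum>\<mu>\<in>UNIV.
           Gv w (a', b') e p \<eta> \<epsilon> j \<mu> * x0 k p * t' \<epsilon> \<gamma> * x' j i * t0 \<beta> \<eta> * t' \<mu> \<alpha>)
        + (if k = i then 1 else 0) *
          (\<Sum>\<mu>\<in>UNIV. \<Sum>\<epsilon>\<in>UNIV. t' \<mu> \<alpha> * t' \<epsilon> \<gamma> * d2coord a' a (base_t e) \<beta> \<mu> \<epsilon>)))"

definition rules_hM ::
  "('t, 'm, 'p::finite, 'n::finite) ncomp \<Rightarrow> ('t, 'm, 'p, 'n) cpair \<Rightarrow> ('t, 'm, 'p, 'n) cpair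
   \<Rightarrow> ('t, 'm) jet_point \<Rightarrow> bool" where
  "rules_hM w = (\<lambda>(a, b) (a', b') e.
     let t' = dcoord a a' (base_t e); t0 = dcoord a' a (base_t e);
         x' = dcoord b b' (base_x e); x0 = dcoord b' b (base_x e) in
     (\<forall>\<gamma> \<beta> l.
        (\<Sum>j\<in>UNIV. Lb w (a, b) e \<gamma> \<beta> j * x0 j l) =
        (\<Sum>\<eta>\<in>UNIV. \<Sum>\<mu>\<in>UNIV. Lb w (a', b') e \<eta> \<mu> l * t0 \<gamma> \<eta> * t' \<mu> \<beta>)) \<and>
     (\<forall>i j r.
        (\<Sum>m\<in>UNIV. Lm w (a, b) e m i j * x' r m) =
        (\<Sum>p\<in>UNIV. \<Sum>q\<in>UNIV. Lm w (a', b') e r p q * x' p i * x' q j)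
        + d2coord b b' (base_x e) r i j) \<and>
     (\<forall>k \<beta> \<gamma> i j.
        Lv w (a, b) e k \<beta> \<gamma> i j =
        (\<Sum>r\<in>UNIV. \<Sum>\<eta>\<in>UNIV. \<Sum>\<nu>\<in>UNIV. \<Sum>p\<in>UNIV. \<Sum>l\<in>UNIV.
           Lv w (a', b') e r \<eta> \<nu> p l * x0 k r * t' \<nu> \<gamma> * x' p i * t0 \<beta> \<eta> * x' l j)
        + (if \<beta> = \<gamma> then 1 else 0) *
          (\<Sum>r\<in>UNIV. x0 k r * d2coord b b' (base_x e) r i j)))"

definition rules_v ::
  "('t, 'm, 'p::finite, 'n::finite) ncomp \<Rightarrow> ('t, 'm, 'p, 'n) cpair \<Rightarrow> ('t, 'm, 'p, 'n) cpair
   \<Rightarrow> ('t, 'm) jet_point \<Rightarrow> bool" where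
  "rules_v w = (\<lambda>(a, b) (a', b') e.
     let t' = dcoord a a' (base_t e); t0 = dcoord a' a (base_t e);
         x' = dcoord b b' (base_x e); x0 = dcoord b' b (base_x e) in
     (\<forall>\<gamma> \<alpha> \<beta> i.
        Cb w (a, b) e \<gamma> \<alpha> \<beta> i =
        (\<Sum>\<mu>\<in>UNIV. \<Sum>\<delta>\<in>UNIV. \<Sum>\<epsilon>\<in>UNIV. \<Sum>j\<in>UNIV.
           Cb w (a', b') e \<mu> \<delta> \<epsilon> j * t0 \<gamma> \<mu> * t' \<epsilon> \<beta> * x' j i * t0 \<alpha> \<delta>)) \<and>
     (\<forall>k \<alpha> i j.
        Cm w (a, b) e k \<alpha> i j =
        (\<Sum>s\<in>UNIV. \<Sum>\<beta>\<in>UNIV. \<Sum>p\<in>UNIV. \<Sum>r\<in>UNIV.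
           Cm w (a', b') e s \<beta> p r * x0 k s * x' p i * x' r j * t0 \<alpha> \<beta>)) \<and>
     (\<forall>k \<beta> \<alpha> \<gamma> i j.
        Cv w (a, b) e k \<beta> \<alpha> \<gamma> i j =
        (\<Sum>r\<in>UNIV. \<Sum>\<mu>\<in>UNIV. \<Sum>\<nu>\<in>UNIV. \<Sum>\<epsilon>\<in>UNIV. \<Sum>p\<in>UNIV. \<Sum>q\<in>UNIV.
           Cv w (a', b') e r \<mu> \<nu> \<epsilon> p q
           * x0 k r * t' \<epsilon> \<gamma> * x' p i * t0 \<beta> \<mu> * x' q j * t0 \<alpha> \<nu>)))"

definition transformation_rules ::
  "('t, real^'p::finite) chart set \<Rightarrow> ('m, real^'n::finite) chart set
   \<Rightarrow> ('t, 'm, 'p, 'n) ncomp \<Rightarrow> bool" where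
  "transformation_rules AT AM w \<longleftrightarrow>
     (\<forall>ab\<in>AT \<times> AM. \<forall>ab'\<in>AT \<times> AM.
        \<forall>e\<in>fst (jet_chart AT AM ab) \<inter> fst (jet_chart AT AM ab').
          rules_hT w ab ab' e \<and> rules_hM w ab ab' e \<and> rules_v w ab ab' e)"

end

theory Submission
  imports Defs
begin

text \<open>
  In the adapted frame of \<open>\<Gamma>\<close> a linear connection on \<open>E\<close> is a family of bilinear maps
  \<open>G\<close>, one for each chart and point: \<open>\<nabla>\<^sub>X Y\<close> has frame components \<open>X(Y) + G(X, Y)\<close>, where on the
  right \<open>X\<close> and \<open>Y\<close> stand for frame components, and such a family comes from a connection iff
  \<open>P (G(u, v)) = G'(P u, P v) + (\<partial>\<^sub>u P) v\<close> for the change \<open>P\<close> of adapted frames. Extending germs of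
  fields to global ones, which makes \<open>G\<close> well defined, uses bump functions and hence the
  Hausdorff property of \<open>E\<close>.

  The transformation rules of \<open>M\<close> and \<open>N\<close> say exactly that \<open>P\<close> is block diagonal, with blocks
  \<open>\<partial>t'/\<partial>t\<close>, \<open>\<partial>x'/\<partial>x\<close> and \<open>\<partial>x'/\<partial>x \<otimes> \<partial>t/\<partial>t'\<close>. A connection is \<open>\<Gamma>\<close>-linear iff each \<open>G(u, \<cdot>)\<close>
  preserves the three blocks. Then \<open>G\<close> has nine components, and evaluating the identity for \<open>P\<close>
  on pairs of basis vectors gives the nine rules.
\<close>

section \<open>Calculus of smooth maps\<close>

text \<open>Along the base directions the fibre coordinates of a chart change have derivatives that
  involve second derivatives of both base changes. They are never computed: the same terms stand in
  the rules for \<open>M\<close> and \<open>N\<close> and cancel. Only the fibre direction, in which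
  the change is affine, is differentiated explicitly. The blocks of \<open>P\<close> depend on the
  base point alone, and each of the first two on one factor only. Hence \<open>P\<close> has zero
  derivative in vertical directions, and just four rules are inhomogeneous: those for
  \<open>Gb\<close>, \<open>Gv\<close>, \<open>Lm\<close> and \<open>Lv\<close>. In
  \<open>Gv\<close> the old coordinates are differentiated by the new ones because the third block
  contains the inverse Jacobian, a function on the new chart. The obstacle is locality. Components
  refer to fields on a chart domain, while the axioms of a connection know only global fields and
  functions; every local computation is therefore made with global objects that agree near the point
  with frame fields and coordinates. Both halves of the theorem come from one equivalence between
  the identity for \<open>P\<close> and the rules. Components vanish off their chart, so the
  correspondence is a bijection of actual HOL values.\<close>

lemma Ck_on_subset: "Ck_on k T f \<Longrightarrow> S \<subseteq> T \<Longrightarrow> Ck_on k S f"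
  by (induction k arbitrary: f) (auto intro: continuous_on_subset)

text \<open>\<open>frechet_derivative\<close> at a point looks at a full neighbourhood, so agreement
  on \<open>S\<close> determines it because \<open>S\<close> is open.\<close>

lemma Ck_on_cong:
  assumes "open S" "\<And>x. x \<in> S \<Longrightarrow> f x = g x" "Ck_on k S f"
  shows "Ck_on k S g"
  using assms(2,3)
proof (induction k arbitrary: f g)
  case 0
  then show ?case by (simp cong: continuous_on_cong)
next
  case (Suc k)
  have d: "g differentiable (at x) \<and> frechet_derivative f (at x) = frechet_derivative g (at x)"
    if "x \<in> S" for x
  proof -
    have f: "f differentiable (at x)" using Suc.prems that by simp
    then have "(f has_derivative frechet_derivative f (at x)) (at x)"
      by (simp add: frechet_derivative_works)
    then have "(g has_derivative frechet_derivative f (at x)) (at x)"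
      by (rule has_derivative_transform_within_open[OF _ assms(1) that]) (use Suc.prems in auto)
    then show ?thesis
      using frechet_derivative_at differentiable_def by blast
  qed
  have "Ck_on k S (\<lambda>x. frechet_derivative g (at x) v)" for v
    by (rule Suc.IH[of "\<lambda>x. frechet_derivative f (at x) v"]) (use d Suc.prems in auto)
  with d show ?case by simp
qed

lemma Ck_on_SucD: "Ck_on (Suc k) S f \<Longrightarrow> Ck_on k S f"
proof (induction k arbitrary: f)
  case 0
  then show ?case
    by (simp add: continuous_at_imp_continuous_on differentiable_imp_continuous_within)
next
  case (Suc k)
  then show ?case by (metis Ck_on.simps(2))
qed

lemma Ck_on_local:
  assumes "\<And>x. x \<in> S \<Longrightarrow> \<exists>T. open T \<and> x \<in> T \<and> Ck_on k T f"
  shows "Ck_on k S f"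
  using assms
proof (induction k arbitrary: f)
  case 0
  have "isCont f x" if "x \<in> S" for x
    using 0[OF that] continuous_on_eq_continuous_at by auto
  then show ?case by (simp add: continuous_at_imp_continuous_on)
next
  case (Suc k)
  have "Ck_on k S (\<lambda>x. frechet_derivative f (at x) v)" for v
  proof (rule Suc.IH)
    fix x assume "x \<in> S"
    from Suc.prems[OF this] obtain T where "open T" "x \<in> T" "Ck_on (Suc k) T f" by blast
    then show "\<exists>T. open T \<and> x \<in> T \<and> Ck_on k T (\<lambda>x. frechet_derivative f (at x) v)" by auto
  qed
  moreover have "f differentiable (at x)" if "x \<in> S" for x
    using Suc.prems[OF that] by auto
  ultimately show ?case by simp
qed

lemma Ck_on_const: "Ck_on k S (\<lambda>x. c)"
  by (induction k arbitrary: c) auto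

lemma frechet_derivativeI:
  "(f has_derivative f') (at x) \<Longrightarrow> f differentiable (at x) \<and> frechet_derivative f (at x) = f'"
  using frechet_derivative_at differentiable_def by metis

text \<open>\<open>frechet_derivative\<close> is a choice operator; uniqueness of derivatives lets
  any explicit candidate replace it, which is how all later closure properties are proved.\<close>

lemma Ck_on_SucI:
  assumes "open S" and "\<And>x. x \<in> S \<Longrightarrow> (f has_derivative f' x) (at x)"
    and "\<And>v. Ck_on k S (\<lambda>x. f' x v)"
  shows "Ck_on (Suc k) S f"
proof -
  have "Ck_on k S (\<lambda>x. frechet_derivative f (at x) v)" for v
    by (rule Ck_on_cong[OF assms(1) _ assms(3)[of v]])
      (use frechet_derivativeI[OF assms(2)] in auto)
  then show ?thesis using frechet_derivativeI[OF assms(2)] by simp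
qed

lemma Ck_on_has_derivative:
  "Ck_on (Suc k) S f \<Longrightarrow> x \<in> S \<Longrightarrow> (f has_derivative frechet_derivative f (at x)) (at x)"
  by (simp add: frechet_derivative_works)

lemma Ck_on_ident: "open S \<Longrightarrow> Ck_on k S (\<lambda>x. x)"
  by (cases k) (auto intro!: Ck_on_SucI[where f'="\<lambda>x v. v"] Ck_on_const simp del: Ck_on.simps(2))

lemma Ck_on_add:
  "open S \<Longrightarrow> Ck_on k S f \<Longrightarrow> Ck_on k S g \<Longrightarrow> Ck_on k S (\<lambda>x. f x + g x)"
proof (induction k arbitrary: f g)
  case 0
  then show ?case by (simp add: continuous_on_add)
next
  case (Suc k)
  show ?case
    by (rule Ck_on_SucI[OF Suc.prems(1) has_derivative_add[OF Ck_on_has_derivative[OF Suc.prems(2)]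
          Ck_on_has_derivative[OF Suc.prems(3)]]]) (use Suc in auto)
qed

lemma Ck_on_bounded_linear:
  "bounded_linear L \<Longrightarrow> open S \<Longrightarrow> Ck_on k S f \<Longrightarrow> Ck_on k S (\<lambda>x. L (f x))"
proof (induction k arbitrary: f)
  case 0
  then show ?case by (simp add: linear_continuous_on_compose bounded_linear.continuous_on)
next
  case (Suc k)
  show ?case
    by (rule Ck_on_SucI[OF Suc.prems(2)
          bounded_linear.has_derivative[OF Suc.prems(1) Ck_on_has_derivative[OF Suc.prems(3)]]])
      (use Suc in auto)
qed

lemma Ck_on_bounded_bilinear:
  assumes "bounded_bilinear L" "open S"
  shows "Ck_on k S f \<Longrightarrow> Ck_on k S g \<Longrightarrow> Ck_on k S (\<lambda>x. L (f x) (g x))"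
proof (induction k arbitrary: f g)
  case 0
  then show ?case by (simp add: bounded_bilinear.continuous_on[OF assms(1)])
next
  case (Suc k)
  \<comment> \<open>The product rule pairs each factor with a derivative of the other, so both
    factors themselves are needed one class lower.\<close>
  have "Ck_on k S f" "Ck_on k S g" using Suc.prems Ck_on_SucD by blast+
  then show ?case
    using Suc.prems
    by (intro Ck_on_SucI[OF assms(2) bounded_bilinear.FDERIV[OF assms(1)
          Ck_on_has_derivative[OF Suc.prems(1)] Ck_on_has_derivative[OF Suc.prems(2)]]])
      (auto intro!: Ck_on_add[OF assms(2)] Suc.IH)
qed

lemma Ck_on_sum:
  "finite I \<Longrightarrow> open S \<Longrightarrow> (\<And>i. i \<in> I \<Longrightarrow> Ck_on k S (f i)) \<Longrightarrow> Ck_on k S (\<lambda>x. \<Sum>i\<in>I. f i x)"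
  by (induction I rule: finite_induct) (auto intro!: Ck_on_const Ck_on_add)

lemma linear_sum_Basis:
  fixes v :: "'a::euclidean_space"
  assumes "linear L"
  shows "L v = (\<Sum>b\<in>Basis. (v \<bullet> b) *\<^sub>R L b)"
proof -
  have "L v = L (\<Sum>b\<in>Basis. (v \<bullet> b) *\<^sub>R b)" by (simp add: euclidean_representation)
  also have "\<dots> = (\<Sum>b\<in>Basis. (v \<bullet> b) *\<^sub>R L b)"
    by (simp add: linear_sum[OF assms] linear_scale[OF assms])
  finally show ?thesis .
qed

text \<open>\<open>Ck_on\<close> controls derivatives in fixed directions, but the chain rule
  differentiates \<open>f\<close> in the moving direction \<open>Dg(x) v\<close>. Expanding that
  direction in a basis gives a finite sum of products to which the induction hypothesis applies;
  this is why the middle space is Euclidean.\<close>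

lemma Ck_on_compose:
  fixes g :: "'a::real_normed_vector \<Rightarrow> 'b::euclidean_space"
  assumes "open S" "g ` S \<subseteq> T"
  shows "Ck_on k T f \<Longrightarrow> Ck_on k S g \<Longrightarrow> Ck_on k S (\<lambda>x. f (g x))"
proof (induction k arbitrary: f)
  case 0
  then show ?case using assms(2) by (auto intro: continuous_on_compose2)
next
  case (Suc k)
  have g: "(g has_derivative frechet_derivative g (at x)) (at x)" if "x \<in> S" for x
    by (rule Ck_on_has_derivative[OF Suc.prems(2) that])
  have f: "(f has_derivative frechet_derivative f (at (g x))) (at (g x))" if "x \<in> S" for x
    by (rule Ck_on_has_derivative[OF Suc.prems(1)]) (use assms(2) that in auto)
  let ?D = "\<lambda>x v. \<Sum>b\<in>Basis. (frechet_derivative g (at x) v \<bullet> b) *\<^sub>R frechet_derivative f (at (g x)) b"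
  have "((\<lambda>x. f (g x)) has_derivative ?D x) (at x)" if "x \<in> S" for x
  proof -
    have "((\<lambda>x. f (g x)) has_derivative
        (\<lambda>v. frechet_derivative f (at (g x)) (frechet_derivative g (at x) v))) (at x)"
      using diff_chain_at[OF g[OF that] f[OF that]] by (simp add: o_def)
    moreover have "linear (frechet_derivative f (at (g x)))"
      using f[OF that] has_derivative_linear by blast
    ultimately show ?thesis by (subst (asm) linear_sum_Basis) auto
  qed
  moreover have "Ck_on k S (\<lambda>x. ?D x v)" for v
    using Suc assms(1)
    by (intro Ck_on_sum Ck_on_bounded_bilinear[OF bounded_bilinear_scaleR]
        Ck_on_bounded_linear[OF bounded_linear_inner_left] Suc.IH Ck_on_SucD[OF Suc.prems(2)]) auto
  ultimately show ?case by (rule Ck_on_SucI[OF assms(1)])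
qed

lemma smooth_on_subset: "smooth_on T f \<Longrightarrow> S \<subseteq> T \<Longrightarrow> smooth_on S f"
  unfolding smooth_on_def using Ck_on_subset by blast

lemma smooth_on_cong:
  "smooth_on S f \<Longrightarrow> open S \<Longrightarrow> (\<And>x. x \<in> S \<Longrightarrow> f x = g x) \<Longrightarrow> smooth_on S g"
  unfolding smooth_on_def using Ck_on_cong by blast

lemma smooth_on_local:
  "(\<And>x. x \<in> S \<Longrightarrow> \<exists>T. open T \<and> x \<in> T \<and> smooth_on T f) \<Longrightarrow> smooth_on S f"
  unfolding smooth_on_def by (meson Ck_on_local)

lemma smooth_on_const: "smooth_on S (\<lambda>x. c)"
  unfolding smooth_on_def using Ck_on_const by blast

lemma smooth_on_ident: "open S \<Longrightarrow> smooth_on S (\<lambda>x. x)"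
  unfolding smooth_on_def using Ck_on_ident by blast

lemma smooth_on_add:
  "open S \<Longrightarrow> smooth_on S f \<Longrightarrow> smooth_on S g \<Longrightarrow> smooth_on S (\<lambda>x. f x + g x)"
  unfolding smooth_on_def using Ck_on_add by blast

lemma smooth_on_bounded_linear:
  "bounded_linear L \<Longrightarrow> open S \<Longrightarrow> smooth_on S f \<Longrightarrow> smooth_on S (\<lambda>x. L (f x))"
  unfolding smooth_on_def using Ck_on_bounded_linear by blast

lemma smooth_on_minus:
  "open S \<Longrightarrow> smooth_on S f \<Longrightarrow> smooth_on S (\<lambda>x. - f x)"
  using smooth_on_bounded_linear[OF bounded_linear_minus[OF bounded_linear_ident]] by blast

lemma smooth_on_diff:
  "open S \<Longrightarrow> smooth_on S f \<Longrightarrow> smooth_on S g \<Longrightarrow> smooth_on S (\<lambda>x. f x - g x)"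
  using smooth_on_add[of S f "\<lambda>x. - g x"] smooth_on_minus[of S g] by simp

lemma smooth_on_bounded_bilinear:
  "bounded_bilinear L \<Longrightarrow> open S \<Longrightarrow> smooth_on S f \<Longrightarrow> smooth_on S g \<Longrightarrow>
    smooth_on S (\<lambda>x. L (f x) (g x))"
  unfolding smooth_on_def using Ck_on_bounded_bilinear by blast

lemmas smooth_on_scaleR = smooth_on_bounded_bilinear[OF bounded_bilinear_scaleR]
lemmas smooth_on_mult = smooth_on_bounded_bilinear[OF bounded_bilinear_mult]
lemmas smooth_on_inner = smooth_on_bounded_bilinear[OF bounded_bilinear_inner]
lemmas smooth_on_fst = smooth_on_bounded_linear[OF bounded_linear_fst]
lemmas smooth_on_snd = smooth_on_bounded_linear[OF bounded_linear_snd]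
lemmas smooth_on_vec_nth = smooth_on_bounded_linear[OF bounded_linear_vec_nth]

lemma smooth_on_sum:
  "finite I \<Longrightarrow> open S \<Longrightarrow> (\<And>i. i \<in> I \<Longrightarrow> smooth_on S (f i)) \<Longrightarrow> smooth_on S (\<lambda>x. \<Sum>i\<in>I. f i x)"
  unfolding smooth_on_def using Ck_on_sum by blast

lemma smooth_on_compose:
  fixes g :: "'a::real_normed_vector \<Rightarrow> 'b::euclidean_space"
  shows "smooth_on T f \<Longrightarrow> smooth_on S g \<Longrightarrow> open S \<Longrightarrow> g ` S \<subseteq> T \<Longrightarrow> smooth_on S (\<lambda>x. f (g x))"
  unfolding smooth_on_def using Ck_on_compose by blast

lemma smooth_on_Pair:
  assumes "open S" "smooth_on S f" "smooth_on S g"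
  shows "smooth_on S (\<lambda>x. (f x, g x))"
proof -
  have "smooth_on S (\<lambda>x. (f x, 0) + (0, g x))"
    by (intro smooth_on_add assms smooth_on_bounded_linear[of "\<lambda>y. (y, 0)" S f]
        smooth_on_bounded_linear[of "\<lambda>y. (0, y)" S g] bounded_linear_Pair
        bounded_linear_ident bounded_linear_zero)
  then show ?thesis by simp
qed

lemma smooth_on_vec_lambda:
  fixes f :: "'i::finite \<Rightarrow> 'a::real_normed_vector \<Rightarrow> 'b::euclidean_space"
  assumes "open S" "\<And>i. smooth_on S (f i)"
  shows "smooth_on S (\<lambda>x. \<chi> i. f i x)"
proof -
  have ax: "bounded_linear (axis i :: 'b \<Rightarrow> 'b^'i)" for i
    unfolding linear_conv_bounded_linear[symmetric]
    by (rule linearI) (auto simp: vec_eq_iff axis_def)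
  have "(\<chi> i. f i x) = (\<Sum>i\<in>UNIV. axis i (f i x))" for x
    by (simp add: vec_eq_iff axis_def)
  then show ?thesis
    by (simp, intro smooth_on_sum smooth_on_bounded_linear[OF ax] assms) auto
qed

lemma smooth_on_differentiable: "smooth_on S f \<Longrightarrow> x \<in> S \<Longrightarrow> f differentiable (at x)"
  unfolding smooth_on_def by (meson Ck_on.simps(2))

lemma smooth_on_has_derivative:
  "smooth_on S f \<Longrightarrow> x \<in> S \<Longrightarrow> (f has_derivative frechet_derivative f (at x)) (at x)"
  using smooth_on_differentiable frechet_derivative_works by blast

lemma smooth_on_continuous_on: "smooth_on S f \<Longrightarrow> continuous_on S f"
  unfolding smooth_on_def by (meson Ck_on.simps(1))

lemma smooth_on_frechet_derivative: "smooth_on S f \<Longrightarrow> smooth_on S (\<lambda>x. frechet_derivative f (at x) v)"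
  unfolding smooth_on_def by (metis Ck_on.simps(2))

lemma smooth_on_linear_apply:
  fixes g :: "'a::real_normed_vector \<Rightarrow> 'b::euclidean_space"
  assumes "open S" "\<And>x. x \<in> S \<Longrightarrow> linear (L x)" "\<And>b. b \<in> Basis \<Longrightarrow> smooth_on S (\<lambda>x. L x b)"
    and "smooth_on S g"
  shows "smooth_on S (\<lambda>x. L x (g x))"
proof (rule smooth_on_cong[OF _ assms(1)])
  show "smooth_on S (\<lambda>x. \<Sum>b\<in>Basis. (g x \<bullet> b) *\<^sub>R L x b)"
    using assms by (intro smooth_on_sum smooth_on_scaleR smooth_on_inner smooth_on_const) auto
qed (use assms(2) in \<open>simp add: linear_sum_Basis[symmetric]\<close>)

lemma smooth_on_frechet_derivative_apply:
  fixes g :: "'a::euclidean_space \<Rightarrow> 'a"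
  assumes "open S" "smooth_on S f" "smooth_on S g"
  shows "smooth_on S (\<lambda>x. frechet_derivative f (at x) (g x))"
proof (rule smooth_on_linear_apply[OF assms(1) _ _ assms(3)])
  show "linear (frechet_derivative f (at x))" if "x \<in> S" for x
    using linear_frechet_derivative[OF smooth_on_differentiable[OF assms(2) that]] .
qed (rule smooth_on_frechet_derivative[OF assms(2)])

text \<open>The product rule for a linear map that varies with the point. The map is known only
  through its values on basis vectors, so the second summand expands \<open>f x\<close> in the
  basis.\<close>

lemma has_derivative_linear_apply:
  fixes f :: "'a::real_normed_vector \<Rightarrow> 'b::euclidean_space"
  assumes S: "open S" "x \<in> S" "\<And>z. z \<in> S \<Longrightarrow> linear (L z)"
    and L: "\<And>b. b \<in> Basis \<Longrightarrow> ((\<lambda>z. L z b) has_derivative L' b) (at x)"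
    and f: "(f has_derivative f') (at x)"
  shows "((\<lambda>z. L z (f z)) has_derivative
      (\<lambda>h. L x (f' h) + (\<Sum>b\<in>Basis. (f x \<bullet> b) *\<^sub>R L' b h))) (at x)"
proof (rule has_derivative_transform_within_open[OF _ S(1,2)])
  have "((\<lambda>z. \<Sum>b\<in>Basis. (f z \<bullet> b) *\<^sub>R L z b) has_derivative
      (\<lambda>h. \<Sum>b\<in>Basis. (f x \<bullet> b) *\<^sub>R L' b h + (f' h \<bullet> b) *\<^sub>R L x b)) (at x)"
    using f L by (auto intro!: derivative_eq_intros)
  then show "((\<lambda>z. \<Sum>b\<in>Basis. (f z \<bullet> b) *\<^sub>R L z b) has_derivative
      (\<lambda>h. L x (f' h) + (\<Sum>b\<in>Basis. (f x \<bullet> b) *\<^sub>R L' b h))) (at x)"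
    by (simp add: sum.distrib linear_sum_Basis[OF S(3)[OF S(2)], symmetric] add.commute)
  show "(\<Sum>b\<in>Basis. (f z \<bullet> b) *\<^sub>R L z b) = L z (f z)" if "z \<in> S" for z
    using linear_sum_Basis[OF S(3)[OF that]] by metis
qed

section \<open>Bump functions\<close>

text \<open>The derivative of \<open>exp_flat m\<close> is a combination of \<open>exp_flat (m + 2)\<close> and
  \<open>exp_flat (m + 1)\<close>; hence all these functions are smooth simultaneously.\<close>

definition exp_flat :: "nat \<Rightarrow> real \<Rightarrow> real" where
  "exp_flat m x = (if x > 0 then exp (- 1 / x) / x ^ m else 0)"

text \<open>On the right the substitution of \<open>1 / x\<close> for \<open>x\<close> turns the
  claim into the dominance of \<open>exp\<close> over powers at infinity; on the left the function
  is zero.\<close>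

lemma exp_flat_tendsto_0: "(exp_flat m \<longlongrightarrow> 0) (at 0)"
proof -
  have "((\<lambda>x::real. x ^ m / exp x) \<longlongrightarrow> 0) at_top" by (rule tendsto_power_div_exp_0)
  then have "((\<lambda>x::real. (inverse x) ^ m / exp (inverse x)) \<longlongrightarrow> 0) (at_right 0)"
    using filterlim_compose filterlim_inverse_at_top_right by blast
  then have "(exp_flat m \<longlongrightarrow> 0) (at_right 0)"
    by (rule tendsto_cong[THEN iffD1, rotated])
      (auto simp: eventually_at_right_field exp_flat_def exp_minus field_simps intro!: exI[of _ 1])
  moreover have "(exp_flat m \<longlongrightarrow> 0) (at_left 0)"
    by (rule tendsto_eventually) (auto simp: eventually_at_left_field exp_flat_def intro!: exI[of _ "-1"])
  ultimately show ?thesis by (simp add: filterlim_split_at)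
qed

lemma exp_flat_has_real_derivative:
  "(exp_flat m has_real_derivative (exp_flat (m + 2) x - m * exp_flat (m + 1) x)) (at x)"
proof -
  consider "x > 0" | "x < 0" | "x = 0" by linarith
  then show ?thesis
  proof cases
    case 1
    have e: "exp_flat k y = exp (- inverse y) * inverse y ^ k" if "y > 0" for k y
      using that by (simp add: exp_flat_def divide_inverse power_inverse)
    have "((\<lambda>x. exp (- inverse x) * inverse x ^ m) has_real_derivative
        (exp (- inverse x) * inverse x ^ (m + 2) - m * (exp (- inverse x) * inverse x ^ (m + 1)))) (at x)"
      using 1 by (auto intro!: derivative_eq_intros simp: algebra_simps power2_eq_square)
        (cases m; simp)
    then have "((\<lambda>x. exp (- inverse x) * inverse x ^ m) has_real_derivative
        (exp_flat (m + 2) x - m * exp_flat (m + 1) x)) (at x)"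
      using e[OF 1] by simp
    then show ?thesis
      by (rule has_field_derivative_transform_within_open[where S="{0<..}"]) (use 1 e in auto)
  next
    case 2
    have "((\<lambda>x. 0) has_real_derivative (exp_flat (m + 2) x - m * exp_flat (m + 1) x)) (at x)"
      using 2 by (simp add: exp_flat_def)
    then show ?thesis
      by (rule has_field_derivative_transform_within_open[where S="{..<0}"]) (use 2 in \<open>auto simp: exp_flat_def\<close>)
  next
    case 3
    \<comment> \<open>Away from 0 the difference quotient of \<open>exp_flat m\<close> at 0 is
      \<open>exp_flat (m + 1)\<close>, whose limit is already known.\<close>
    have "((\<lambda>y. exp_flat m y / y) \<longlongrightarrow> 0) (at 0)"
      by (rule tendsto_cong[THEN iffD1, OF _ exp_flat_tendsto_0[of "Suc m"]])
        (auto simp: exp_flat_def eventually_at_filter)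
    then show ?thesis
      using 3 by (simp add: DERIV_def exp_flat_def)
  qed
qed

lemma smooth_on_exp_flat: "smooth_on UNIV (exp_flat m)"
proof -
  have "Ck_on k UNIV (exp_flat m)" for k
  proof (induction k arbitrary: m)
    case 0
    show ?case
      using exp_flat_has_real_derivative DERIV_isCont continuous_at_imp_continuous_on
      by (metis Ck_on.simps(1))
  next
    case (Suc k)
    have "(exp_flat m has_derivative (\<lambda>v. (exp_flat (m + 2) x + - m * exp_flat (m + 1) x) * v)) (at x)"
      for x using exp_flat_has_real_derivative[of m x] by (simp add: has_field_derivative_def)
    moreover have "Ck_on k UNIV (\<lambda>x. (exp_flat (m + 2) x + - m * exp_flat (m + 1) x) * v)" for v
      by (intro Ck_on_bounded_bilinear[OF bounded_bilinear_mult] Ck_on_add Ck_on_const Suc open_UNIV)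
    ultimately show ?case by (intro Ck_on_SucI) auto
  qed
  then show ?thesis by (simp add: smooth_on_def)
qed

text \<open>Two nested flat functions. Inside radius \<open>s\<close> the inner argument
  \<open>h x\<close> is negative, so the inner function is 0 and the quotient is 1. From radius
  \<open>r\<close> on the inner function is at least \<open>a\<close>, its value there, so the outer
  argument is at most 0. The radius \<open>s = r / 2\<close> is an arbitrary choice below
  \<open>r\<close>.\<close>

lemma smooth_bump:
  fixes p :: "'a::euclidean_space"
  assumes "r > 0"
  obtains f :: "'a \<Rightarrow> real" and s where "smooth_on UNIV f" "0 < s" "s < r"
    "\<And>x. dist p x < s \<Longrightarrow> f x = 1" "\<And>x. dist p x \<ge> r \<Longrightarrow> f x = 0"
proof -
  define s where "s = r / 2"
  define a where "a = exp_flat 0 (r\<^sup>2 - s\<^sup>2)"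
  have s: "0 < s" "s < r" "s\<^sup>2 < r\<^sup>2"
    using assms by (auto simp: s_def power_divide)
  have a: "0 < a" using s by (simp add: a_def exp_flat_def)
  \<comment> \<open>The squared distance is used because the distance itself is not smooth at
    \<open>p\<close>.\<close>
  define h where "h = (\<lambda>x. (x - p) \<bullet> (x - p) - s\<^sup>2)"
  have h: "h x = (dist p x)\<^sup>2 - s\<^sup>2" for x
    by (simp add: h_def dist_norm power2_norm_eq_inner[symmetric] norm_minus_commute)
  define f where "f x = exp_flat 0 (a - exp_flat 0 (h x)) / exp_flat 0 a" for x
  have mono: "exp_flat 0 y \<le> exp_flat 0 z" if "y \<le> z" for y z
    using that by (auto simp: exp_flat_def frac_le)
  show thesis
  proof (rule that[of f s])
    have "smooth_on UNIV h"
      unfolding h_def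
      by (intro smooth_on_diff smooth_on_inner smooth_on_ident smooth_on_const open_UNIV)
    then have "smooth_on UNIV (\<lambda>x. exp_flat 0 (a - exp_flat 0 (h x)) * (1 / exp_flat 0 a))"
      by (intro smooth_on_mult smooth_on_const smooth_on_diff smooth_on_compose[OF smooth_on_exp_flat] open_UNIV)
        auto
    then show "smooth_on UNIV f" by (simp add: f_def[abs_def])
    show "f x = 1" if "dist p x < s" for x
    proof -
      have "h x < 0" using that by (simp add: h power_strict_mono)
      then show ?thesis using a by (simp add: f_def exp_flat_def)
    qed
    show "f x = 0" if "dist p x \<ge> r" for x
    proof -
      have "h x \<ge> r\<^sup>2 - s\<^sup>2" using that assms by (simp add: h power_mono)
      then have "exp_flat 0 (h x) \<ge> a" unfolding a_def by (rule mono)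
      then show ?thesis by (simp add: f_def exp_flat_def)
    qed
  qed (use s in auto)
qed

section \<open>Symmetry of second derivatives\<close>

lemma has_derivative_imp_line:
  fixes f :: "'a::real_normed_vector \<Rightarrow> real"
  assumes "f differentiable (at (x + t *\<^sub>R v))"
  shows "((\<lambda>t. f (x + t *\<^sub>R v)) has_real_derivative frechet_derivative f (at (x + t *\<^sub>R v)) v) (at t)"
proof -
  have "(f has_derivative frechet_derivative f (at (x + t *\<^sub>R v))) (at (x + t *\<^sub>R v))"
    using assms frechet_derivative_works by blast
  moreover have "((\<lambda>t. x + t *\<^sub>R v) has_derivative (\<lambda>h. h *\<^sub>R v)) (at t)"
    by (auto intro!: derivative_eq_intros)
  ultimately have "((\<lambda>t. f (x + t *\<^sub>R v)) has_derivative
      (\<lambda>h. frechet_derivative f (at (x + t *\<^sub>R v)) (h *\<^sub>R v))) (at t)"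
    using diff_chain_at[of "\<lambda>t. x + t *\<^sub>R v" _ t f] by (simp add: o_def)
  moreover have "linear (frechet_derivative f (at (x + t *\<^sub>R v)))"
    using assms by (rule linear_frechet_derivative)
  ultimately show ?thesis
    by (simp add: has_field_derivative_def linear_scale mult.commute[of _ "frechet_derivative f _ v"])
qed

text \<open>The mean value theorem is used twice: along \<open>v\<close> for the increment of
  \<open>f\<close> in direction \<open>w\<close>, then along \<open>w\<close> for the derivative of
  \<open>f\<close> in direction \<open>v\<close>.\<close>

lemma second_difference_mean_value:
  fixes f :: "'a::real_normed_vector \<Rightarrow> real"
  assumes "smooth_on S f" "h > 0"
    and S: "\<And>s t. 0 \<le> s \<Longrightarrow> s \<le> h \<Longrightarrow> 0 \<le> t \<Longrightarrow> t \<le> h \<Longrightarrow> x + s *\<^sub>R v + t *\<^sub>R w \<in> S"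
  obtains s t where "0 \<le> s" "s \<le> h" "0 \<le> t" "t \<le> h"
    "f (x + h *\<^sub>R v + h *\<^sub>R w) - f (x + h *\<^sub>R v) - f (x + h *\<^sub>R w) + f x =
      h\<^sup>2 * frechet_derivative (\<lambda>y. frechet_derivative f (at y) v) (at (x + s *\<^sub>R v + t *\<^sub>R w)) w"
proof -
  let ?Dv = "\<lambda>y. frechet_derivative f (at y) v"
  define g where "g s = f (x + s *\<^sub>R v + h *\<^sub>R w) - f (x + s *\<^sub>R v)" for s
  have d: "f differentiable (at (x + s *\<^sub>R v + t *\<^sub>R w))" if "0 \<le> s" "s \<le> h" "0 \<le> t" "t \<le> h" for s t
    using smooth_on_differentiable[OF assms(1) S[OF that]] .
  have "(g has_real_derivative (?Dv (x + s *\<^sub>R v + h *\<^sub>R w) - ?Dv (x + s *\<^sub>R v))) (at s)"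
    if "0 \<le> s" "s \<le> h" for s
  proof -
    have "f differentiable (at (x + h *\<^sub>R w + s *\<^sub>R v))"
      using d[of s h] that assms(2) by (simp add: algebra_simps)
    then have "((\<lambda>s. f (x + h *\<^sub>R w + s *\<^sub>R v)) has_real_derivative ?Dv (x + h *\<^sub>R w + s *\<^sub>R v)) (at s)"
      by (rule has_derivative_imp_line)
    moreover have "f differentiable (at (x + s *\<^sub>R v))"
      using d[of s 0] that assms(2) by simp
    then have "((\<lambda>s. f (x + s *\<^sub>R v)) has_real_derivative ?Dv (x + s *\<^sub>R v)) (at s)"
      by (rule has_derivative_imp_line)
    ultimately show ?thesis
      unfolding g_def by (auto intro!: derivative_eq_intros simp: algebra_simps)
  qed
  then obtain s where s: "0 < s" "s < h"
    "g h - g 0 = (h - 0) * (?Dv (x + s *\<^sub>R v + h *\<^sub>R w) - ?Dv (x + s *\<^sub>R v))"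
    using MVT2[OF assms(2), of g "\<lambda>s. ?Dv (x + s *\<^sub>R v + h *\<^sub>R w) - ?Dv (x + s *\<^sub>R v)"] by auto
  have "((\<lambda>t. ?Dv (x + s *\<^sub>R v + t *\<^sub>R w)) has_real_derivative
      frechet_derivative ?Dv (at (x + s *\<^sub>R v + t *\<^sub>R w)) w) (at t)"
    if "0 \<le> t" "t \<le> h" for t
    using s that
    by (intro has_derivative_imp_line smooth_on_differentiable[OF smooth_on_frechet_derivative[OF assms(1)]] S) auto
  then obtain t where t: "0 < t" "t < h" "?Dv (x + s *\<^sub>R v + h *\<^sub>R w) - ?Dv (x + s *\<^sub>R v + 0 *\<^sub>R w) =
      (h - 0) * frechet_derivative ?Dv (at (x + s *\<^sub>R v + t *\<^sub>R w)) w"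
    using MVT2[OF assms(2), of "\<lambda>t. ?Dv (x + s *\<^sub>R v + t *\<^sub>R w)"
        "\<lambda>t. frechet_derivative ?Dv (at (x + s *\<^sub>R v + t *\<^sub>R w)) w"] by auto
  have "f (x + h *\<^sub>R v + h *\<^sub>R w) - f (x + h *\<^sub>R v) - f (x + h *\<^sub>R w) + f x = g h - g 0"
    by (simp add: g_def)
  also have "\<dots> = h\<^sup>2 * frechet_derivative ?Dv (at (x + s *\<^sub>R v + t *\<^sub>R w)) w"
    using s(3) t(3) by (simp add: power2_eq_square)
  finally show thesis using that s t by (metis less_imp_le)
qed

text \<open>The second difference is symmetric in \<open>v\<close> and \<open>w\<close>, so the two
  mixed derivatives take equal values at two points as close to \<open>x\<close> as desired. By
  continuity these values lie within half the supposed gap \<open>2 * e\<close> of the values at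
  \<open>x\<close>, a contradiction.\<close>

lemma second_derivative_symmetric:
  fixes f :: "'a::real_normed_vector \<Rightarrow> real"
  assumes "smooth_on S f" "open S" "x \<in> S"
  shows "frechet_derivative (\<lambda>y. frechet_derivative f (at y) v) (at x) w =
    frechet_derivative (\<lambda>y. frechet_derivative f (at y) w) (at x) v"
proof (rule ccontr)
  let ?F = "\<lambda>v w y. frechet_derivative (\<lambda>y. frechet_derivative f (at y) v) (at y) w"
  assume ne: "\<not> ?thesis"
  define e where "e = \<bar>?F v w x - ?F w v x\<bar> / 2"
  have e: "e > 0" using ne by (simp add: e_def)
  have "isCont (?F a b) x" for a b
    using smooth_on_continuous_on[OF smooth_on_frechet_derivative[OF smooth_on_frechet_derivative[OF assms(1)]]]
      assms(2,3) continuous_on_eq_continuous_at by blast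
  then have "\<exists>d>0. \<forall>y. dist y x < d \<longrightarrow> dist (?F a b y) (?F a b x) < e" for a b
    using e by (simp add: continuous_at_eps_delta)
  then obtain d1 d2 where d12: "d1 > 0" "d2 > 0"
    "\<And>y. dist y x < d1 \<Longrightarrow> dist (?F v w y) (?F v w x) < e"
    "\<And>y. dist y x < d2 \<Longrightarrow> dist (?F w v y) (?F w v x) < e" by metis
  obtain d3 where d3: "d3 > 0" "ball x d3 \<subseteq> S"
    using assms(2,3) open_contains_ball by blast
  define d where "d = min d1 (min d2 d3)"
  \<comment> \<open>The added 1 keeps \<open>K\<close> positive when both vectors vanish. With
    \<open>h = d / (2 * K)\<close> the whole parallelogram lies within \<open>d / 2\<close> of
    \<open>x\<close>.\<close>
  define K where "K = norm v + norm w + 1"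
  define h where "h = d / (2 * K)"
  have d: "d > 0" using d12 d3 by (simp add: d_def)
  have nz: "K > 0" by (simp add: K_def add_nonneg_pos)
  have h: "h > 0" using d nz by (simp add: h_def)
  have near: "dist (x + s *\<^sub>R v + t *\<^sub>R w) x < d" if "0 \<le> s" "s \<le> h" "0 \<le> t" "t \<le> h" for s t
  proof -
    have "dist (x + s *\<^sub>R v + t *\<^sub>R w) x \<le> norm (s *\<^sub>R v) + norm (t *\<^sub>R w)"
      by (simp add: dist_norm add.assoc norm_triangle_ineq del: norm_scaleR)
    also have "\<dots> \<le> h * norm v + h * norm w"
      using that by (intro add_mono) (auto intro: mult_right_mono)
    also have "\<dots> \<le> h * K" using h by (simp add: K_def algebra_simps)
    also have "\<dots> = d / 2" using nz by (simp add: h_def)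
    finally show ?thesis using d by simp
  qed
  have inS: "x + s *\<^sub>R v + t *\<^sub>R w \<in> S" if "0 \<le> s" "s \<le> h" "0 \<le> t" "t \<le> h" for s t
    using near[OF that] d3(2) by (auto simp: d_def dist_commute)
  obtain s t where st: "0 \<le> s" "s \<le> h" "0 \<le> t" "t \<le> h"
    "f (x + h *\<^sub>R v + h *\<^sub>R w) - f (x + h *\<^sub>R v) - f (x + h *\<^sub>R w) + f x =
      h\<^sup>2 * ?F v w (x + s *\<^sub>R v + t *\<^sub>R w)"
    by (rule second_difference_mean_value[OF assms(1) h inS])
  have inS': "x + s *\<^sub>R w + t *\<^sub>R v \<in> S" if "0 \<le> s" "s \<le> h" "0 \<le> t" "t \<le> h" for s t
    using inS[of t s] that by (simp add: algebra_simps)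
  obtain s' t' where st': "0 \<le> s'" "s' \<le> h" "0 \<le> t'" "t' \<le> h"
    "f (x + h *\<^sub>R w + h *\<^sub>R v) - f (x + h *\<^sub>R w) - f (x + h *\<^sub>R v) + f x =
      h\<^sup>2 * ?F w v (x + s' *\<^sub>R w + t' *\<^sub>R v)"
    by (rule second_difference_mean_value[OF assms(1) h inS'])
  have sw: "x + s' *\<^sub>R w + t' *\<^sub>R v = x + t' *\<^sub>R v + s' *\<^sub>R w" "x + h *\<^sub>R w + h *\<^sub>R v = x + h *\<^sub>R v + h *\<^sub>R w"
    by (simp_all add: algebra_simps)
  have "h\<^sup>2 * ?F v w (x + s *\<^sub>R v + t *\<^sub>R w) = h\<^sup>2 * ?F w v (x + t' *\<^sub>R v + s' *\<^sub>R w)"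
    using st(5) st'(5) unfolding sw by linarith
  then have eq: "?F v w (x + s *\<^sub>R v + t *\<^sub>R w) = ?F w v (x + t' *\<^sub>R v + s' *\<^sub>R w)"
    using h by simp
  have "dist (?F v w (x + s *\<^sub>R v + t *\<^sub>R w)) (?F v w x) < e"
    using d12(3) near[OF st(1-4)] by (simp add: d_def)
  moreover have "dist (?F w v (x + t' *\<^sub>R v + s' *\<^sub>R w)) (?F w v x) < e"
    using d12(4) near[OF st'(3,4,1,2)] by (simp add: d_def)
  ultimately show False
    unfolding eq e_def dist_real_def by (auto simp: abs_if split: if_splits)
qed

section \<open>Smooth functions and tangent vectors on a manifold\<close>

definition msmooth ::
  "('a, 'v::euclidean_space) chart set \<Rightarrow> 'a set \<Rightarrow> ('a \<Rightarrow> 'b::real_normed_vector) \<Rightarrow> bool" where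
  "msmooth A U f \<longleftrightarrow> (\<forall>c\<in>A. smooth_on (snd c ` (U \<inter> fst c)) (\<lambda>u. f (cinv c u)))"

definition mderiv ::
  "('a, 'v::euclidean_space) chart \<Rightarrow> ('a \<Rightarrow> 'b::real_normed_vector) \<Rightarrow> 'a \<Rightarrow> 'v \<Rightarrow> 'b" where
  "mderiv c f q = frechet_derivative (\<lambda>u. f (cinv c u)) (at (snd c q))"

text \<open>Only smoothness is restricted to \<open>U\<close>. Tangency is asked at every point,
  which fields on a chart domain satisfy because they are the zero family elsewhere.\<close>

definition local_fields ::
  "('a, 'v::euclidean_space) chart set \<Rightarrow> 'a set \<Rightarrow> ('a, 'v) vfield set" where
  "local_fields A U =
     {X. (\<forall>q. X q \<in> tangent_space A q) \<and> (\<forall>c\<in>A. msmooth A (U \<inter> fst c) (\<lambda>q. X q c))}"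

text \<open>The closed set \<open>K\<close>, rather than mere vanishing off \<open>W\<close>, is
  what globalises: \<open>W\<close> and the complement of \<open>K\<close> are open and cover the
  manifold.\<close>

definition bump_at :: "('a, 'v::euclidean_space) chart set \<Rightarrow> 'a set \<Rightarrow> 'a \<Rightarrow> ('a \<Rightarrow> real) \<Rightarrow> bool" where
  "bump_at A W q f \<longleftrightarrow> msmooth A (points A) f \<and>
     (\<exists>V. openin (mtopology A) V \<and> q \<in> V \<and> (\<forall>r\<in>V. f r = 1)) \<and>
     (\<exists>K. closedin (mtopology A) K \<and> K \<subseteq> W \<and> (\<forall>r. r \<notin> K \<longrightarrow> f r = 0))"

section \<open>Charts and the topology they generate\<close>

locale manifold_atlas =
  fixes A :: "('a, 'v::euclidean_space) chart set"
  assumes atlas: "smooth_atlas A"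
begin

lemma inj_chart: "c \<in> A \<Longrightarrow> inj_on (snd c) (fst c)"
  and open_chart: "c \<in> A \<Longrightarrow> open (snd c ` fst c)"
  and open_overlap: "c \<in> A \<Longrightarrow> d \<in> A \<Longrightarrow> open (snd c ` (fst c \<inter> fst d))"
  and smooth_transition: "c \<in> A \<Longrightarrow> d \<in> A \<Longrightarrow> smooth_on (snd c ` (fst c \<inter> fst d)) (transition c d)"
  using atlas unfolding smooth_atlas_def by blast+

lemma cinv_chart [simp]: "c \<in> A \<Longrightarrow> q \<in> fst c \<Longrightarrow> cinv c (snd c q) = q"
  by (simp add: cinv_def inj_chart)

lemma cinv_in: "u \<in> snd c ` U \<Longrightarrow> U \<subseteq> fst c \<Longrightarrow> c \<in> A \<Longrightarrow> cinv c u \<in> U"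
  by auto

lemma chart_cinv: "u \<in> snd c ` fst c \<Longrightarrow> c \<in> A \<Longrightarrow> snd c (cinv c u) = u"
  by (simp add: cinv_def f_inv_into_f)

lemma transition_chart [simp]: "c \<in> A \<Longrightarrow> q \<in> fst c \<Longrightarrow> transition c d (snd c q) = snd d q"
  by (simp add: transition_def)

lemma openin_generator:
  "c \<in> A \<Longrightarrow> open S \<Longrightarrow> openin (mtopology A) {q \<in> fst c. snd c q \<in> S}"
  unfolding mtopology_def by (rule topology_generated_by_Basis) blast

lemma openin_domain: "c \<in> A \<Longrightarrow> openin (mtopology A) (fst c)"
  using openin_generator[of c UNIV] by simp

lemma topspace_mtopology: "topspace (mtopology A) = points A"
proof
  show "topspace (mtopology A) \<subseteq> points A"
    unfolding mtopology_def by (auto simp: points_def)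
  show "points A \<subseteq> topspace (mtopology A)"
    using openin_domain openin_subset by (fastforce simp: points_def)
qed

text \<open>One direction is an induction on the generation of the topology: injectivity of charts
  handles intersections, and continuity of the transition maps handles the generating sets. For the
  other, such a \<open>U\<close> is the union of the generators given by its own chart
  images.\<close>

lemma openin_iff:
  "openin (mtopology A) U \<longleftrightarrow> U \<subseteq> points A \<and> (\<forall>c\<in>A. open (snd c ` (U \<inter> fst c)))"
proof (intro iffI conjI ballI)
  assume U: "openin (mtopology A) U"
  then show "U \<subseteq> points A" using openin_subset topspace_mtopology by blast
  fix c assume c: "c \<in> A"
  from U have "generate_topology_on {{q \<in> fst c. snd c q \<in> S} | c S. c \<in> A \<and> open S} U"
    unfolding mtopology_def by (rule openin_topology_generated_by)
  then show "open (snd c ` (U \<inter> fst c))"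
  proof induction
    case Empty
    show ?case by simp
  next
    case (Int a b)
    have "snd c ` (a \<inter> b \<inter> fst c) = snd c ` (a \<inter> fst c) \<inter> snd c ` (b \<inter> fst c)"
      using inj_on_image_Int[OF inj_chart[OF c], of "a \<inter> fst c" "b \<inter> fst c"]
      by (simp add: Int_ac)
    then show ?case using Int by auto
  next
    case (UN K)
    have "snd c ` (\<Union>K \<inter> fst c) = (\<Union>k\<in>K. snd c ` (k \<inter> fst c))" by auto
    then show ?case using UN by auto
  next
    case (Basis s)
    then obtain d S where d: "d \<in> A" "open S" and s: "s = {q \<in> fst d. snd d q \<in> S}" by blast
    have "snd c ` (s \<inter> fst c) = snd c ` (fst c \<inter> fst d) \<inter> transition c d -` S"
      using c by (auto simp: s)
    moreover have "open \<dots>"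
      using smooth_on_continuous_on[OF smooth_transition[OF c d(1)]] open_overlap[OF c d(1)] d(2)
      by (rule continuous_open_preimage)
    ultimately show ?case by simp
  qed
next
  assume U: "U \<subseteq> points A \<and> (\<forall>c\<in>A. open (snd c ` (U \<inter> fst c)))"
  have "U = (\<Union>c\<in>A. {q \<in> fst c. snd c q \<in> snd c ` (U \<inter> fst c)})"
  proof (intro equalityI subsetI)
    fix q assume "q \<in> (\<Union>c\<in>A. {q \<in> fst c. snd c q \<in> snd c ` (U \<inter> fst c)})"
    then obtain c q' where "c \<in> A" "q \<in> fst c" "q' \<in> U" "q' \<in> fst c" "snd c q = snd c q'" by blast
    then show "q \<in> U" using inj_chart inj_onD by metis
  next
    fix q assume "q \<in> U"
    then show "q \<in> (\<Union>c\<in>A. {q \<in> fst c. snd c q \<in> snd c ` (U \<inter> fst c)})"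
      using U unfolding points_def by blast
  qed
  also have "openin (mtopology A) \<dots>"
    using U by (intro openin_Union) (auto intro!: openin_generator)
  finally show "openin (mtopology A) U" .
qed

lemma open_image: "openin (mtopology A) U \<Longrightarrow> c \<in> A \<Longrightarrow> open (snd c ` (U \<inter> fst c))"
  by (simp add: openin_iff)

lemma openin_Int_domain: "openin (mtopology A) U \<Longrightarrow> c \<in> A \<Longrightarrow> openin (mtopology A) (U \<inter> fst c)"
  using openin_domain by blast

lemma openin_points: "openin (mtopology A) (points A)"
  using openin_topspace[of "mtopology A"] by (simp add: topspace_mtopology)

lemma domain_subset_points: "c \<in> A \<Longrightarrow> fst c \<subseteq> points A"
  by (auto simp: points_def)

lemma points_Int_domain [simp]: "c \<in> A \<Longrightarrow> points A \<inter> fst c = fst c"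
  by (auto simp: points_def)

section \<open>Functions that are smooth on part of a manifold\<close>

lemma msmooth_subset: "msmooth A V f \<Longrightarrow> U \<subseteq> V \<Longrightarrow> msmooth A U f"
  unfolding msmooth_def by (meson Int_mono image_mono order_refl smooth_on_subset)

lemma msmooth_cong:
  assumes "msmooth A U f" "openin (mtopology A) U" "\<And>q. q \<in> U \<Longrightarrow> f q = g q"
  shows "msmooth A U g"
  unfolding msmooth_def
proof
  fix c assume c: "c \<in> A"
  show "smooth_on (snd c ` (U \<inter> fst c)) (\<lambda>u. g (cinv c u))"
    by (rule smooth_on_cong[where f="\<lambda>u. f (cinv c u)"])
      (use c assms open_image in \<open>auto simp: msmooth_def\<close>)
qed

lemma msmooth_local:
  assumes "\<And>q. q \<in> U \<Longrightarrow> \<exists>W. openin (mtopology A) W \<and> q \<in> W \<and> msmooth A W f"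
  shows "msmooth A U f"
  unfolding msmooth_def
proof
  fix c assume c: "c \<in> A"
  show "smooth_on (snd c ` (U \<inter> fst c)) (\<lambda>u. f (cinv c u))"
  proof (rule smooth_on_local)
    fix x assume "x \<in> snd c ` (U \<inter> fst c)"
    then obtain q where q: "x = snd c q" "q \<in> U" "q \<in> fst c" by auto
    with assms obtain W where W: "openin (mtopology A) W" "q \<in> W" "msmooth A W f" by blast
    show "\<exists>T. open T \<and> x \<in> T \<and> smooth_on T (\<lambda>u. f (cinv c u))"
      using W q c open_image[OF W(1) c]
      by (intro exI[of _ "snd c ` (W \<inter> fst c)"]) (auto simp: msmooth_def)
  qed
qed

text \<open>In another chart the representative is the one in \<open>c\<close> composed with a
  transition map, so a single chart around \<open>U\<close> decides smoothness.\<close>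

lemma msmooth_chartI:
  assumes c: "c \<in> A" and U: "openin (mtopology A) U" "U \<subseteq> fst c"
    and f: "smooth_on (snd c ` U) (\<lambda>u. f (cinv c u))"
  shows "msmooth A U f"
  unfolding msmooth_def
proof
  fix d assume d: "d \<in> A"
  show "smooth_on (snd d ` (U \<inter> fst d)) (\<lambda>u. f (cinv d u))"
  proof (rule smooth_on_cong[where f="\<lambda>u. f (cinv c (transition d c u))"])
    show "smooth_on (snd d ` (U \<inter> fst d)) (\<lambda>u. f (cinv c (transition d c u)))"
    proof (rule smooth_on_compose[OF f])
      show "smooth_on (snd d ` (U \<inter> fst d)) (transition d c)"
        using smooth_transition[OF d c] by (rule smooth_on_subset) (use U in auto)
    qed (use open_image[OF U(1) d] d in auto)
  qed (use open_image[OF U(1) d] U c d in auto)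
qed

lemma msmooth_iff_chart:
  assumes "c \<in> A" "openin (mtopology A) U" "U \<subseteq> fst c"
  shows "msmooth A U f \<longleftrightarrow> smooth_on (snd c ` U) (\<lambda>u. f (cinv c u))"
proof
  assume "msmooth A U f"
  then show "smooth_on (snd c ` U) (\<lambda>u. f (cinv c u))"
    using assms by (auto simp: msmooth_def Int_absorb2)
qed (rule msmooth_chartI[OF assms])

lemma smooth_in_chart_iff: "c \<in> A \<Longrightarrow> smooth_in_chart c f \<longleftrightarrow> msmooth A (fst c) f"
  unfolding smooth_in_chart_def using msmooth_iff_chart[OF _ openin_domain order_refl] by blast

lemma smooth_function_iff: "smooth_function A f \<longleftrightarrow> msmooth A (points A) f"
  unfolding smooth_function_def smooth_in_chart_def msmooth_def by simp

lemma msmooth_const: "msmooth A U (\<lambda>q. k)"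
  unfolding msmooth_def by (simp add: smooth_on_const)

lemma msmooth_add:
  "openin (mtopology A) U \<Longrightarrow> msmooth A U f \<Longrightarrow> msmooth A U g \<Longrightarrow> msmooth A U (\<lambda>q. f q + g q)"
  unfolding msmooth_def by (auto intro!: smooth_on_add open_image)

lemma msmooth_bounded_linear:
  "bounded_linear L \<Longrightarrow> openin (mtopology A) U \<Longrightarrow> msmooth A U f \<Longrightarrow> msmooth A U (\<lambda>q. L (f q))"
  unfolding msmooth_def by (intro ballI smooth_on_bounded_linear[where L=L] open_image) auto

lemma msmooth_bounded_bilinear:
  "bounded_bilinear L \<Longrightarrow> openin (mtopology A) U \<Longrightarrow> msmooth A U f \<Longrightarrow> msmooth A U g \<Longrightarrow>
    msmooth A U (\<lambda>q. L (f q) (g q))"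
  unfolding msmooth_def by (intro ballI smooth_on_bounded_bilinear[where L=L] open_image) auto

lemmas msmooth_scaleR = msmooth_bounded_bilinear[OF bounded_bilinear_scaleR]
lemmas msmooth_mult = msmooth_bounded_bilinear[OF bounded_bilinear_mult]
lemmas msmooth_inner_left = msmooth_bounded_linear[OF bounded_linear_inner_left]

lemma msmooth_sum:
  "finite I \<Longrightarrow> openin (mtopology A) U \<Longrightarrow> (\<And>i. i \<in> I \<Longrightarrow> msmooth A U (f i)) \<Longrightarrow>
    msmooth A U (\<lambda>q. \<Sum>i\<in>I. f i q)"
  unfolding msmooth_def by (auto intro!: smooth_on_sum open_image)

lemma msmooth_linear_apply:
  fixes g :: "'a \<Rightarrow> 'w::euclidean_space"
  assumes "openin (mtopology A) U" "\<And>q. q \<in> U \<Longrightarrow> linear (L q)"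
    "\<And>b. b \<in> Basis \<Longrightarrow> msmooth A U (\<lambda>q. L q b)" "msmooth A U g"
  shows "msmooth A U (\<lambda>q. L q (g q))"
proof (rule msmooth_cong[OF _ assms(1)])
  show "msmooth A U (\<lambda>q. \<Sum>b\<in>Basis. (g q \<bullet> b) *\<^sub>R L q b)"
    using assms by (intro msmooth_sum msmooth_scaleR msmooth_inner_left) auto
qed (use assms(2) in \<open>simp add: linear_sum_Basis[symmetric]\<close>)

section \<open>Derivatives of functions read in charts\<close>

lemma msmooth_has_derivative:
  assumes "msmooth A U f" "q \<in> U" "c \<in> A" "q \<in> fst c"
  shows "((\<lambda>u. f (cinv c u)) has_derivative mderiv c f q) (at (snd c q))"
  unfolding mderiv_def
  by (rule smooth_on_has_derivative[of "snd c ` (U \<inter> fst c)"]) (use assms in \<open>auto simp: msmooth_def\<close>)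

lemma mderiv_unique:
  "((\<lambda>u. f (cinv c u)) has_derivative D) (at (snd c q)) \<Longrightarrow> mderiv c f q = D"
  unfolding mderiv_def using frechet_derivativeI by blast

lemma linear_mderiv:
  "msmooth A U f \<Longrightarrow> q \<in> U \<Longrightarrow> c \<in> A \<Longrightarrow> q \<in> fst c \<Longrightarrow> linear (mderiv c f q)"
  using msmooth_has_derivative has_derivative_linear by blast

lemma mderiv_cong:
  assumes "openin (mtopology A) W" "q \<in> W" "\<And>r. r \<in> W \<Longrightarrow> f r = g r" "c \<in> A" "q \<in> fst c"
  shows "mderiv c f q = mderiv c g q"
proof -
  have S: "open (snd c ` (W \<inter> fst c))" "snd c q \<in> snd c ` (W \<inter> fst c)"
    using assms open_image by auto
  have eq: "f (cinv c u) = g (cinv c u)" if "u \<in> snd c ` (W \<inter> fst c)" for u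
    using that assms by auto
  \<comment> \<open>Differentiability is not assumed. Both functions have the same set of
    derivatives, possibly empty, so the choice operator picks the same value for both.\<close>
  have "((\<lambda>u. f (cinv c u)) has_derivative D) (at (snd c q)) \<longleftrightarrow>
      ((\<lambda>u. g (cinv c u)) has_derivative D) (at (snd c q))" for D
    by (metis (no_types, lifting) has_derivative_transform_within_open[OF _ S] eq)
  then show ?thesis by (simp add: mderiv_def frechet_derivative_def)
qed

lemma transition_has_derivative:
  "c \<in> A \<Longrightarrow> d \<in> A \<Longrightarrow> q \<in> fst c \<Longrightarrow> q \<in> fst d \<Longrightarrow>
    (transition c d has_derivative frechet_derivative (transition c d) (at (snd c q))) (at (snd c q))"
  using smooth_on_has_derivative[OF smooth_transition] by blast

lemma linear_transition_derivative:
  "c \<in> A \<Longrightarrow> d \<in> A \<Longrightarrow> q \<in> fst c \<Longrightarrow> q \<in> fst d \<Longrightarrow>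
    linear (frechet_derivative (transition c d) (at (snd c q)))"
  using transition_has_derivative has_derivative_linear by blast

text \<open>By the chain rule, the derivative of a function along a tangent vector does not depend
  on the chart in which both are read.\<close>

lemma mderiv_change_chart:
  assumes "msmooth A U f" "q \<in> U" "c \<in> A" "q \<in> fst c" "d \<in> A" "q \<in> fst d"
  shows "mderiv d f q (frechet_derivative (transition c d) (at (snd c q)) v) = mderiv c f q v"
proof -
  let ?D = "frechet_derivative (transition c d) (at (snd c q))"
  have "((\<lambda>u. f (cinv d u)) has_derivative mderiv d f q) (at (transition c d (snd c q)))"
    using msmooth_has_derivative[OF assms(1,2,5,6)] assms by simp
  with transition_has_derivative[OF assms(3,5,4,6)]
  have "((\<lambda>u. f (cinv d (transition c d u))) has_derivative (\<lambda>v. mderiv d f q (?D v))) (at (snd c q))"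
    using diff_chain_at by (auto simp: o_def)
  then have "((\<lambda>u. f (cinv c u)) has_derivative (\<lambda>v. mderiv d f q (?D v))) (at (snd c q))"
    by (rule has_derivative_transform_within_open[OF _ open_overlap[OF assms(3,5)]])
      (use assms in auto)
  then show ?thesis using mderiv_unique by metis
qed

text \<open>This is the chart independence of derivatives applied to the coordinate map of
  \<open>d'\<close>, since a transition map is a coordinate map read in another chart.\<close>

lemma transition_derivative_cocycle:
  assumes "c \<in> A" "q \<in> fst c" "d \<in> A" "q \<in> fst d" "d' \<in> A" "q \<in> fst d'"
  shows "frechet_derivative (transition d d') (at (snd d q))
      (frechet_derivative (transition c d) (at (snd c q)) v) =
    frechet_derivative (transition c d') (at (snd c q)) v"
proof -
  have "msmooth A (fst d \<inter> fst d') (snd d')"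
    using smooth_transition[OF assms(3,5)] openin_Int_domain[OF openin_domain] assms
    by (intro msmooth_chartI[of d]) (auto simp: transition_def[abs_def])
  from mderiv_change_chart[OF this, of q c d v] assms show ?thesis
    by (simp add: mderiv_def transition_def[abs_def])
qed

lemma transition_derivative_same:
  assumes "c \<in> A" "q \<in> fst c"
  shows "frechet_derivative (transition c c) (at (snd c q)) = (\<lambda>v. v)"
proof -
  have "(transition c c has_derivative (\<lambda>v. v)) (at (snd c q))"
    by (rule has_derivative_transform_within_open[OF has_derivative_ident open_chart[OF assms(1)]])
      (use assms in auto)
  then show ?thesis using frechet_derivativeI by blast
qed

lemma mderiv_add:
  assumes "msmooth A U f" "msmooth A U g" "q \<in> U" "c \<in> A" "q \<in> fst c"
  shows "mderiv c (\<lambda>r. f r + g r) q v = mderiv c f q v + mderiv c g q v"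
  using mderiv_unique[OF has_derivative_add[OF msmooth_has_derivative[OF assms(1,3-5)]
        msmooth_has_derivative[OF assms(2-5)]]] by simp

lemma mderiv_scaleR:
  assumes "msmooth A U f" "msmooth A U g" "q \<in> U" "c \<in> A" "q \<in> fst c"
  shows "mderiv c (\<lambda>r. f r *\<^sub>R g r) q v = mderiv c f q v *\<^sub>R g q + f q *\<^sub>R mderiv c g q v"
  using mderiv_unique[OF has_derivative_scaleR[OF msmooth_has_derivative[OF assms(1,3-5)]
        msmooth_has_derivative[OF assms(2-5)]]] assms(4,5) by simp

lemma mderiv_bounded_linear:
  assumes "bounded_linear L" "msmooth A U f" "q \<in> U" "c \<in> A" "q \<in> fst c"
  shows "mderiv c (\<lambda>r. L (f r)) q v = L (mderiv c f q v)"
  using mderiv_unique[OF bounded_linear.has_derivative[OF assms(1) msmooth_has_derivative[OF assms(2-5)]]]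
  by simp

lemma mderiv_const [simp]: "mderiv c (\<lambda>r. k) q v = 0"
  by (simp add: mderiv_def)

lemma mderiv_linear_apply:
  fixes f :: "'a \<Rightarrow> 'w::euclidean_space"
  assumes U: "openin (mtopology A) U" "q \<in> U" "c \<in> A" "q \<in> fst c"
    and L: "\<And>r. r \<in> U \<Longrightarrow> linear (L r)" "\<And>b. b \<in> Basis \<Longrightarrow> msmooth A U (\<lambda>r. L r b)"
    and f: "msmooth A U f"
  shows "mderiv c (\<lambda>r. L r (f r)) q v =
    L q (mderiv c f q v) + (\<Sum>b\<in>Basis. (f q \<bullet> b) *\<^sub>R mderiv c (\<lambda>r. L r b) q v)"
proof -
  have "((\<lambda>u. L (cinv c u) (f (cinv c u))) has_derivative
      (\<lambda>h. L (cinv c (snd c q)) (mderiv c f q h) +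
        (\<Sum>b\<in>Basis. (f (cinv c (snd c q)) \<bullet> b) *\<^sub>R mderiv c (\<lambda>r. L r b) q h))) (at (snd c q))"
  proof (rule has_derivative_linear_apply)
    show "open (snd c ` (U \<inter> fst c))" using U open_image by auto
    show "linear (L (cinv c z))" if "z \<in> snd c ` (U \<inter> fst c)" for z
      using that U L(1) by auto
    show "((\<lambda>z. L (cinv c z) b) has_derivative mderiv c (\<lambda>r. L r b) q) (at (snd c q))"
      if "b \<in> Basis" for b
      using msmooth_has_derivative[OF L(2)[OF that] U(2-4)] .
  qed (use U msmooth_has_derivative[OF f U(2-4)] in auto)
  from mderiv_unique[OF this] U(3,4) show ?thesis by simp
qed

lemma msmooth_mderiv:
  assumes U: "openin (mtopology A) U" "U \<subseteq> fst c" "c \<in> A"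
    and f: "msmooth A U f" and X: "msmooth A U X"
  shows "msmooth A U (\<lambda>q. mderiv c f q (X q))"
proof (rule msmooth_chartI[OF U(3,1,2)])
  have [simp]: "U \<inter> fst c = U" using U by auto
  have op: "open (snd c ` U)" using open_image[OF U(1,3)] by simp
  have "smooth_on (snd c ` U) (\<lambda>u. frechet_derivative (\<lambda>u. f (cinv c u)) (at u) (X (cinv c u)))"
    using f X U(3) by (intro smooth_on_frechet_derivative_apply op) (force simp: msmooth_def)+
  then show "smooth_on (snd c ` U) (\<lambda>u. mderiv c f (cinv c u) (X (cinv c u)))"
    by (rule smooth_on_cong) (use op U in \<open>auto simp: mderiv_def chart_cinv subset_iff\<close>)
qed

section \<open>Tangent vectors and vector fields\<close>

lemma tangentI:
  assumes "\<And>c. \<not> (c \<in> A \<and> q \<in> fst c) \<Longrightarrow> v c = 0"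
    and "\<And>c d. c \<in> A \<Longrightarrow> d \<in> A \<Longrightarrow> q \<in> fst c \<Longrightarrow> q \<in> fst d \<Longrightarrow>
      v d = frechet_derivative (transition c d) (at (snd c q)) (v c)"
  shows "v \<in> tangent_space A q"
  using assms unfolding tangent_space_def by blast

lemma tangent_transition:
  "v \<in> tangent_space A q \<Longrightarrow> c \<in> A \<Longrightarrow> d \<in> A \<Longrightarrow> q \<in> fst c \<Longrightarrow> q \<in> fst d \<Longrightarrow>
    v d = frechet_derivative (transition c d) (at (snd c q)) (v c)"
  unfolding tangent_space_def by blast

lemma tangent_off: "v \<in> tangent_space A q \<Longrightarrow> \<not> (c \<in> A \<and> q \<in> fst c) \<Longrightarrow> v c = 0"
  unfolding tangent_space_def by blast

lemma tangent_zero: "(\<lambda>c. 0) \<in> tangent_space A q"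
  by (rule tangentI) (auto simp: linear_0[OF linear_transition_derivative])

lemma tangent_add:
  assumes "v \<in> tangent_space A q" "w \<in> tangent_space A q"
  shows "(\<lambda>c. v c + w c) \<in> tangent_space A q"
proof (rule tangentI)
  show "v c + w c = 0" if "\<not> (c \<in> A \<and> q \<in> fst c)" for c
    using tangent_off[OF assms(1) that] tangent_off[OF assms(2) that] by simp
  show "v d + w d = frechet_derivative (transition c d) (at (snd c q)) (v c + w c)"
    if "c \<in> A" "d \<in> A" "q \<in> fst c" "q \<in> fst d" for c d
    using tangent_transition[OF assms(1) that] tangent_transition[OF assms(2) that]
    by (simp only: linear_add[OF linear_transition_derivative[OF that]])
qed

lemma tangent_scale:
  assumes "v \<in> tangent_space A q"
  shows "(\<lambda>c. k *\<^sub>R v c) \<in> tangent_space A q"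
proof (rule tangentI)
  show "k *\<^sub>R v c = 0" if "\<not> (c \<in> A \<and> q \<in> fst c)" for c
    using assms that tangent_off by simp
  show "k *\<^sub>R v d = frechet_derivative (transition c d) (at (snd c q)) (k *\<^sub>R v c)"
    if "c \<in> A" "d \<in> A" "q \<in> fst c" "q \<in> fst d" for c d
    using tangent_transition[OF assms that]
    by (simp only: linear_scale[OF linear_transition_derivative[OF that]])
qed

lemma tangent_eqI:
  assumes "v \<in> tangent_space A q" "w \<in> tangent_space A q" "c \<in> A" "q \<in> fst c" "v c = w c"
  shows "v = w"
proof
  fix d show "v d = w d"
    using tangent_transition[OF assms(1,3), of d] tangent_transition[OF assms(2,3), of d]
      tangent_off[OF assms(1), of d] tangent_off[OF assms(2), of d] assms(4,5)
    by (cases "d \<in> A \<and> q \<in> fst d") auto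
qed

lemma coord_vec_tangent: "c \<in> A \<Longrightarrow> coord_vec A c w q \<in> tangent_space A q"
  by (rule tangentI)
    (auto simp: coord_vec_def transition_derivative_cocycle linear_0[OF linear_transition_derivative])

lemma coord_vec_self: "c \<in> A \<Longrightarrow> q \<in> fst c \<Longrightarrow> coord_vec A c w q c = w"
  by (simp add: coord_vec_def transition_derivative_same)

lemma coord_vec_tangent_eq:
  "v \<in> tangent_space A q \<Longrightarrow> c \<in> A \<Longrightarrow> q \<in> fst c \<Longrightarrow> coord_vec A c (v c) q = v"
  by (rule tangent_eqI) (auto simp: coord_vec_self coord_vec_tangent)

lemma linear_coord_vec: "c \<in> A \<Longrightarrow> linear (\<lambda>w. coord_vec A c w q d)"
  using linear_transition_derivative[of c d q]
  by (cases "d \<in> A \<and> q \<in> fst c \<inter> fst d") (auto simp: coord_vec_def linear_zero)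

lemma vector_fields_eq: "vector_fields A = local_fields A (points A)"
  by (auto simp: vector_fields_def local_fields_def smooth_in_chart_iff)

lemma local_fields_smooth: "X \<in> local_fields A U \<Longrightarrow> c \<in> A \<Longrightarrow> msmooth A (U \<inter> fst c) (\<lambda>q. X q c)"
  by (simp add: local_fields_def)

text \<open>The components of \<open>X\<close> in a chart \<open>d\<close> are the derivative of the
  coordinate map of \<open>d\<close> along \<open>X\<close>, hence smooth once the components in
  \<open>c\<close> are.\<close>

lemma local_fields_chartI:
  assumes c: "c \<in> A" and U: "openin (mtopology A) U" "U \<subseteq> fst c"
    and X: "\<And>q. X q \<in> tangent_space A q" "msmooth A U (\<lambda>q. X q c)"
  shows "X \<in> local_fields A U"
  unfolding local_fields_def
proof (intro CollectI conjI allI ballI X(1))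
  fix d assume d: "d \<in> A"
  have dc: "openin (mtopology A) (U \<inter> fst d)" using U d openin_Int_domain by blast
  have [simp]: "U \<inter> fst d \<inter> fst c = U \<inter> fst d" using U by auto
  have "msmooth A (U \<inter> fst d) (snd d)"
    using smooth_transition[OF d d] d openin_domain
    by (intro msmooth_subset[OF msmooth_chartI[of d "fst d"]]) (auto simp: transition_def[abs_def])
  then have "msmooth A (U \<inter> fst d) (\<lambda>q. mderiv c (snd d) q (X q c))"
    using c dc U X(2) by (intro msmooth_mderiv) (auto intro: msmooth_subset)
  then show "msmooth A (U \<inter> fst d) (\<lambda>q. X q d)"
    by (rule msmooth_cong[OF _ dc])
      (use c d U tangent_transition[OF X(1) c d] in \<open>auto simp: mderiv_def transition_def[abs_def]\<close>)
qed

lemma vf_scale_local: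
  assumes "openin (mtopology A) U" "msmooth A U f" "X \<in> local_fields A U"
  shows "vf_scale f X \<in> local_fields A U"
  using assms unfolding local_fields_def vf_scale_def
  by (auto intro!: tangent_scale msmooth_scaleR openin_Int_domain intro: msmooth_subset)

lemma vf_add_local:
  assumes "openin (mtopology A) U" "X \<in> local_fields A U" "Y \<in> local_fields A U"
  shows "vf_add X Y \<in> local_fields A U"
  using assms unfolding local_fields_def vf_add_def
  by (auto intro!: tangent_add msmooth_add openin_Int_domain)

lemma vf_apply_eq:
  assumes "msmooth A (points A) f" "X \<in> vector_fields A" "c \<in> A" "q \<in> fst c"
  shows "vf_apply A X f q = mderiv c f q (X q c)"
proof -
  define d where "d = (SOME c. c \<in> A \<and> q \<in> fst c)"
  have d: "d \<in> A" "q \<in> fst d"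
    unfolding d_def using someI[of "\<lambda>c. c \<in> A \<and> q \<in> fst c", OF conjI[OF assms(3,4)]] by auto
  have q: "q \<in> points A" using assms(3,4) by (auto simp: points_def)
  have "vf_apply A X f q = mderiv d f q (X q d)"
    by (simp add: vf_apply_def d_def Let_def mderiv_def)
  also have "X q d = frechet_derivative (transition c d) (at (snd c q)) (X q c)"
    using assms d by (intro tangent_transition[of "X q"]) (auto simp: vector_fields_def)
  finally show ?thesis using mderiv_change_chart[OF assms(1) q assms(3,4) d] by simp
qed

lemma vf_apply_smooth:
  assumes "msmooth A (points A) f" "X \<in> vector_fields A"
  shows "msmooth A (points A) (vf_apply A X f)"
proof (rule msmooth_local)
  fix q assume "q \<in> points A"
  then obtain c where c: "c \<in> A" "q \<in> fst c" by (auto simp: points_def)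
  have "msmooth A (fst c) (\<lambda>q. mderiv c f q (X q c))"
    using assms c local_fields_smooth[of X "points A" c]
    by (intro msmooth_mderiv openin_domain msmooth_subset[OF assms(1)] domain_subset_points)
      (auto simp: vector_fields_eq)
  then have "msmooth A (fst c) (vf_apply A X f)"
    by (rule msmooth_cong) (use assms c vf_apply_eq openin_domain in auto)
  then show "\<exists>W. openin (mtopology A) W \<and> q \<in> W \<and> msmooth A W (vf_apply A X f)"
    using c openin_domain by blast
qed

section \<open>Globalising local functions and fields with bump functions\<close>

lemma bump_mult_smooth:
  assumes "bump_at A W q f" "openin (mtopology A) W" "msmooth A W g"
  shows "msmooth A (points A) (\<lambda>r. f r *\<^sub>R g r)"
proof (rule msmooth_local)
  obtain K where K: "closedin (mtopology A) K" "K \<subseteq> W" "\<And>r. r \<notin> K \<Longrightarrow> f r = 0"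
    and f: "msmooth A (points A) f"
    using assms(1) unfolding bump_at_def by blast
  fix r assume r: "r \<in> points A"
  \<comment> \<open>A point of \<open>K\<close> has the neighbourhood \<open>W\<close>, where both
    factors are smooth. Any other point has the complement of \<open>K\<close>, where the product is
    identically zero whatever \<open>g\<close> does there.\<close>
  show "\<exists>W. openin (mtopology A) W \<and> r \<in> W \<and> msmooth A W (\<lambda>r. f r *\<^sub>R g r)"
  proof (cases "r \<in> K")
    case True
    have "W \<subseteq> points A" using assms(2) openin_iff by blast
    then have "msmooth A W (\<lambda>r. f r *\<^sub>R g r)"
      using assms f by (intro msmooth_scaleR) (auto intro: msmooth_subset)
    then show ?thesis using True K(2) assms(2) by blast
  next
    case False
    have op: "openin (mtopology A) (points A - K)"
      using K(1) openin_points by blast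
    have "msmooth A (points A - K) (\<lambda>r. f r *\<^sub>R g r)"
      by (rule msmooth_cong[OF msmooth_const[of _ 0] op]) (simp add: K(3))
    then show ?thesis using op r False by blast
  qed
qed

text \<open>Smoothness follows from the cover by \<open>W\<close> and the complement of
  \<open>K\<close>; the germ at \<open>q\<close> is kept because the bump is 1 on a whole
  neighbourhood of \<open>q\<close>, not only at \<open>q\<close>.\<close>

lemma bump_extends_germ:
  assumes "bump_at A W q f" "openin (mtopology A) W" "X \<in> local_fields A W"
  shows "vf_scale f X \<in> vector_fields A" "extends_germ A q X (vf_scale f X)"
proof -
  obtain K where K: "closedin (mtopology A) K" "K \<subseteq> W" "\<And>r. r \<notin> K \<Longrightarrow> f r = 0"
    using assms(1) unfolding bump_at_def by blast
  show X: "vf_scale f X \<in> vector_fields A"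
    unfolding vector_fields_eq local_fields_def
  proof (intro CollectI conjI allI ballI)
    show "vf_scale f X r \<in> tangent_space A r" for r
      using assms(3) by (auto simp: vf_scale_def local_fields_def tangent_scale)
    fix c assume c: "c \<in> A"
    show "msmooth A (points A \<inter> fst c) (\<lambda>r. vf_scale f X r c)"
    proof (rule msmooth_local)
      fix r assume r: "r \<in> points A \<inter> fst c"
      show "\<exists>V. openin (mtopology A) V \<and> r \<in> V \<and> msmooth A V (\<lambda>r. vf_scale f X r c)"
      proof (cases "r \<in> K")
        case True
        have W: "openin (mtopology A) (W \<inter> fst c)" "W \<subseteq> points A"
          using assms(2) c openin_Int_domain openin_iff by blast+
        then have "msmooth A (W \<inter> fst c) f"
          using assms(1) msmooth_subset[of "points A" f "W \<inter> fst c"] by (auto simp: bump_at_def)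
        then have "msmooth A (W \<inter> fst c) (\<lambda>r. vf_scale f X r c)"
          unfolding vf_scale_def
          using W(1) local_fields_smooth[OF assms(3) c] by (intro msmooth_scaleR)
        then show ?thesis using W(1) True K(2) r by blast
      next
        case False
        have op: "openin (mtopology A) (points A - K)"
          using K(1) openin_points by blast
        have "msmooth A (points A - K) (\<lambda>r. vf_scale f X r c)"
          by (rule msmooth_cong[OF msmooth_const[of _ 0] op]) (simp add: K(3) vf_scale_def)
        then show ?thesis using op r False by blast
      qed
    qed
  qed
  show "extends_germ A q X (vf_scale f X)"
  proof -
    obtain V where "openin (mtopology A) V" "q \<in> V" "\<And>r. r \<in> V \<Longrightarrow> f r = 1"
      using assms(1) unfolding bump_at_def by blast
    then show ?thesis
      unfolding extends_germ_def using X by (intro conjI exI[of _ V]) (auto simp: vf_scale_def)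
  qed
qed

end

locale hausdorff_atlas = manifold_atlas A for A :: "('a, 'v::euclidean_space) chart set" +
  assumes hausdorff: "Hausdorff_space (mtopology A)"
begin

text \<open>A Euclidean bump supported in a closed ball inside the chart image is extended by zero.
  The preimage \<open>K\<close> of the ball is compact, and the Hausdorff property makes it closed
  in the whole manifold and not only in the chart domain, so the extension by zero is smooth at
  points outside the chart as well.\<close>

lemma exists_bump:
  assumes W: "openin (mtopology A) W" "q \<in> W"
  obtains f where "bump_at A W q f"
proof -
  have "q \<in> points A" using W openin_iff by blast
  then obtain c where c: "c \<in> A" "q \<in> fst c" by (auto simp: points_def)
  have "open (snd c ` (W \<inter> fst c))" "snd c q \<in> snd c ` (W \<inter> fst c)"
    using open_image W c by auto
  then obtain r where r: "r > 0" "cball (snd c q) r \<subseteq> snd c ` (W \<inter> fst c)"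
    using open_contains_cball by blast
  obtain h :: "'v \<Rightarrow> real" and s where h: "smooth_on UNIV h" "0 < s" "s < r"
    "\<And>x. dist (snd c q) x < s \<Longrightarrow> h x = 1" "\<And>x. dist (snd c q) x \<ge> r \<Longrightarrow> h x = 0"
    using smooth_bump[OF r(1)] by blast
  define f where "f z = (if z \<in> fst c then h (snd c z) else 0)" for z
  define K where "K = cinv c ` cball (snd c q) r"
  have K: "K = {z \<in> fst c. snd c z \<in> cball (snd c q) r}"
  proof
    show "K \<subseteq> {z \<in> fst c. snd c z \<in> cball (snd c q) r}"
      using r(2) c by (fastforce simp: K_def)
    show "{z \<in> fst c. snd c z \<in> cball (snd c q) r} \<subseteq> K"
      unfolding K_def using c by (auto intro!: image_eqI[where x="snd c z" for z])
  qed
  \<comment> \<open>The inverse of a chart is continuous because charts map open sets to open sets;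
    compactness of the ball then passes to \<open>K\<close>.\<close>
  have "continuous_map (top_of_set (cball (snd c q) r)) (mtopology A) (cinv c)"
    unfolding continuous_map_def
  proof (intro conjI allI impI)
    show "cinv c \<in> topspace (top_of_set (cball (snd c q) r)) \<rightarrow> topspace (mtopology A)"
      using r(2) c by (fastforce simp: topspace_mtopology points_def)
    fix U assume U: "openin (mtopology A) U"
    have "{x \<in> topspace (top_of_set (cball (snd c q) r)). cinv c x \<in> U} =
        cball (snd c q) r \<inter> snd c ` (U \<inter> fst c)"
      using r(2) c by fastforce
    then show "openin (top_of_set (cball (snd c q) r))
        {x \<in> topspace (top_of_set (cball (snd c q) r)). cinv c x \<in> U}"
      using open_image[OF U c(1)] by (simp add: openin_open_Int)
  qed
  then have "compactin (mtopology A) K"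
    unfolding K_def by (rule image_compactin[rotated]) (simp add: compactin_subtopology)
  then have clK: "closedin (mtopology A) K"
    using compactin_imp_closedin hausdorff by blast
  have KW: "K \<subseteq> W"
  proof
    fix z assume "z \<in> K"
    then have "z \<in> fst c" "snd c z \<in> snd c ` (W \<inter> fst c)" using K r(2) by auto
    then show "z \<in> W" using c(1) by (metis IntD1 cinv_in cinv_chart inf_le2)
  qed
  have off: "f z = 0" if "z \<notin> K" for z
    using that h(5) by (auto simp: f_def K)
  have sm: "msmooth A (points A) f"
  proof (rule msmooth_local)
    fix z assume z: "z \<in> points A"
    show "\<exists>W. openin (mtopology A) W \<and> z \<in> W \<and> msmooth A W f"
    proof (cases "z \<in> fst c")
      case True
      have "smooth_on (snd c ` fst c) (\<lambda>u. f (cinv c u))"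
        by (rule smooth_on_cong[OF smooth_on_subset[OF h(1)]])
          (use c open_chart in \<open>auto simp: f_def\<close>)
      then have "msmooth A (fst c) f"
        using msmooth_chartI[OF c(1) openin_domain[OF c(1)] order_refl] by blast
      then show ?thesis using True openin_domain[OF c(1)] by blast
    next
      case False
      have op: "openin (mtopology A) (points A - K)"
        using clK openin_points by blast
      have "msmooth A (points A - K) f"
        by (rule msmooth_cong[OF msmooth_const[of _ 0] op]) (simp add: off)
      then show ?thesis using op z False K by blast
    qed
  qed
  have "\<exists>V. openin (mtopology A) V \<and> q \<in> V \<and> (\<forall>r\<in>V. f r = 1)"
    using openin_generator[OF c(1) open_ball, of "snd c q" s] c h(2,4)
    by (intro exI[of _ "{z \<in> fst c. snd c z \<in> ball (snd c q) s}"]) (auto simp: f_def)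
  then have "bump_at A W q f"
    unfolding bump_at_def using sm clK KW off by blast
  then show thesis by (rule that)
qed

end

section \<open>Linear connections in a moving frame\<close>

text \<open>For each chart \<open>ch i\<close> the linear maps \<open>B i q\<close> and \<open>C i q\<close> convert frame components of a
  tangent vector at \<open>q\<close> to its coordinate components and back.\<close>

locale framed_atlas = hausdorff_atlas A for A :: "('a, 'v::euclidean_space) chart set" +
  fixes I :: "'i set" and ch :: "'i \<Rightarrow> ('a, 'v) chart" and B C :: "'i \<Rightarrow> 'a \<Rightarrow> 'v \<Rightarrow> 'v"
  assumes A_eq: "A = ch ` I"
    and B_linear: "linear (B i q)" and C_linear: "linear (C i q)"
    and CB [simp]: "C i q (B i q v) = v" and BC [simp]: "B i q (C i q v) = v"
    and B_smooth: "i \<in> I \<Longrightarrow> msmooth A (fst (ch i)) (\<lambda>q. B i q v)"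
    and C_smooth: "i \<in> I \<Longrightarrow> msmooth A (fst (ch i)) (\<lambda>q. C i q v)"
begin

abbreviation "VF \<equiv> vector_fields A"
abbreviation "cdom i \<equiv> fst (ch i)"

definition frame :: "'i \<Rightarrow> 'v \<Rightarrow> ('a, 'v) vfield" where
  "frame i v q = coord_vec A (ch i) (B i q v) q"

definition coords :: "'i \<Rightarrow> ('a, 'v) vfield \<Rightarrow> 'a \<Rightarrow> 'v" where
  "coords i X q = C i q (X q (ch i))"

text \<open>Defined through the coordinates of a field instead of a product of matrices, so that its
  smoothness in the point is an instance of the smoothness of coordinates.\<close>

definition frame_change :: "'i \<Rightarrow> 'i \<Rightarrow> 'a \<Rightarrow> 'v \<Rightarrow> 'v" where
  "frame_change i j q v = coords j (frame i v) q"

lemma ch_in [simp]: "i \<in> I \<Longrightarrow> ch i \<in> A"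
  by (simp add: A_eq)

lemma in_pointsE:
  assumes "q \<in> points A" obtains i where "i \<in> I" "q \<in> cdom i"
  using assms by (auto simp: points_def A_eq)

lemma dom_open: "i \<in> I \<Longrightarrow> openin (mtopology A) (cdom i)"
  by (simp add: openin_domain)

lemma dom_points: "i \<in> I \<Longrightarrow> cdom i \<subseteq> points A"
  by (simp add: domain_subset_points)

lemma frame_tangent: "i \<in> I \<Longrightarrow> frame i v q \<in> tangent_space A q"
  by (simp add: frame_def coord_vec_tangent)

lemma frame_self: "i \<in> I \<Longrightarrow> q \<in> cdom i \<Longrightarrow> frame i v q (ch i) = B i q v"
  by (simp add: frame_def coord_vec_self)

lemma coords_frame [simp]: "i \<in> I \<Longrightarrow> q \<in> cdom i \<Longrightarrow> coords i (frame i v) q = v"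
  by (simp add: coords_def frame_self)

lemma frame_coords: "(\<And>q. X q \<in> tangent_space A q) \<Longrightarrow> i \<in> I \<Longrightarrow> q \<in> cdom i \<Longrightarrow> frame i (coords i X q) q = X q"
  by (simp add: frame_def coords_def coord_vec_tangent_eq)

lemma B_coords: "B i q (coords i X q) = X q (ch i)"
  by (simp add: coords_def)

lemma linear_frame: "i \<in> I \<Longrightarrow> linear (\<lambda>v. frame i v q d)"
  unfolding frame_def
  using linear_compose[OF B_linear[of i q] linear_coord_vec[of "ch i" q d]] by (simp add: o_def)

lemma coords_change:
  assumes "\<And>q. X q \<in> tangent_space A q" "i \<in> I" "q \<in> cdom i"
  shows "coords j X q = frame_change i j q (coords i X q)"
  using frame_coords[OF assms] by (simp add: frame_change_def coords_def[of j])

lemma linear_frame_change: "i \<in> I \<Longrightarrow> linear (frame_change i j q)"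
  unfolding frame_change_def coords_def
  using linear_compose[OF linear_frame[of i q "ch j"] C_linear[of j q]] by (simp add: o_def)

lemma frame_frame_change:
  assumes "i \<in> I" "j \<in> I" "q \<in> cdom i" "q \<in> cdom j"
  shows "frame j (frame_change i j q v) q = frame i v q"
  unfolding frame_change_def using assms by (intro frame_coords frame_tangent)

lemma frame_local:
  assumes "i \<in> I"
  shows "frame i v \<in> local_fields A (cdom i)"
proof (rule local_fields_chartI[of "ch i"])
  show "msmooth A (cdom i) (\<lambda>q. frame i v q (ch i))"
    by (rule msmooth_cong[OF B_smooth[OF assms]]) (use assms dom_open frame_self in auto)
qed (use assms dom_open frame_tangent in auto)

lemma coords_smooth:
  assumes "openin (mtopology A) U" "X \<in> local_fields A U" "i \<in> I"
  shows "msmooth A (U \<inter> cdom i) (coords i X)"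
  unfolding coords_def
  by (rule msmooth_linear_apply[where L="C i" and g="\<lambda>q. X q (ch i)"])
    (use assms local_fields_smooth[OF assms(2), of "ch i"] openin_Int_domain[of U "ch i"]
      C_linear msmooth_subset[OF C_smooth] in auto)

lemma coords_smooth_dom: "X \<in> VF \<Longrightarrow> i \<in> I \<Longrightarrow> msmooth A (cdom i) (coords i X)"
  using coords_smooth[of "points A" X i] by (simp add: vector_fields_eq openin_points)

lemma frame_change_smooth:
  "i \<in> I \<Longrightarrow> j \<in> I \<Longrightarrow> msmooth A (cdom i \<inter> cdom j) (\<lambda>q. frame_change i j q v)"
  unfolding frame_change_def by (intro coords_smooth dom_open frame_local)

lemma tangent_coords_eqI:
  assumes "i \<in> I" "q \<in> cdom i" "\<And>q. X q \<in> tangent_space A q" "\<And>q. Y q \<in> tangent_space A q"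
    and "coords i X q = coords i Y q"
  shows "X q = Y q"
  using frame_coords[OF assms(3,1,2)] frame_coords[OF assms(4,1,2)] assms(5) by metis

lemma vf_eqI:
  assumes "X \<in> VF" "Y \<in> VF" "\<And>i q. i \<in> I \<Longrightarrow> q \<in> cdom i \<Longrightarrow> coords i X q = coords i Y q"
  shows "X = Y"
proof
  fix q
  have t: "X q \<in> tangent_space A q" "Y q \<in> tangent_space A q" for q
    using assms(1,2) by (auto simp: vector_fields_def)
  show "X q = Y q"
  proof (cases "q \<in> points A")
    case True
    then obtain i where i: "i \<in> I" "q \<in> cdom i" by (rule in_pointsE)
    show ?thesis by (rule tangent_coords_eqI[OF i t assms(3)[OF i]])
  next
    case False
    then show ?thesis
      using tangent_off[OF t(1)] tangent_off[OF t(2)] by (auto simp: points_def fun_eq_iff)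
  qed
qed

lemma VF_tangent: "X \<in> VF \<Longrightarrow> X q \<in> tangent_space A q"
  by (simp add: vector_fields_def)

lemma VF_I:
  assumes "\<And>q. X q \<in> tangent_space A q" "\<And>i. i \<in> I \<Longrightarrow> msmooth A (cdom i) (coords i X)"
  shows "X \<in> VF"
  unfolding vector_fields_eq local_fields_def
proof (intro CollectI conjI allI ballI assms(1))
  fix c assume "c \<in> A"
  then obtain i where i: "i \<in> I" "c = ch i" by (auto simp: A_eq)
  have "msmooth A (cdom i) (\<lambda>q. B i q (coords i X q))"
    by (rule msmooth_linear_apply[where L="B i" and g="coords i X"])
      (use i dom_open B_linear B_smooth assms(2) in auto)
  then show "msmooth A (points A \<inter> fst c) (\<lambda>q. X q c)"
    using i by (simp add: B_coords)
qed

lemma VF_add: "X \<in> VF \<Longrightarrow> Y \<in> VF \<Longrightarrow> vf_add X Y \<in> VF"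
  by (simp add: vector_fields_eq vf_add_local openin_points)

lemma VF_scale: "msmooth A (points A) f \<Longrightarrow> X \<in> VF \<Longrightarrow> vf_scale f X \<in> VF"
  by (simp add: vector_fields_eq vf_scale_local openin_points)

lemma VF_zero: "vf_zero \<in> VF"
  by (simp add: vector_fields_eq local_fields_def vf_zero_def tangent_zero msmooth_const)

lemma coords_add: "coords i (vf_add X Y) q = coords i X q + coords i Y q"
  by (simp add: coords_def vf_add_def linear_add[OF C_linear])

lemma coords_scale: "coords i (vf_scale f X) q = f q *\<^sub>R coords i X q"
  by (simp add: coords_def vf_scale_def linear_scale[OF C_linear])

definition vf_sum :: "'b set \<Rightarrow> ('b \<Rightarrow> ('a, 'v) vfield) \<Rightarrow> ('a, 'v) vfield" where
  "vf_sum S F = (\<lambda>q c. \<Sum>b\<in>S. F b q c)"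

lemma vf_sum_empty: "vf_sum {} F = vf_zero"
  and vf_sum_insert: "finite S \<Longrightarrow> b \<notin> S \<Longrightarrow> vf_sum (insert b S) F = vf_add (F b) (vf_sum S F)"
  by (simp_all add: vf_sum_def vf_zero_def vf_add_def)

lemma VF_sum: "finite S \<Longrightarrow> (\<And>b. b \<in> S \<Longrightarrow> F b \<in> VF) \<Longrightarrow> vf_sum S F \<in> VF"
  by (induction S rule: finite_induct) (auto simp: vf_sum_empty vf_sum_insert VF_zero VF_add)

text \<open>Frame fields exist on a chart domain only, hence the detour through
  \<open>conn_local\<close>.\<close>

definition conn_coef :: "('a, 'v) conn \<Rightarrow> 'i \<Rightarrow> 'a \<Rightarrow> 'v \<Rightarrow> 'v \<Rightarrow> 'v" where
  "conn_coef nab i q u v = C i q (conn_local A nab (frame i u) (frame i v) q (ch i))"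

text \<open>The transformation law of Christoffel symbols in a moving frame. The last term arises
  because a field with constant components \<open>v\<close> in frame \<open>i\<close> has the
  varying components \<open>frame_change i j r v\<close> in frame \<open>j\<close>. The map
  \<open>B i q\<close> turns the frame components \<open>u\<close> into the chart components along
  which \<open>mderiv\<close> differentiates.\<close>

definition christoffel :: "('i \<Rightarrow> 'a \<Rightarrow> 'v \<Rightarrow> 'v \<Rightarrow> 'v) \<Rightarrow> bool" where
  "christoffel G \<longleftrightarrow>
     (\<forall>i\<in>I. \<forall>q\<in>cdom i. bilinear (G i q)) \<and>
     (\<forall>i\<in>I. \<forall>u v. msmooth A (cdom i) (\<lambda>q. G i q u v)) \<and>
     (\<forall>i\<in>I. \<forall>j\<in>I. \<forall>q\<in>cdom i \<inter> cdom j. \<forall>u v.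
        frame_change i j q (G i q u v) =
        G j q (frame_change i j q u) (frame_change i j q v)
        + mderiv (ch i) (\<lambda>r. frame_change i j r v) q (B i q u))"

section \<open>Linearity and locality of a connection\<close>

context
  fixes nab :: "('a, 'v) conn"
  assumes lc: "linear_connection A nab"
begin

lemma conn_VF: "X \<in> VF \<Longrightarrow> Y \<in> VF \<Longrightarrow> nab X Y \<in> VF"
  and conn_add_left: "X \<in> VF \<Longrightarrow> X' \<in> VF \<Longrightarrow> Y \<in> VF \<Longrightarrow>
      nab (vf_add X X') Y = vf_add (nab X Y) (nab X' Y)"
  and conn_add_right: "X \<in> VF \<Longrightarrow> Y \<in> VF \<Longrightarrow> Y' \<in> VF \<Longrightarrow>
      nab X (vf_add Y Y') = vf_add (nab X Y) (nab X Y')"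
  and conn_scale_left: "msmooth A (points A) f \<Longrightarrow> X \<in> VF \<Longrightarrow> Y \<in> VF \<Longrightarrow>
      nab (vf_scale f X) Y = vf_scale f (nab X Y)"
  and conn_leibniz: "msmooth A (points A) f \<Longrightarrow> X \<in> VF \<Longrightarrow> Y \<in> VF \<Longrightarrow>
      nab X (vf_scale f Y) = vf_add (vf_scale (vf_apply A X f) Y) (vf_scale f (nab X Y))"
  and conn_off: "X \<notin> VF \<or> Y \<notin> VF \<Longrightarrow> nab X Y = vf_zero"
  using lc unfolding linear_connection_def smooth_function_iff by blast+

lemma conn_zero_left: "Y \<in> VF \<Longrightarrow> nab vf_zero Y = vf_zero"
  using conn_scale_left[of "\<lambda>_. 0" vf_zero Y] VF_zero
  by (simp add: msmooth_const) (simp add: vf_scale_def vf_zero_def)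

lemma conn_zero_right: "X \<in> VF \<Longrightarrow> nab X vf_zero = vf_zero"
  using conn_add_right[OF _ VF_zero VF_zero, of X]
  by (simp add: vf_add_def vf_zero_def fun_eq_iff)

lemma conn_sum_left:
  "finite S \<Longrightarrow> (\<And>b. b \<in> S \<Longrightarrow> F b \<in> VF) \<Longrightarrow> Y \<in> VF \<Longrightarrow>
    nab (vf_sum S F) Y = vf_sum S (\<lambda>b. nab (F b) Y)"
  by (induction S rule: finite_induct)
    (auto simp: vf_sum_empty vf_sum_insert conn_zero_left conn_add_left VF_sum)

lemma conn_sum_right:
  "finite S \<Longrightarrow> (\<And>b. b \<in> S \<Longrightarrow> F b \<in> VF) \<Longrightarrow> X \<in> VF \<Longrightarrow>
    nab X (vf_sum S F) = vf_sum S (\<lambda>b. nab X (F b))"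
  by (induction S rule: finite_induct)
    (auto simp: vf_sum_empty vf_sum_insert conn_zero_right conn_add_right VF_sum)

text \<open>Locality: multiply by a bump function supported where the fields agree.\<close>

lemma conn_germ:
  assumes X: "X \<in> VF" "X' \<in> VF" and Y: "Y \<in> VF" "Y' \<in> VF"
    and W: "openin (mtopology A) W" "q \<in> W" "\<And>r. r \<in> W \<Longrightarrow> X r = X' r" "\<And>r. r \<in> W \<Longrightarrow> Y r = Y' r"
  shows "nab X Y q = nab X' Y' q"
proof -
  obtain f where f: "bump_at A W q f" using exists_bump[OF W(1,2)] .
  have sm: "msmooth A (points A) f" and fq: "f q = 1" and off: "\<And>r. r \<notin> W \<Longrightarrow> f r = 0"
    using f unfolding bump_at_def by blast+
  have eq: "vf_scale f X = vf_scale f X'" "vf_scale f Y = vf_scale f Y'"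
    unfolding vf_scale_def using W(3,4) off by (metis (no_types, opaque_lifting) scaleR_zero_left)+
  have "vf_scale f (nab X Y) q = vf_scale f (nab X' Y) q"
    using conn_scale_left[OF sm X(1) Y(1)] conn_scale_left[OF sm X(2) Y(1)] eq(1) by metis
  then have "nab X Y q = nab X' Y q"
    by (simp add: vf_scale_def fq)
  \<comment> \<open>Both sides contain the derivative of \<open>f\<close> times the second field.
    Those terms agree at \<open>q\<close> because \<open>Y q = Y' q\<close>, and what remains is
    multiplied by \<open>f q = 1\<close>.\<close>
  moreover have "vf_add (vf_scale (vf_apply A X' f) Y) (vf_scale f (nab X' Y)) q =
      vf_add (vf_scale (vf_apply A X' f) Y') (vf_scale f (nab X' Y')) q"
    using conn_leibniz[OF sm X(2) Y(1)] conn_leibniz[OF sm X(2) Y(2)] eq(2) by metis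
  then have "nab X' Y q = nab X' Y' q"
    using W(4)[OF W(2)] by (simp add: vf_scale_def vf_add_def fq fun_eq_iff)
  ultimately show ?thesis by simp
qed

text \<open>Two extensions of the same germ agree on a common neighbourhood, so by
  \<open>conn_germ\<close> the arbitrary choice inside \<open>conn_local\<close> is
  harmless.\<close>

lemma conn_local_eq:
  assumes "extends_germ A q X X'" "extends_germ A q Y Y'"
  shows "conn_local A nab X Y q = nab X' Y' q"
proof -
  define X0 where "X0 = (SOME X'. extends_germ A q X X')"
  define Y0 where "Y0 = (SOME Y'. extends_germ A q Y Y')"
  have e: "extends_germ A q X X0" "extends_germ A q Y Y0"
    unfolding X0_def Y0_def 
    using someI[of "extends_germ A q X", OF assms(1)] someI[of "extends_germ A q Y", OF assms(2)] by auto
  obtain W1 where W1: "openin (mtopology A) W1" "q \<in> W1" "\<And>r. r \<in> W1 \<Longrightarrow> X0 r = X r"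
    using e(1) unfolding extends_germ_def by blast
  obtain W2 where W2: "openin (mtopology A) W2" "q \<in> W2" "\<And>r. r \<in> W2 \<Longrightarrow> Y0 r = Y r"
    using e(2) unfolding extends_germ_def by blast
  obtain W3 where W3: "openin (mtopology A) W3" "q \<in> W3" "\<And>r. r \<in> W3 \<Longrightarrow> X' r = X r"
    using assms(1) unfolding extends_germ_def by blast
  obtain W4 where W4: "openin (mtopology A) W4" "q \<in> W4" "\<And>r. r \<in> W4 \<Longrightarrow> Y' r = Y r"
    using assms(2) unfolding extends_germ_def by blast
  have "nab X0 Y0 q = nab X' Y' q"
  proof (rule conn_germ[where W="W1 \<inter> W2 \<inter> W3 \<inter> W4"])
    show "openin (mtopology A) (W1 \<inter> W2 \<inter> W3 \<inter> W4)" using W1 W2 W3 W4 by blast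
  qed (use W1 W2 W3 W4 e assms in \<open>auto simp: extends_germ_def\<close>)
  then show ?thesis by (simp add: conn_local_def X0_def Y0_def)
qed

lemma conn_coef_eq:
  assumes "extends_germ A q (frame i u) X" "extends_germ A q (frame i v) Y"
  shows "conn_coef nab i q u v = coords i (nab X Y) q"
  unfolding conn_coef_def conn_local_eq[OF assms] coords_def ..

end

section \<open>Global extensions of frames, functions and field expansions\<close>

definition extends_frame :: "'i \<Rightarrow> 'a set \<Rightarrow> ('v \<Rightarrow> ('a, 'v) vfield) \<Rightarrow> bool" where
  "extends_frame i V E \<longleftrightarrow> openin (mtopology A) V \<and> V \<subseteq> cdom i \<and>
     (\<forall>v. E v \<in> VF \<and> (\<forall>r\<in>V. E v r = frame i v r))"

lemma extends_frameD:
  assumes "extends_frame i V E"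
  shows "openin (mtopology A) V" "V \<subseteq> cdom i" "E v \<in> VF" "r \<in> V \<Longrightarrow> E v r = frame i v r"
    "r \<in> V \<Longrightarrow> extends_germ A r (frame i v) (E v)"
  using assms by (auto simp: extends_frame_def extends_germ_def)

text \<open>One bump function rescales every frame field, so the neighbourhood \<open>V\<close> is
  the same for all \<open>v\<close>.\<close>

lemma frame_extension:
  assumes i: "i \<in> I" "q \<in> cdom i"
  obtains V E where "q \<in> V" "extends_frame i V E"
proof -
  obtain f where f: "bump_at A (cdom i) q f" using exists_bump[OF dom_open[OF i(1)] i(2)] .
  then obtain V0 where V0: "openin (mtopology A) V0" "q \<in> V0" "\<And>r. r \<in> V0 \<Longrightarrow> f r = 1"
    unfolding bump_at_def by blast
  define V where "V = V0 \<inter> cdom i"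
  have V: "openin (mtopology A) V" "q \<in> V" "V \<subseteq> cdom i"
    using V0 dom_open[OF i(1)] i(2) by (auto simp: V_def)
  have E: "vf_scale f (frame i v) \<in> VF" for v
    using bump_extends_germ(1)[OF f dom_open[OF i(1)] frame_local[OF i(1)]] .
  have eq: "vf_scale f (frame i v) r = frame i v r" if "r \<in> V" for r v
    using that V0(3) by (simp add: vf_scale_def V_def)
  show thesis
    by (rule that[of V "\<lambda>v. vf_scale f (frame i v)"]) (use V E eq in \<open>auto simp: extends_frame_def\<close>)
qed

lemma function_extension:
  assumes g: "msmooth A W g" and W: "openin (mtopology A) W" "q \<in> W"
  obtains V h where "openin (mtopology A) V" "q \<in> V" "msmooth A (points A) h"
    "\<And>r. r \<in> V \<Longrightarrow> h r = (g r :: real)"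
proof -
  obtain f where f: "bump_at A W q f" using exists_bump[OF W] .
  then obtain V where V: "openin (mtopology A) V" "q \<in> V" "\<And>r. r \<in> V \<Longrightarrow> f r = 1"
    unfolding bump_at_def by blast
  show thesis
    by (rule that[OF V(1,2) bump_mult_smooth[OF f W(1) g]]) (simp add: V(3))
qed

text \<open>Near \<open>q\<close> a field is a combination of frame fields with its coordinates as
  coefficients. Replacing both by global extensions makes it a finite sum of products of global
  functions and global fields, the only shape to which the axioms of a connection apply.\<close>

lemma field_extension:
  assumes X: "X \<in> VF" and i: "i \<in> I" "q \<in> cdom i"
    and q: "q \<in> V" and E: "extends_frame i V E"
  obtains W h where "openin (mtopology A) W" "q \<in> W" "W \<subseteq> V" "\<And>b. msmooth A (points A) (h b)"
    "\<And>b r. b \<in> Basis \<Longrightarrow> r \<in> W \<Longrightarrow> h b r = coords i X r \<bullet> b"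
    "\<And>r. r \<in> W \<Longrightarrow> vf_sum Basis (\<lambda>b. vf_scale (h b) (E b)) r = X r"
    "vf_sum Basis (\<lambda>b. vf_scale (h b) (E b)) \<in> VF"
proof -
  note V = extends_frameD(1)[OF E] q extends_frameD(2)[OF E] extends_frameD(4)[OF E] extends_frameD(3)[OF E]
  have "\<exists>h W. openin (mtopology A) W \<and> q \<in> W \<and> msmooth A (points A) h \<and>
      (\<forall>r\<in>W. h r = coords i X r \<bullet> b)" for b
  proof -
    have "msmooth A (cdom i) (\<lambda>r. coords i X r \<bullet> b)"
      by (intro msmooth_inner_left dom_open i coords_smooth_dom X)
    from function_extension[OF this dom_open[OF i(1)] i(2)] show ?thesis by metis
  qed
  then obtain h W where hW: "\<And>b. openin (mtopology A) (W b)" "\<And>b. q \<in> W b"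
    "\<And>b. msmooth A (points A) (h b)" "\<And>b r. r \<in> W b \<Longrightarrow> h b r = coords i X r \<bullet> b"
    by metis
  define U where "U = V \<inter> (\<Inter>b\<in>Basis. W b)"
  have U: "openin (mtopology A) U" "q \<in> U" "U \<subseteq> V"
    unfolding U_def using hW V by (auto intro!: openin_Int openin_INT2)
  have "vf_sum Basis (\<lambda>b. vf_scale (h b) (E b)) r = X r" if "r \<in> U" for r
  proof
    fix d
    have r: "r \<in> cdom i" "r \<in> V" "\<And>b. b \<in> Basis \<Longrightarrow> r \<in> W b" using that V by (auto simp: U_def)
    have "vf_sum Basis (\<lambda>b. vf_scale (h b) (E b)) r d =
        (\<Sum>b\<in>Basis. (coords i X r \<bullet> b) *\<^sub>R frame i b r d)"
      by (simp add: vf_sum_def vf_scale_def V(4)[OF r(2)] hW(4)[OF r(3)])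
    also have "\<dots> = frame i (coords i X r) r d"
      using linear_sum_Basis[OF linear_frame[OF i(1)], symmetric] .
    finally show "vf_sum Basis (\<lambda>b. vf_scale (h b) (E b)) r d = X r d"
      using frame_coords[OF VF_tangent[OF X] i(1) r(1)] by simp
  qed
  moreover have "vf_sum Basis (\<lambda>b. vf_scale (h b) (E b)) \<in> VF"
    using hW(3) V(5) by (intro VF_sum VF_scale) auto
  ultimately show thesis
    using U hW(3,4) by (intro that[of U h]) (auto simp: U_def)
qed

section \<open>The coefficients of a given connection\<close>

context
  fixes nab :: "('a, 'v) conn"
  assumes lc: "linear_connection A nab"
begin

text \<open>After expanding both fields, linearity over functions in the first argument and the
  Leibniz rule in the second leave the connection only on frame fields. The formula stays in basis
  form because bilinearity of \<open>conn_coef\<close> is not yet known; it is a consequence of this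
  formula.\<close>

lemma conn_formula_Basis:
  assumes X: "X \<in> VF" and Y: "Y \<in> VF" and i: "i \<in> I" "q \<in> cdom i"
  shows "coords i (nab X Y) q = mderiv (ch i) (coords i Y) q (X q (ch i)) +
    (\<Sum>b\<in>Basis. (coords i X q \<bullet> b) *\<^sub>R
      (\<Sum>b'\<in>Basis. (coords i Y q \<bullet> b') *\<^sub>R conn_coef nab i q b b'))"
proof -
  obtain V E where q: "q \<in> V" and E: "extends_frame i V E"
    using frame_extension[OF i] .
  note VE = extends_frameD(1)[OF E] q extends_frameD(2-5)[OF E]
  obtain W h where W: "openin (mtopology A) W" "q \<in> W" "W \<subseteq> V" and h: "\<And>b. msmooth A (points A) (h b)"
    "\<And>b r. b \<in> Basis \<Longrightarrow> r \<in> W \<Longrightarrow> h b r = coords i X r \<bullet> b"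
    "\<And>r. r \<in> W \<Longrightarrow> vf_sum Basis (\<lambda>b. vf_scale (h b) (E b)) r = X r"
    "vf_sum Basis (\<lambda>b. vf_scale (h b) (E b)) \<in> VF"
    using field_extension[OF X i q E] by blast
  obtain W' h' where W': "openin (mtopology A) W'" "q \<in> W'" "W' \<subseteq> V"
    and h': "\<And>b. msmooth A (points A) (h' b)"
    "\<And>b r. b \<in> Basis \<Longrightarrow> r \<in> W' \<Longrightarrow> h' b r = coords i Y r \<bullet> b"
    "\<And>r. r \<in> W' \<Longrightarrow> vf_sum Basis (\<lambda>b. vf_scale (h' b) (E b)) r = Y r"
    "vf_sum Basis (\<lambda>b. vf_scale (h' b) (E b)) \<in> VF"
    using field_extension[OF Y i q E] by blast
  let ?X = "vf_sum Basis (\<lambda>b. vf_scale (h b) (E b))" and ?Y = "vf_sum Basis (\<lambda>b. vf_scale (h' b) (E b))"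
  let ?D = "mderiv (ch i) (coords i Y) q"
  \<comment> \<open>The expansions agree with the fields only near \<open>q\<close>; locality is
    what allows the replacement.\<close>
  have "nab X Y q = nab ?X ?Y q"
    by (rule conn_germ[OF lc X h(4) Y h'(4), where W="W \<inter> W'"])
      (use W W' h(3) h'(3) in auto)
  then have "coords i (nab X Y) q = coords i (nab ?X ?Y) q"
    by (simp add: coords_def)
  also have "nab ?X ?Y = vf_sum Basis (\<lambda>b. vf_scale (h b) (nab (E b) ?Y))"
    using conn_sum_left[OF lc finite_Basis, of "\<lambda>b. vf_scale (h b) (E b)" ?Y] h h' VE(4)
    by (simp add: VF_scale conn_scale_left[OF lc])
  also have "coords i \<dots> q = (\<Sum>b\<in>Basis. (coords i X q \<bullet> b) *\<^sub>R coords i (nab (E b) ?Y) q)"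
    using h(2) W(2)
    by (simp add: coords_def vf_sum_def linear_sum[OF C_linear] vf_scale_def linear_scale[OF C_linear])
  also have "\<dots> = (\<Sum>b\<in>Basis. (coords i X q \<bullet> b) *\<^sub>R (?D (B i q b) +
      (\<Sum>b'\<in>Basis. (coords i Y q \<bullet> b') *\<^sub>R conn_coef nab i q b b')))"
  proof (rule sum.cong[OF refl])
    fix b :: 'v assume b: "b \<in> Basis"
    have "nab (E b) ?Y = vf_sum Basis (\<lambda>b'. vf_add (vf_scale (vf_apply A (E b) (h' b')) (E b'))
        (vf_scale (h' b') (nab (E b) (E b'))))"
      using conn_sum_right[OF lc finite_Basis, of "\<lambda>b. vf_scale (h' b) (E b)" "E b"] h' VE(4)
      by (simp add: VF_scale conn_leibniz[OF lc])
    then have "coords i (nab (E b) ?Y) q = (\<Sum>b'\<in>Basis. vf_apply A (E b) (h' b') q *\<^sub>R coords i (E b') q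
        + h' b' q *\<^sub>R coords i (nab (E b) (E b')) q)"
      by (simp add: coords_def vf_sum_def linear_sum[OF C_linear] vf_scale_def vf_add_def
          linear_scale[OF C_linear] linear_add[OF C_linear])
    also have "\<dots> = (\<Sum>b'\<in>Basis. (?D (B i q b) \<bullet> b') *\<^sub>R b' + (coords i Y q \<bullet> b') *\<^sub>R conn_coef nab i q b b')"
    proof (rule sum.cong[OF refl])
      fix b' :: 'v assume b': "b' \<in> Basis"
      have "coords i (E b') q = b'"
        using VE(5)[OF VE(2)] coords_frame[OF i, of b'] by (simp add: coords_def)
      moreover have "coords i (nab (E b) (E b')) q = conn_coef nab i q b b'"
        using conn_coef_eq[OF lc VE(6)[OF VE(2)] VE(6)[OF VE(2)]] by simp
      \<comment> \<open>Near \<open>q\<close> the global function \<open>h' b'\<close> is a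
        coordinate of \<open>Y\<close>, so its derivative along the frame field is the corresponding
        component of the derivative of all coordinates.\<close>
      moreover have "vf_apply A (E b) (h' b') q = ?D (B i q b) \<bullet> b'"
      proof -
        have "vf_apply A (E b) (h' b') q = mderiv (ch i) (h' b') q (B i q b)"
          using vf_apply_eq[OF h'(1) VE(4) ch_in[OF i(1)] i(2)] VE(5)[OF VE(2)] frame_self[OF i]
          by simp
        also have "mderiv (ch i) (h' b') q = mderiv (ch i) (\<lambda>r. coords i Y r \<bullet> b') q"
          by (rule mderiv_cong[OF W'(1,2)]) (use b' h'(2) i in auto)
        also have "\<dots> (B i q b) = ?D (B i q b) \<bullet> b'"
          using mderiv_bounded_linear[OF bounded_linear_inner_left coords_smooth_dom[OF Y i(1)] i(2)] i
          by simp
        finally show ?thesis .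
      qed
      ultimately show "vf_apply A (E b) (h' b') q *\<^sub>R coords i (E b') q
        + h' b' q *\<^sub>R coords i (nab (E b) (E b')) q =
        (?D (B i q b) \<bullet> b') *\<^sub>R b' + (coords i Y q \<bullet> b') *\<^sub>R conn_coef nab i q b b'"
        using h'(2)[OF b' W'(2)] by simp
    qed
    also have "\<dots> = ?D (B i q b) + (\<Sum>b'\<in>Basis. (coords i Y q \<bullet> b') *\<^sub>R conn_coef nab i q b b')"
      by (simp add: sum.distrib euclidean_representation)
    finally show "(coords i X q \<bullet> b) *\<^sub>R coords i (nab (E b) ?Y) q = (coords i X q \<bullet> b) *\<^sub>R (?D (B i q b) +
      (\<Sum>b'\<in>Basis. (coords i Y q \<bullet> b') *\<^sub>R conn_coef nab i q b b'))" by simp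
  qed
  also have "\<dots> = (\<Sum>b\<in>Basis. (coords i X q \<bullet> b) *\<^sub>R ?D (B i q b)) + (\<Sum>b\<in>Basis. (coords i X q \<bullet> b) *\<^sub>R
      (\<Sum>b'\<in>Basis. (coords i Y q \<bullet> b') *\<^sub>R conn_coef nab i q b b'))"
    by (simp add: sum.distrib scaleR_add_right)
  \<comment> \<open>Linearity reassembles the direction: the coordinates of \<open>X\<close>,
    carried by \<open>B\<close>, are the chart components of \<open>X\<close>.\<close>
  also have "(\<Sum>b\<in>Basis. (coords i X q \<bullet> b) *\<^sub>R ?D (B i q b)) = ?D (X q (ch i))"
  proof -
    have "linear ?D" using linear_mderiv[OF coords_smooth_dom[OF Y i(1)] i(2)] i by simp
    then have "linear (\<lambda>v. ?D (B i q v))"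
      using linear_compose[OF B_linear] by (fastforce simp: o_def)
    from linear_sum_Basis[OF this, of "coords i X q"] show ?thesis by (simp add: B_coords)
  qed
  finally show ?thesis .
qed

text \<open>Apply the formula to extended frame fields. Their coordinates are constant near
  \<open>q\<close>, so the derivative term drops out and the basis expansion remains.\<close>

lemma conn_coef_expand:
  assumes i: "i \<in> I" "q \<in> cdom i"
  shows "conn_coef nab i q u v =
    (\<Sum>b\<in>Basis. (u \<bullet> b) *\<^sub>R (\<Sum>b'\<in>Basis. (v \<bullet> b') *\<^sub>R conn_coef nab i q b b'))"
proof -
  obtain V E where q: "q \<in> V" and E: "extends_frame i V E"
    using frame_extension[OF i] .
  note VE = extends_frameD(1)[OF E] q extends_frameD(2-5)[OF E]
  have c: "coords i (E w) r = w" if "r \<in> V" for w r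
    using coords_frame[OF i(1), of r w] VE(3,5) that by (auto simp: coords_def)
  have "mderiv (ch i) (coords i (E v)) q = mderiv (ch i) (\<lambda>r. v) q"
    by (rule mderiv_cong[OF VE(1,2)]) (use c i in auto)
  then show ?thesis
    using conn_formula_Basis[OF VE(4) VE(4) i, of u v]
      conn_coef_eq[OF lc VE(6)[OF VE(2)] VE(6)[OF VE(2)], of u v] c[OF VE(2)] by simp
qed

lemma conn_formula:
  assumes "X \<in> VF" "Y \<in> VF" "i \<in> I" "q \<in> cdom i"
  shows "coords i (nab X Y) q =
    mderiv (ch i) (coords i Y) q (X q (ch i)) + conn_coef nab i q (coords i X q) (coords i Y q)"
  using conn_formula_Basis[OF assms] conn_coef_expand[OF assms(3,4), of "coords i X q" "coords i Y q"] by simp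

lemma conn_coef_bilinear:
  assumes "i \<in> I" "q \<in> cdom i"
  shows "bilinear (conn_coef nab i q)"
  unfolding bilinear_def
proof (intro conjI allI linearI)
  fix u u' v v' and k :: real
  note ex = conn_coef_expand[OF assms]
  show "conn_coef nab i q u (v + v') = conn_coef nab i q u v + conn_coef nab i q u v'"
    by (subst (1 2 3) ex) (simp add: inner_add_left scaleR_add_left scaleR_add_right sum.distrib)
  show "conn_coef nab i q (u + u') v = conn_coef nab i q u v + conn_coef nab i q u' v"
    by (subst (1 2 3) ex) (simp add: inner_add_left scaleR_add_left scaleR_add_right sum.distrib)
  show "conn_coef nab i q u (k *\<^sub>R v) = k *\<^sub>R conn_coef nab i q u v"
    by (subst (1 2) ex) (simp add: scaleR_sum_right mult_ac)
  show "conn_coef nab i q (k *\<^sub>R u) v = k *\<^sub>R conn_coef nab i q u v"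
    by (subst (1 2) ex) (simp add: scaleR_sum_right mult_ac)
qed

text \<open>Near each point the coefficient function is a coordinate of one global field, namely
  \<open>nab (E u) (E v)\<close>, even though its definition chooses extensions afresh at every
  point.\<close>

lemma conn_coef_smooth:
  assumes i: "i \<in> I"
  shows "msmooth A (cdom i) (\<lambda>q. conn_coef nab i q u v)"
proof (rule msmooth_local)
  fix q assume q: "q \<in> cdom i"
  obtain V E where q: "q \<in> V" and E: "extends_frame i V E"
    using frame_extension[OF i q] .
  note VE = extends_frameD(1)[OF E] q extends_frameD(2-5)[OF E]
  have "msmooth A V (coords i (nab (E u) (E v)))"
    using coords_smooth_dom[OF conn_VF[OF lc VE(4) VE(4)] i] VE(3) msmooth_subset by blast
  then have "msmooth A V (\<lambda>q. conn_coef nab i q u v)"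
    by (rule msmooth_cong[OF _ VE(1)]) (use conn_coef_eq[OF lc VE(6) VE(6)] in simp)
  then show "\<exists>W. openin (mtopology A) W \<and> q \<in> W \<and> msmooth A W (\<lambda>q. conn_coef nab i q u v)"
    using VE by blast
qed

text \<open>The single field \<open>nab (E u) (E v)\<close> is read in both frames. In frame
  \<open>i\<close> the coordinates of \<open>E v\<close> are constant; in frame \<open>j\<close>
  they are the frame change applied to \<open>v\<close>, whose derivative is the inhomogeneous
  term.\<close>

lemma conn_coef_change:
  assumes i: "i \<in> I" "q \<in> cdom i" and j: "j \<in> I" "q \<in> cdom j"
  shows "frame_change i j q (conn_coef nab i q u v) =
    conn_coef nab j q (frame_change i j q u) (frame_change i j q v)
    + mderiv (ch i) (\<lambda>r. frame_change i j r v) q (B i q u)"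
proof -
  obtain V E where q: "q \<in> V" and E: "extends_frame i V E"
    using frame_extension[OF i] .
  note VE = extends_frameD(1)[OF E] q extends_frameD(2-5)[OF E]
  have c: "coords j (E w) r = frame_change i j r w" if "r \<in> V" for w r
    using VE(5)[OF that] by (simp add: frame_change_def coords_def)
  have nVF: "nab (E u) (E v) \<in> VF" using conn_VF[OF lc VE(4) VE(4)] .
  have "frame_change i j q (conn_coef nab i q u v) = coords j (nab (E u) (E v)) q"
    using coords_change[OF VF_tangent[OF nVF] i, of j]
      conn_coef_eq[OF lc VE(6)[OF VE(2)] VE(6)[OF VE(2)], of u v] by simp
  also have "\<dots> = mderiv (ch j) (coords j (E v)) q (E u q (ch j)) +
      conn_coef nab j q (frame_change i j q u) (frame_change i j q v)"
    using conn_formula[OF VE(4) VE(4) j, of u v] c[OF VE(2)] by simp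
  also have "mderiv (ch j) (coords j (E v)) q = mderiv (ch j) (\<lambda>r. frame_change i j r v) q"
    by (rule mderiv_cong[OF VE(1,2)]) (use c j in auto)
  also have "E u q (ch j) = frechet_derivative (transition (ch i) (ch j)) (at (snd (ch i) q)) (B i q u)"
    using VE(5)[OF VE(2)] i j by (simp add: frame_def coord_vec_def)
  also have "mderiv (ch j) (\<lambda>r. frame_change i j r v) q \<dots> =
      mderiv (ch i) (\<lambda>r. frame_change i j r v) q (B i q u)"
    by (rule mderiv_change_chart[OF frame_change_smooth[OF i(1) j(1)]]) (use i j in auto)
  finally show ?thesis by simp
qed

lemma christoffel_conn_coef: "christoffel (conn_coef nab)"
  unfolding christoffel_def
  by (intro conjI ballI allI conn_coef_bilinear conn_coef_smooth conn_coef_change) auto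

end

lemma conn_eqI:
  assumes lc: "linear_connection A nab" "linear_connection A nab'"
    and eq: "\<And>i q. i \<in> I \<Longrightarrow> q \<in> cdom i \<Longrightarrow> conn_coef nab i q = conn_coef nab' i q"
  shows "nab = nab'"
proof (intro ext[of nab nab'] ext[of "nab X" "nab' X" for X])
  fix X Y
  show "nab X Y = nab' X Y"
  proof (cases "X \<in> VF \<and> Y \<in> VF")
    case True
    then show ?thesis
      using conn_VF[OF lc(1)] conn_VF[OF lc(2)] conn_formula[OF lc(1)] conn_formula[OF lc(2)] eq
      by (intro vf_eqI) auto
  next
    case False
    then show ?thesis using conn_off[OF lc(1)] conn_off[OF lc(2)] by metis
  qed
qed

text \<open>The chart around \<open>q\<close> is arbitrary, and \<open>conn_of_change\<close> shows
  that the choice does not matter. The zero values meet the last clause of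
  \<open>linear_connection\<close> and the convention that fields vanish off the manifold.\<close>

definition conn_of :: "('i \<Rightarrow> 'a \<Rightarrow> 'v \<Rightarrow> 'v \<Rightarrow> 'v) \<Rightarrow> ('a, 'v) conn" where
  "conn_of G X Y q =
     (if X \<in> VF \<and> Y \<in> VF \<and> q \<in> points A
      then let i = (SOME i. i \<in> I \<and> q \<in> cdom i) in
        frame i (mderiv (ch i) (coords i Y) q (X q (ch i)) + G i q (coords i X q) (coords i Y q)) q
      else (\<lambda>d. 0))"

context
  fixes G :: "'i \<Rightarrow> 'a \<Rightarrow> 'v \<Rightarrow> 'v \<Rightarrow> 'v"
  assumes G: "christoffel G"
begin

lemma G_bilinear: "i \<in> I \<Longrightarrow> q \<in> cdom i \<Longrightarrow> bilinear (G i q)"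
  and G_smooth: "i \<in> I \<Longrightarrow> msmooth A (cdom i) (\<lambda>q. G i q u v)"
  and G_change: "i \<in> I \<Longrightarrow> j \<in> I \<Longrightarrow> q \<in> cdom i \<Longrightarrow> q \<in> cdom j \<Longrightarrow>
      frame_change i j q (G i q u v) = G j q (frame_change i j q u) (frame_change i j q v)
        + mderiv (ch i) (\<lambda>r. frame_change i j r v) q (B i q u)"
  using G unfolding christoffel_def by blast+

text \<open>Differentiating the coordinates of \<open>Y\<close> in frame \<open>j\<close> as a
  product of the frame change and the coordinates in frame \<open>i\<close> yields an extra term
  with the derivative of the frame change. It is exactly the inhomogeneous term of
  \<open>christoffel\<close>, with the opposite effect.\<close>

lemma conn_of_change:
  assumes X: "X \<in> VF" and Y: "Y \<in> VF" and i: "i \<in> I" "q \<in> cdom i" and j: "j \<in> I" "q \<in> cdom j"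
  shows "mderiv (ch j) (coords j Y) q (X q (ch j)) + G j q (coords j X q) (coords j Y q) =
    frame_change i j q (mderiv (ch i) (coords i Y) q (X q (ch i)) + G i q (coords i X q) (coords i Y q))"
proof -
  let ?P = "frame_change i j"
  let ?D = "\<lambda>f. mderiv (ch i) f q (X q (ch i))"
  have op: "openin (mtopology A) (cdom i \<inter> cdom j)"
    using dom_open i(1) j(1) by blast
  have "mderiv (ch j) (coords j Y) q (X q (ch j)) =
      mderiv (ch j) (coords j Y) q (frechet_derivative (transition (ch i) (ch j)) (at (snd (ch i) q)) (X q (ch i)))"
    using tangent_transition[OF VF_tangent[OF X], of "ch i" "ch j" q] i j by simp
  also have "\<dots> = ?D (coords j Y)"
    by (rule mderiv_change_chart[OF coords_smooth_dom[OF Y j(1)]]) (use i j in auto)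
  also have "\<dots> = ?D (\<lambda>r. ?P r (coords i Y r))"
    by (rule fun_cong[OF mderiv_cong[OF op]])
      (use i j coords_change[OF VF_tangent[OF Y], where i=i and j=j] in auto)
  also have "\<dots> = ?P q (?D (coords i Y)) + (\<Sum>b\<in>Basis. (coords i Y q \<bullet> b) *\<^sub>R ?D (\<lambda>r. ?P r b))"
    by (rule mderiv_linear_apply[OF op])
      (use i j linear_frame_change frame_change_smooth msmooth_subset[OF coords_smooth_dom[OF Y i(1)]] in auto)
  \<comment> \<open>The same product rule, applied with the coordinates of \<open>Y\<close> frozen
    at \<open>q\<close>, identifies the sum with the derivative of the frame change on a fixed
    vector.\<close>
  also have "(\<Sum>b\<in>Basis. (coords i Y q \<bullet> b) *\<^sub>R ?D (\<lambda>r. ?P r b)) = ?D (\<lambda>r. ?P r (coords i Y q))"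
  proof -
    have "?D (\<lambda>r. ?P r (coords i Y q)) = ?P q (?D (\<lambda>r. coords i Y q))
        + (\<Sum>b\<in>Basis. (coords i Y q \<bullet> b) *\<^sub>R ?D (\<lambda>r. ?P r b))"
      by (rule mderiv_linear_apply[OF op])
        (use i j linear_frame_change frame_change_smooth msmooth_const in auto)
    then show ?thesis by (simp add: linear_0[OF linear_frame_change[OF i(1)]])
  qed
  finally have D: "mderiv (ch j) (coords j Y) q (X q (ch j)) =
      ?P q (?D (coords i Y)) + ?D (\<lambda>r. ?P r (coords i Y q))" .
  have "?P q (G i q (coords i X q) (coords i Y q)) =
      G j q (coords j X q) (coords j Y q) + ?D (\<lambda>r. ?P r (coords i Y q))"
    using G_change[OF i(1) j(1) i(2) j(2)] coords_change[OF VF_tangent[OF X] i, of j]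
      coords_change[OF VF_tangent[OF Y] i, of j] by (simp add: B_coords)
  with D show ?thesis by (simp add: linear_add[OF linear_frame_change[OF i(1)]])
qed

lemma coords_conn_of:
  assumes X: "X \<in> VF" and Y: "Y \<in> VF" and i: "i \<in> I" "q \<in> cdom i"
  shows "coords i (conn_of G X Y) q =
    mderiv (ch i) (coords i Y) q (X q (ch i)) + G i q (coords i X q) (coords i Y q)"
proof -
  define j where "j = (SOME i. i \<in> I \<and> q \<in> cdom i)"
  have j: "j \<in> I" "q \<in> cdom j"
    unfolding j_def using someI[of "\<lambda>i. i \<in> I \<and> q \<in> cdom i", OF conjI[OF i]] by auto
  have "q \<in> points A" using i dom_points by blast
  then have "conn_of G X Y q =
      frame j (mderiv (ch j) (coords j Y) q (X q (ch j)) + G j q (coords j X q) (coords j Y q)) q"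
    using X Y by (simp add: conn_of_def Let_def j_def)
  also have "\<dots> = frame i (mderiv (ch i) (coords i Y) q (X q (ch i)) + G i q (coords i X q) (coords i Y q)) q"
    using conn_of_change[OF X Y i j] frame_frame_change[OF i(1) j(1) i(2) j(2)] by simp
  finally show ?thesis using coords_frame[OF i] by (simp add: coords_def)
qed

lemma conn_of_VF:
  assumes X: "X \<in> VF" and Y: "Y \<in> VF"
  shows "conn_of G X Y \<in> VF"
proof (rule VF_I)
  fix q
  show "conn_of G X Y q \<in> tangent_space A q"
  proof (cases "q \<in> points A")
    case True
    then have "(SOME i. i \<in> I \<and> q \<in> cdom i) \<in> I" using in_pointsE by (metis (mono_tags, lifting) someI)
    then show ?thesis by (simp add: conn_of_def Let_def frame_tangent tangent_zero)
  next
    case False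
    then show ?thesis by (simp add: conn_of_def tangent_zero)
  qed
next
  fix i assume i: "i \<in> I"
  note cs = coords_smooth_dom[OF X i] coords_smooth_dom[OF Y i]
  have Xi: "msmooth A (cdom i) (\<lambda>q. X q (ch i))"
    using local_fields_smooth[of X "points A" "ch i"] X i by (simp add: vector_fields_eq)
  have "msmooth A (cdom i) (\<lambda>q. G i q (coords i X q) (coords i Y q))"
  proof (rule msmooth_linear_apply[OF dom_open[OF i] _ _ cs(2)])
    show "linear (G i q (coords i X q))" if "q \<in> cdom i" for q
      using G_bilinear[OF i that] by (simp add: bilinear_def)
    show "msmooth A (cdom i) (\<lambda>q. G i q (coords i X q) b)" for b
      by (rule msmooth_linear_apply[OF dom_open[OF i] _ _ cs(1), where L="\<lambda>q w. G i q w b"])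
        (use G_bilinear[OF i] G_smooth[OF i] in \<open>auto simp: bilinear_def\<close>)
  qed
  then have "msmooth A (cdom i)
      (\<lambda>q. mderiv (ch i) (coords i Y) q (X q (ch i)) + G i q (coords i X q) (coords i Y q))"
    using i by (intro msmooth_add msmooth_mderiv dom_open cs(2) Xi) auto
  then show "msmooth A (cdom i) (coords i (conn_of G X Y))"
    by (rule msmooth_cong[OF _ dom_open[OF i]]) (use coords_conn_of[OF X Y i] in simp)
qed

lemma linear_connection_conn_of: "linear_connection A (conn_of G)"
proof -
  have left_lin: "linear (\<lambda>w. mderiv (ch i) (coords i Y) q w)" "linear (\<lambda>u. G i q u v)" "linear (G i q u)"
    if "Y \<in> VF" "i \<in> I" "q \<in> cdom i" for i q Y u v
    using linear_mderiv[OF coords_smooth_dom[OF that(1,2)] that(3)] G_bilinear[OF that(2,3)] that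
    by (auto simp: bilinear_def)
  have add1: "conn_of G (vf_add X X') Y = vf_add (conn_of G X Y) (conn_of G X' Y)"
    if "X \<in> VF" "X' \<in> VF" "Y \<in> VF" for X X' Y
  proof (intro vf_eqI conn_of_VF VF_add that)
    fix i q assume i: "i \<in> I" "q \<in> cdom i"
    have "vf_add X X' q (ch i) = X q (ch i) + X' q (ch i)" by (simp add: vf_add_def)
    then show "coords i (conn_of G (vf_add X X') Y) q = coords i (vf_add (conn_of G X Y) (conn_of G X' Y)) q"
      using that i
      by (simp add: coords_conn_of VF_add coords_add linear_add[OF left_lin(2)] linear_add[OF left_lin(1)])
  qed
  have scale1: "conn_of G (vf_scale f X) Y = vf_scale f (conn_of G X Y)"
    if f: "msmooth A (points A) f" and XY: "X \<in> VF" "Y \<in> VF" for X f Y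
  proof (intro vf_eqI conn_of_VF VF_scale f XY)
    fix i q assume i: "i \<in> I" "q \<in> cdom i"
    have "vf_scale f X q (ch i) = f q *\<^sub>R X q (ch i)" by (simp add: vf_scale_def)
    then show "coords i (conn_of G (vf_scale f X) Y) q = coords i (vf_scale f (conn_of G X Y)) q"
      using f XY i
      by (simp add: coords_conn_of VF_scale coords_scale linear_scale[OF left_lin(2)]
          linear_scale[OF left_lin(1)] scaleR_add_right)
  qed
  have add2: "conn_of G X (vf_add Y Y') = vf_add (conn_of G X Y) (conn_of G X Y')"
    if "X \<in> VF" "Y \<in> VF" "Y' \<in> VF" for X Y Y'
  proof (intro vf_eqI conn_of_VF VF_add that)
    fix i q assume i: "i \<in> I" "q \<in> cdom i"
    have "mderiv (ch i) (coords i (vf_add Y Y')) q (X q (ch i)) =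
        mderiv (ch i) (coords i Y) q (X q (ch i)) + mderiv (ch i) (coords i Y') q (X q (ch i))"
      unfolding coords_add[abs_def]
      by (rule mderiv_add[OF coords_smooth_dom coords_smooth_dom i(2)]) (use that i in auto)
    then show "coords i (conn_of G X (vf_add Y Y')) q = coords i (vf_add (conn_of G X Y) (conn_of G X Y')) q"
      using that i by (simp add: coords_conn_of VF_add coords_add linear_add[OF left_lin(3)])
  qed
  have leibniz: "conn_of G X (vf_scale f Y) =
      vf_add (vf_scale (vf_apply A X f) Y) (vf_scale f (conn_of G X Y))"
    if f: "msmooth A (points A) f" and XY: "X \<in> VF" "Y \<in> VF" for f X Y
  proof (intro vf_eqI conn_of_VF VF_add VF_scale f XY vf_apply_smooth)
    fix i q assume i: "i \<in> I" "q \<in> cdom i"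
    have "mderiv (ch i) (coords i (vf_scale f Y)) q (X q (ch i)) =
        mderiv (ch i) f q (X q (ch i)) *\<^sub>R coords i Y q + f q *\<^sub>R mderiv (ch i) (coords i Y) q (X q (ch i))"
      unfolding coords_scale[abs_def]
      by (rule mderiv_scaleR[OF msmooth_subset[OF f dom_points] coords_smooth_dom i(2)]) (use XY i in auto)
    then show "coords i (conn_of G X (vf_scale f Y)) q =
        coords i (vf_add (vf_scale (vf_apply A X f) Y) (vf_scale f (conn_of G X Y))) q"
      using XY i f
      by (simp add: coords_conn_of VF_scale coords_add coords_scale linear_scale[OF left_lin(3)]
          vf_apply_eq[where c="ch i"] scaleR_add_right)
  qed
  have off: "conn_of G X Y = vf_zero" if "X \<notin> VF \<or> Y \<notin> VF" for X Y
    using that by (auto simp: conn_of_def vf_zero_def fun_eq_iff)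
  show ?thesis
    unfolding linear_connection_def smooth_function_iff
    by (intro conjI ballI allI impI; (elim conjE)?; (rule conn_of_VF add1 scale1 add2 leibniz off; assumption))
qed

lemma conn_coef_conn_of:
  assumes i: "i \<in> I" "q \<in> cdom i"
  shows "conn_coef (conn_of G) i q u v = G i q u v"
proof -
  obtain V E where q: "q \<in> V" and E: "extends_frame i V E"
    using frame_extension[OF i] .
  note VE = extends_frameD(1)[OF E] q extends_frameD(2-5)[OF E]
  have c: "coords i (E w) r = w" if "r \<in> V" for w r
    using coords_frame[OF i(1), of r w] VE(3,5) that by (auto simp: coords_def)
  have "mderiv (ch i) (coords i (E v)) q = mderiv (ch i) (\<lambda>r. v) q"
    by (rule mderiv_cong[OF VE(1,2)]) (use c i in auto)
  then show ?thesis
    using conn_coef_eq[OF linear_connection_conn_of VE(6)[OF VE(2)] VE(6)[OF VE(2)], of u v]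
      coords_conn_of[OF VE(4) VE(4) i, of u v] c[OF VE(2)] by simp
qed

end

text \<open>In the frame the operator \<open>h\<close> is a linear map \<open>Q\<close> independent
  of the point, so it commutes with the derivative term of the connection formula. Only the
  condition on the coefficients is left; extended frame fields test it at each point.\<close>

lemma parallel_iff:
  assumes lc: "linear_connection A nab" and Q: "linear Q"
    and h: "\<And>X q. X \<in> VF \<Longrightarrow> h X q \<in> tangent_space A q"
      "\<And>X i q. X \<in> VF \<Longrightarrow> i \<in> I \<Longrightarrow> q \<in> cdom i \<Longrightarrow> coords i (h X) q = Q (coords i X q)"
  shows "(\<forall>X\<in>VF. \<forall>Y\<in>VF. nab X (h Y) = h (nab X Y)) \<longleftrightarrow>
    (\<forall>i\<in>I. \<forall>q\<in>cdom i. \<forall>u v. conn_coef nab i q u (Q v) = Q (conn_coef nab i q u v))"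
proof -
  have bQ: "bounded_linear Q" using Q by (simp add: linear_conv_bounded_linear)
  have hVF: "h X \<in> VF" if "X \<in> VF" for X
  proof (rule VF_I[OF h(1)[OF that]])
    fix i assume i: "i \<in> I"
    show "msmooth A (cdom i) (coords i (h X))"
      by (rule msmooth_cong[OF msmooth_bounded_linear[OF bQ dom_open[OF i] coords_smooth_dom[OF that i]] dom_open[OF i]])
        (simp add: h(2)[OF that i])
  qed
  have D: "mderiv (ch i) (coords i (h Y)) q w = Q (mderiv (ch i) (coords i Y) q w)"
    if "Y \<in> VF" "i \<in> I" "q \<in> cdom i" for Y i q w
  proof -
    have "mderiv (ch i) (coords i (h Y)) q w = mderiv (ch i) (\<lambda>r. Q (coords i Y r)) q w"
      by (rule fun_cong[OF mderiv_cong[OF dom_open[OF that(2)] that(3)]]) (use h(2) that in auto)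
    then show ?thesis
      using mderiv_bounded_linear[OF bQ coords_smooth_dom[OF that(1,2)] that(3)] that by simp
  qed
  have form: "coords i (nab X (h Y)) q = Q (mderiv (ch i) (coords i Y) q (X q (ch i)))
        + conn_coef nab i q (coords i X q) (Q (coords i Y q))"
      "coords i (h (nab X Y)) q = Q (mderiv (ch i) (coords i Y) q (X q (ch i)))
        + Q (conn_coef nab i q (coords i X q) (coords i Y q))"
    if "X \<in> VF" "Y \<in> VF" "i \<in> I" "q \<in> cdom i" for X Y i q
    using that conn_formula[OF lc that(1) hVF[OF that(2)] that(3,4)] conn_formula[OF lc that]
    by (simp_all add: D h(2) conn_VF[OF lc] linear_add[OF Q])
  show ?thesis
  proof (intro iffI ballI allI)
    fix i q u v
    assume par: "\<forall>X\<in>VF. \<forall>Y\<in>VF. nab X (h Y) = h (nab X Y)" and i: "i \<in> I" "q \<in> cdom i"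
    obtain V E where q: "q \<in> V" and E: "extends_frame i V E"
      using frame_extension[OF i] .
    note VE = extends_frameD(1)[OF E] q extends_frameD(2-5)[OF E]
    have "coords i (E w) q = w" for w
      using coords_frame[OF i, of w] VE(2,5) by (auto simp: coords_def)
    then show "conn_coef nab i q u (Q v) = Q (conn_coef nab i q u v)"
      using form[OF VE(4) VE(4) i, of u v] par VE(4) by simp
  next
    fix X Y
    assume "\<forall>i\<in>I. \<forall>q\<in>cdom i. \<forall>u v. conn_coef nab i q u (Q v) = Q (conn_coef nab i q u v)"
      and XY: "X \<in> VF" "Y \<in> VF"
    then show "nab X (h Y) = h (nab X Y)"
      using form by (intro vf_eqI conn_VF[OF lc] hVF) auto
  qed
qed

end

section \<open>The jet bundle as a manifold\<close>

lemma linear_eq_matrixI: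
  fixes f g :: "real^'a \<Rightarrow> real^'b"
  assumes "linear f" "linear g" "matrix f = matrix g"
  shows "f = g"
proof -
  have "f = (\<lambda>x. matrix f *v x)" by (rule matrix_vector_mul(2)[OF assms(1), symmetric])
  also have "\<dots> = g" unfolding assms(3) by (rule matrix_vector_mul(2)[OF assms(2)])
  finally show ?thesis .
qed

lemma pdv_component:
  fixes F :: "real^'a::finite \<Rightarrow> real^'b::finite"
  assumes "F differentiable (at z)"
  shows "pdv k (\<lambda>u. F u $ j) z = matrix (frechet_derivative F (at z)) $ j $ k"
proof -
  have "(F has_derivative frechet_derivative F (at z)) (at z)"
    using assms frechet_derivative_works by blast
  then have "((\<lambda>u. F u $ j) has_derivative (\<lambda>v. frechet_derivative F (at z) v $ j)) (at z)"
    by (rule bounded_linear.has_derivative[OF bounded_linear_vec_nth])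
  then show ?thesis using frechet_derivativeI by (fastforce simp: pdv_def matrix_def)
qed

lemma smooth_on_matrix_mult:
  fixes F :: "'a::real_normed_vector \<Rightarrow> real^'k::finite^'i::finite" and G :: "'a \<Rightarrow> real^'j::finite^'k"
  assumes "open S" "\<And>i j. smooth_on S (\<lambda>z. F z $ i $ j)" "\<And>i j. smooth_on S (\<lambda>z. G z $ i $ j)"
  shows "smooth_on S (\<lambda>z. (F z ** G z) $ i $ j)"
proof -
  have "smooth_on S (\<lambda>z. \<Sum>k\<in>UNIV. F z $ i $ k * G z $ k $ j)"
    by (intro smooth_on_sum smooth_on_mult assms finite)
  then show ?thesis by (simp add: matrix_matrix_mult_def)
qed

lemma linear_component_sum:
  fixes D :: "real^'a::finite \<Rightarrow> real^'b::finite"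
  assumes "linear D"
  shows "D v $ j = (\<Sum>i\<in>UNIV. matrix D $ j $ i * v $ i)"
proof -
  have "D v = matrix D *v v" using fun_cong[OF matrix_vector_mul(2)[OF assms], of v] by simp
  then show ?thesis by (simp add: matrix_vector_mult_def)
qed

lemma if_mult_zero:
  "(a::real) * (if P then b else 0) = (if P then a * b else 0)"
  "(if P then b else 0) * (a::real) = (if P then b * a else 0)"
  by simp_all

lemma sum_if_const: "(\<Sum>j\<in>A. if P then f j else 0) = (if P then \<Sum>j\<in>A. f j else (0::real))"
  by simp

lemma axis_nth_if: "axis i x $ k = (if k = i then x else 0)"
  by (simp add: axis_def)

lemma if_vec_nth: "(if P then x else 0) $ k = (if P then x $ k else 0)"
  by simp

lemmas delta_simps = axis_nth_if if_vec_nth if_mult_zero sum_if_const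

section \<open>Jacobians and second derivatives of coordinate changes\<close>

locale coordinate_atlas = hausdorff_atlas A for A :: "('a, real^'k::finite) chart set"
begin

lemma dcoord_matrix:
  "a \<in> A \<Longrightarrow> a' \<in> A \<Longrightarrow> q \<in> fst a \<Longrightarrow> q \<in> fst a' \<Longrightarrow>
    matrix (frechet_derivative (transition a a') (at (snd a q))) $ \<mu> $ \<alpha> = dcoord a a' q \<mu> \<alpha>"
  unfolding dcoord_def
  by (rule pdv_component[symmetric]) (use transition_has_derivative differentiable_def in blast)

lemma transition_component:
  "a \<in> A \<Longrightarrow> a' \<in> A \<Longrightarrow> q \<in> fst a \<Longrightarrow> q \<in> fst a' \<Longrightarrow>
    frechet_derivative (transition a a') (at (snd a q)) v $ \<mu> = (\<Sum>\<alpha>\<in>UNIV. dcoord a a' q \<mu> \<alpha> * v $ \<alpha>)"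
  using linear_component_sum[OF linear_transition_derivative[of a a' q]] dcoord_matrix by simp

lemma dcoord_inverse:
  assumes "a \<in> A" "a' \<in> A" "q \<in> fst a" "q \<in> fst a'"
  shows "(\<Sum>m\<in>UNIV. dcoord a' a q k m * dcoord a a' q m i) = (if k = i then 1 else 0)"
proof -
  have "frechet_derivative (transition a' a) (at (snd a' q))
      (frechet_derivative (transition a a') (at (snd a q)) (axis i 1)) $ k = (if k = i then 1 else 0)"
    using transition_derivative_cocycle[of a q a' a] assms
    by (simp add: transition_derivative_same axis_def)
  then show ?thesis
    using transition_component assms by (simp add: delta_simps cong: if_cong)
qed

lemma smooth_pdv_transition:
  assumes "a \<in> A" "a' \<in> A"
  shows "smooth_on (snd a ` (fst a \<inter> fst a')) (pdv \<alpha> (\<lambda>u. transition a a' u $ \<mu>))"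
  unfolding pdv_def[abs_def]
  by (intro smooth_on_frechet_derivative smooth_on_vec_nth open_overlap smooth_transition assms)

lemma d2coord_symmetric:
  assumes "a \<in> A" "a' \<in> A" "q \<in> fst a" "q \<in> fst a'"
  shows "d2coord a a' q \<mu> \<alpha> \<beta> = d2coord a a' q \<mu> \<beta> \<alpha>"
  unfolding d2coord_def pdv_def
  by (rule second_derivative_symmetric[where S="snd a ` (fst a \<inter> fst a')"])
    (use assms open_overlap smooth_on_vec_nth[OF open_overlap smooth_transition] in auto)

end

section \<open>Jets of local maps and their coordinates\<close>

locale jet_bundle =
  fixes AT :: "('t, real^'p::finite) chart set" and AM :: "('m, real^'n::finite) chart set"
  assumes manifold_T: "smooth_manifold AT" and manifold_M: "smooth_manifold AM"
begin

sublocale T: coordinate_atlas AT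
  using manifold_T by unfold_locales (auto simp: smooth_manifold_def)

sublocale M: coordinate_atlas AM
  using manifold_M by unfold_locales (auto simp: smooth_manifold_def)

abbreviation "jatlas \<equiv> jet_atlas AT AM"
abbreviation "jchart a b \<equiv> jet_chart AT AM (a, b)"

abbreviation local_rep :: "('t, real^'p) chart \<Rightarrow> ('m, real^'n) chart \<Rightarrow> ('t \<Rightarrow> 'm) \<Rightarrow> real^'p \<Rightarrow> real^'n" where
  "local_rep a b f \<equiv> \<lambda>u. snd b (f (cinv a u))"

text \<open>\<open>smooth_near\<close> asks for smoothness on the set of points mapped into the
  chart; the continuity it also demands makes that set an open neighbourhood.\<close>

lemma smooth_near_localE:
  assumes f: "smooth_near AT AM t f" and a: "a \<in> AT" "t \<in> fst a" and b: "b \<in> AM" "f t \<in> fst b"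
  obtains S where "openin (mtopology AT) S" "t \<in> S" "S \<subseteq> fst a" "\<And>r. r \<in> S \<Longrightarrow> f r \<in> fst b"
    "smooth_on (snd a ` S) (local_rep a b f)"
proof -
  obtain W where W: "openin (mtopology AT) W" "t \<in> W"
    "continuous_map (subtopology (mtopology AT) W) (mtopology AM) f"
    "smooth_on (snd a ` {r \<in> W \<inter> fst a. f r \<in> fst b}) (local_rep a b f)"
    using f a b unfolding smooth_near_def by blast
  have "W \<subseteq> points AT" using W(1) T.openin_iff by blast
  then have top: "topspace (subtopology (mtopology AT) W) = W"
    by (auto simp: T.topspace_mtopology)
  have "openin (subtopology (mtopology AT) W) {r \<in> W. f r \<in> fst b}"
    using W(3) M.openin_domain[OF b(1)] unfolding continuous_map_def top by blast
  then have "openin (mtopology AT) {r \<in> W. f r \<in> fst b}"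
    using W(1) openin_open_subtopology by blast
  then have op: "openin (mtopology AT) ({r \<in> W. f r \<in> fst b} \<inter> fst a)"
    using a T.openin_domain by blast
  have "{r \<in> W. f r \<in> fst b} \<inter> fst a = {r \<in> W \<inter> fst a. f r \<in> fst b}" by auto
  then show thesis using W op a b by (intro that[of "{r \<in> W \<inter> fst a. f r \<in> fst b}"]) auto
qed

lemma local_rep_has_derivative:
  assumes f: "smooth_near AT AM t f" and a: "a \<in> AT" "t \<in> fst a" and b: "b \<in> AM" "f t \<in> fst b"
  shows "(local_rep a b f has_derivative frechet_derivative (local_rep a b f) (at (snd a t))) (at (snd a t))"
proof -
  obtain S where "t \<in> S" "smooth_on (snd a ` S) (local_rep a b f)"
    using smooth_near_localE[OF assms] by metis
  then show ?thesis by (intro smooth_on_has_derivative) auto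
qed

lemma linear_local_rep_derivative:
  assumes "smooth_near AT AM t f" "a \<in> AT" "t \<in> fst a" "b \<in> AM" "f t \<in> fst b"
  shows "linear (frechet_derivative (local_rep a b f) (at (snd a t)))"
  using local_rep_has_derivative[OF assms] has_derivative_linear by blast

text \<open>The chain rule for both charts at once. It makes equality of jets independent of charts
  and also yields the transition of the fibre coordinates.\<close>

lemma local_rep_change:
  assumes f: "smooth_near AT AM t f" and a: "a \<in> AT" "t \<in> fst a" and b: "b \<in> AM" "f t \<in> fst b"
    and a': "a' \<in> AT" "t \<in> fst a'" and b': "b' \<in> AM" "f t \<in> fst b'"
  shows "frechet_derivative (local_rep a' b' f) (at (snd a' t)) =
    frechet_derivative (transition b b') (at (snd b (f t))) \<circ>
    (frechet_derivative (local_rep a b f) (at (snd a t)) \<circ>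
     frechet_derivative (transition a' a) (at (snd a' t)))"
proof -
  obtain S where S: "openin (mtopology AT) S" "t \<in> S" "S \<subseteq> fst a" "\<And>r. r \<in> S \<Longrightarrow> f r \<in> fst b"
    using smooth_near_localE[OF f a b] by metis
  have d1: "(transition a' a has_derivative frechet_derivative (transition a' a) (at (snd a' t))) (at (snd a' t))"
    using T.transition_has_derivative a a' by blast
  have d2: "(local_rep a b f has_derivative frechet_derivative (local_rep a b f) (at (snd a t)))
      (at (transition a' a (snd a' t)))"
    using local_rep_has_derivative[OF f a b] a' by simp
  have d3: "(transition b b' has_derivative frechet_derivative (transition b b') (at (snd b (f t))))
      (at ((local_rep a b f \<circ> transition a' a) (snd a' t)))"
    using M.transition_has_derivative[OF b(1) b'(1) b(2) b'(2)] a a' by simp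
  have "((transition b b' \<circ> (local_rep a b f \<circ> transition a' a)) has_derivative
    (frechet_derivative (transition b b') (at (snd b (f t))) \<circ>
    (frechet_derivative (local_rep a b f) (at (snd a t)) \<circ>
     frechet_derivative (transition a' a) (at (snd a' t))))) (at (snd a' t))"
    by (rule diff_chain_at[OF diff_chain_at[OF d1 d2] d3])
  then have "(local_rep a' b' f has_derivative
    (frechet_derivative (transition b b') (at (snd b (f t))) \<circ>
    (frechet_derivative (local_rep a b f) (at (snd a t)) \<circ>
     frechet_derivative (transition a' a) (at (snd a' t))))) (at (snd a' t))"
  proof (rule has_derivative_transform_within_open)
    show "open (snd a' ` (S \<inter> fst a'))" using T.open_image[OF S(1) a'(1)] .
    show "snd a' t \<in> snd a' ` (S \<inter> fst a')" using S(2) a'(2) by blast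
    fix z assume "z \<in> snd a' ` (S \<inter> fst a')"
    then obtain r where r: "r \<in> S" "r \<in> fst a'" "z = snd a' r" by blast
    then show "(transition b b' \<circ> (local_rep a b f \<circ> transition a' a)) z = local_rep a' b' f z"
      using S(3,4) a(1) a'(1) b(1) by auto
  qed
  then show ?thesis using frechet_derivativeI by blast
qed

lemma jet_class_self: "smooth_near AT AM t f \<Longrightarrow> f \<in> jet_class AT AM t f"
  by (simp add: jet_class_def)

text \<open>By \<open>local_rep_change\<close> the first derivative in one pair of charts determines
  it in every other pair.\<close>

lemma jet_class_eqI:
  assumes f: "smooth_near AT AM t f" and g: "smooth_near AT AM t g" and eq: "g t = f t"
    and a: "a \<in> AT" "t \<in> fst a" and b: "b \<in> AM" "f t \<in> fst b"
    and D: "frechet_derivative (local_rep a b g) (at (snd a t)) = frechet_derivative (local_rep a b f) (at (snd a t))"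
  shows "jet_class AT AM t g = jet_class AT AM t f"
proof -
  have "frechet_derivative (local_rep a' b' g) (at (snd a' t)) =
      frechet_derivative (local_rep a' b' f) (at (snd a' t))"
    if "a' \<in> AT" "b' \<in> AM" "t \<in> fst a'" "f t \<in> fst b'" for a' b'
    using local_rep_change[OF f a b that(1,3,2,4)]
      local_rep_change[OF g a b(1) _ that(1,3,2)] that b D eq by simp
  then show ?thesis by (auto simp: jet_class_def eq)
qed

text \<open>The representative that \<open>jet_chart\<close> chooses internally, named so that facts
  about it can be stated.\<close>

definition jet_rep :: "('t, 'm) jet_point \<Rightarrow> 't \<Rightarrow> 'm" where
  "jet_rep e = (SOME f. f \<in> snd (snd e))"

lemma jet_rep:
  assumes "e \<in> J1 AT AM"
  shows "base_t e \<in> points AT" "smooth_near AT AM (base_t e) (jet_rep e)"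
    "jet_rep e (base_t e) = base_x e"
    "e = (base_t e, base_x e, jet_class AT AM (base_t e) (jet_rep e))"
proof -
  obtain t f where e: "e = (t, f t, jet_class AT AM t f)" and t: "t \<in> points AT"
    and f: "smooth_near AT AM t f"
    using assms unfolding J1_def by blast
  have r: "jet_rep e \<in> jet_class AT AM t f"
    using someI[of "\<lambda>g. g \<in> jet_class AT AM t f", OF jet_class_self[OF f]]
    by (simp add: jet_rep_def e)
  then have g: "smooth_near AT AM t (jet_rep e)" "jet_rep e t = f t" by (auto simp: jet_class_def)
  have "jet_class AT AM t (jet_rep e) = jet_class AT AM t f"
    using r by (auto simp: jet_class_def)
  then show "base_t e \<in> points AT" "smooth_near AT AM (base_t e) (jet_rep e)"
    "jet_rep e (base_t e) = base_x e"
    "e = (base_t e, base_x e, jet_class AT AM (base_t e) (jet_rep e))"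
    using t g by (auto simp: e)
qed

lemma jet_class_derivative:
  assumes "g \<in> jet_class AT AM t f" "a \<in> AT" "b \<in> AM" "t \<in> fst a" "f t \<in> fst b"
  shows "frechet_derivative (local_rep a b g) (at (snd a t)) =
    frechet_derivative (local_rep a b f) (at (snd a t))"
  using assms by (auto simp: jet_class_def)

lemma jet_domain: "e \<in> fst (jchart a b) \<longleftrightarrow> e \<in> J1 AT AM \<and> base_t e \<in> fst a \<and> base_x e \<in> fst b"
  by (auto simp: jet_chart_def)

lemma jet_coords:
  assumes "a \<in> AT" "b \<in> AM" "e \<in> fst (jchart a b)"
  shows "snd (jchart a b) e = (snd a (base_t e), snd b (base_x e),
    matrix (frechet_derivative (local_rep a b (jet_rep e)) (at (snd a (base_t e)))))"
proof -
  obtain t x J where e: "e = (t, x, J)" by (cases e)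
  have J: "e \<in> J1 AT AM" "t \<in> fst a" "x \<in> fst b"
    using assms(3) unfolding jet_domain by (auto simp: e)
  have "local_rep a b (jet_rep e) differentiable (at (snd a t))"
    using local_rep_has_derivative[of t "jet_rep e" a b] jet_rep[OF J(1)] J assms
    by (auto simp: e differentiable_def)
  from pdv_component[OF this] show ?thesis
    by (simp add: jet_chart_def e jet_rep_def vec_eq_iff)
qed

text \<open>The coordinate change of the fibre in matrix form: the Jacobian of the change on
  \<open>M\<close> multiplies on the left, and the Jacobian of the inverse change on
  \<open>T\<close> on the right.\<close>

lemma jet_coords_change:
  assumes a: "a \<in> AT" "a' \<in> AT" and b: "b \<in> AM" "b' \<in> AM"
    and e: "e \<in> fst (jchart a b)" "e \<in> fst (jchart a' b')"
  shows "snd (snd (snd (jchart a' b') e)) =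
    matrix (frechet_derivative (transition b b') (at (snd b (base_x e)))) **
    (snd (snd (snd (jchart a b) e)) **
    matrix (frechet_derivative (transition a' a) (at (snd a' (base_t e)))))"
proof -
  have J: "e \<in> J1 AT AM" "base_t e \<in> fst a" "base_x e \<in> fst b" "base_t e \<in> fst a'" "base_x e \<in> fst b'"
    using e unfolding jet_domain by auto
  note r = jet_rep(2,3)[OF J(1)]
  have lin: "linear (frechet_derivative (transition b b') (at (snd b (base_x e))))"
    "linear (frechet_derivative (local_rep a b (jet_rep e)) (at (snd a (base_t e))))"
    "linear (frechet_derivative (transition a' a) (at (snd a' (base_t e))))"
    using M.linear_transition_derivative[OF b J(3,5)] T.linear_transition_derivative[OF a(2,1) J(4,2)]
      linear_local_rep_derivative[OF r(1) a(1) J(2) b(1)] r(2) J by auto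
  show ?thesis
    unfolding jet_coords[OF a(1) b(1) e(1)] jet_coords[OF a(2) b(2) e(2)]
    using local_rep_change[OF r(1) a(1) J(2) b(1) _ a(2) J(4) b(2)] r(2) J lin
    by (simp add: matrix_compose linear_compose)
qed

text \<open>Every value and every matrix come from a jet: take the map that is affine in the two
  charts, with linear part \<open>y\<close>. Outside \<open>W\<close> the map \<open>f\<close> has
  arbitrary values, but \<open>smooth_near\<close> looks only at a neighbourhood of
  \<open>t\<close>.\<close>

lemma jet_exists:
  assumes a: "a \<in> AT" and b: "b \<in> AM" and t: "t \<in> fst a" and x: "x \<in> fst b"
  obtains e where "e \<in> fst (jchart a b)" "base_t e = t" "base_x e = x"
    "snd (jchart a b) e = (snd a t, snd b x, y)"
proof -
  define L where "L z = snd b x + y *v (z - snd a t)" for z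
  define f where "f s = cinv b (L (snd a s))" for s
  define W where "W = {s \<in> fst a. snd a s \<in> L -` (snd b ` fst b)}"
  have Lsm: "smooth_on UNIV L"
    unfolding L_def
    by (intro smooth_on_add smooth_on_const smooth_on_bounded_linear[of "(*v) y"] smooth_on_diff
        smooth_on_ident matrix_vector_mul_bounded_linear open_UNIV)
  have Lpre: "open (L -` S)" if "open S" for S
    using smooth_on_continuous_on[OF Lsm] that by (simp add: open_vimage)
  have Lt: "L (snd a t) = snd b x" by (simp add: L_def)
  have Wop: "openin (mtopology AT) W"
    unfolding W_def by (intro T.openin_generator a Lpre M.open_chart b)
  have tW: "t \<in> W" using t x Lt by (simp add: W_def)
  have ft: "f t = x" using x b by (simp add: f_def Lt)
  have fW: "f s \<in> fst b" "snd b (f s) = L (snd a s)" if "s \<in> W" for s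
    using that b by (auto simp: W_def f_def)
  \<comment> \<open>Preimages under \<open>f\<close> become preimages under the continuous map
    \<open>L\<close> in coordinates, which settles continuity of \<open>f\<close> and openness of
    the domains in all other charts.\<close>
  have pre: "{s \<in> W. f s \<in> U} = {s \<in> fst a. snd a s \<in> L -` (snd b ` (U \<inter> fst b))}" for U
  proof (intro equalityI subsetI)
    fix s assume "s \<in> {s \<in> W. f s \<in> U}"
    then show "s \<in> {s \<in> fst a. snd a s \<in> L -` (snd b ` (U \<inter> fst b))}"
      using fW[of s] by (auto simp: W_def intro!: image_eqI[of _ _ "f s"])
  qed (use b in \<open>auto simp: W_def f_def\<close>)
  have pre_open: "openin (mtopology AT) {s \<in> W. f s \<in> U}" if "openin (mtopology AM) U" for U
    unfolding pre by (intro T.openin_generator a Lpre M.open_image that b)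
  have f: "smooth_near AT AM t f"
    unfolding smooth_near_def
  proof (intro exI[of _ W] conjI ballI Wop tW)
    have top: "topspace (subtopology (mtopology AT) W) = W"
      using Wop T.openin_iff T.topspace_mtopology by fastforce
    show "continuous_map (subtopology (mtopology AT) W) (mtopology AM) f"
      unfolding continuous_map_def top
    proof (intro conjI allI impI)
      show "f \<in> W \<rightarrow> topspace (mtopology AM)"
        using fW(1) b M.topspace_mtopology by (auto simp: points_def)
      fix U assume "openin (mtopology AM) U"
      from pre_open[OF this] show "openin (subtopology (mtopology AT) W) {x \<in> W. f x \<in> U}"
        using openin_open_subtopology[OF Wop] by blast
    qed
    fix c d assume cd: "c \<in> AT" "d \<in> AM"
    let ?S = "snd c ` {r \<in> W \<inter> fst c. f r \<in> fst d}"
    have S_eq: "{r \<in> W \<inter> fst c. f r \<in> fst d} = {s \<in> W. f s \<in> fst d} \<inter> fst c" by auto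
    have op: "open ?S"
      unfolding S_eq by (rule T.open_image[OF pre_open[OF M.openin_domain[OF cd(2)]] cd(1)])
    have "smooth_on ?S (\<lambda>u. transition b d (L (transition c a u)))"
    proof (rule smooth_on_compose[OF M.smooth_transition[OF b cd(2)] _ op])
      show "smooth_on ?S (\<lambda>u. L (transition c a u))"
        by (rule smooth_on_compose[OF Lsm smooth_on_subset[OF T.smooth_transition[OF cd(1) a]] op])
          (auto simp: W_def)
      show "(\<lambda>u. L (transition c a u)) ` ?S \<subseteq> snd b ` (fst b \<inter> fst d)"
      proof
        fix z assume "z \<in> (\<lambda>u. L (transition c a u)) ` ?S"
        then obtain r where r: "r \<in> W" "r \<in> fst c" "f r \<in> fst d" "z = L (transition c a (snd c r))" by blast
        then have "z = snd b (f r)" using fW(2)[OF r(1)] cd by simp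
        then show "z \<in> snd b ` (fst b \<inter> fst d)" using r fW(1)[OF r(1)] by blast
      qed
    qed
    then show "smooth_on ?S (\<lambda>u. snd d (f (cinv c u)))"
      by (rule smooth_on_cong[OF _ op]) (use cd in \<open>auto simp: f_def transition_def[of b]\<close>)
  qed
  define e where "e = (t, x, jet_class AT AM t f)"
  have e: "e \<in> J1 AT AM" "e \<in> fst (jchart a b)"
    using f a t x ft unfolding jet_domain by (auto simp: J1_def e_def points_def)
  have "(local_rep a b f has_derivative (\<lambda>h. y *v h)) (at (snd a t))"
  proof (rule has_derivative_transform_within_open)
    show "(L has_derivative (\<lambda>h. y *v h)) (at (snd a t))"
      unfolding L_def
      by (auto intro!: derivative_eq_intros bounded_linear.has_derivative[OF matrix_vector_mul_bounded_linear])
    show "open (snd a ` (W \<inter> fst a))" by (rule T.open_image[OF Wop a])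
    show "snd a t \<in> snd a ` (W \<inter> fst a)" using tW t by blast
    show "L z = local_rep a b f z" if "z \<in> snd a ` (W \<inter> fst a)" for z
      using that a fW(2) by auto
  qed
  then have "frechet_derivative (local_rep a b f) (at (snd a t)) = (\<lambda>h. y *v h)"
    using frechet_derivativeI by blast
  moreover have "jet_rep e \<in> jet_class AT AM t f"
    using someI[of "\<lambda>g. g \<in> jet_class AT AM t f", OF jet_class_self[OF f]]
    by (simp add: jet_rep_def e_def)
  ultimately have "frechet_derivative (local_rep a b (jet_rep e)) (at (snd a t)) = (\<lambda>h. y *v h)"
    using jet_class_derivative a b t x ft by metis
  then have "snd (jchart a b) e = (snd a t, snd b x, y)"
    using jet_coords[OF a b e(2)] by (simp add: e_def)
  then show thesis using e by (intro that[of e]) (auto simp: e_def)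
qed

lemma jet_inj:
  assumes "a \<in> AT" "b \<in> AM"
  shows "inj_on (snd (jchart a b)) (fst (jchart a b))"
proof (rule inj_onI)
  fix e e' assume e: "e \<in> fst (jchart a b)" "e' \<in> fst (jchart a b)"
    and eq: "snd (jchart a b) e = snd (jchart a b) e'"
  have J: "e \<in> J1 AT AM" "base_t e \<in> fst a" "base_x e \<in> fst b"
    "e' \<in> J1 AT AM" "base_t e' \<in> fst a" "base_x e' \<in> fst b"
    using e unfolding jet_domain by auto
  note r = jet_rep[OF J(1)] and r' = jet_rep[OF J(4)]
  have bt: "base_t e = base_t e'" and bx: "base_x e = base_x e'"
    using eq J inj_onD[OF T.inj_chart[OF assms(1)]] inj_onD[OF M.inj_chart[OF assms(2)]]
    unfolding jet_coords[OF assms e(1)] jet_coords[OF assms e(2)] by auto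
  have "frechet_derivative (local_rep a b (jet_rep e)) (at (snd a (base_t e))) =
      frechet_derivative (local_rep a b (jet_rep e')) (at (snd a (base_t e)))"
    using eq bt r r' J assms unfolding jet_coords[OF assms e(1)] jet_coords[OF assms e(2)]
    by (intro linear_eq_matrixI linear_local_rep_derivative) auto
  then have "jet_class AT AM (base_t e) (jet_rep e) = jet_class AT AM (base_t e) (jet_rep e')"
    using r r' J assms bt bx by (intro jet_class_eqI[of _ _ _ a b]) auto
  then show "e = e'" using r(4) r'(4) bt bx by metis
qed

text \<open>The fibre direction is unrestricted because \<open>jet_exists\<close> realises every
  matrix. This lets chart changes be differentiated later along whole lines in the fibre.\<close>

lemma jet_overlap_image:
  assumes "a \<in> AT" "b \<in> AM" "U \<subseteq> fst a" "V \<subseteq> fst b"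
  shows "snd (jchart a b) ` {e \<in> fst (jchart a b). base_t e \<in> U \<and> base_x e \<in> V} =
    (snd a ` U) \<times> (snd b ` V) \<times> UNIV"
proof (intro equalityI subsetI)
  fix z assume "z \<in> (snd a ` U) \<times> (snd b ` V) \<times> (UNIV :: (real^'p^'n) set)"
  then obtain t x y where z: "z = (snd a t, snd b x, y)" "t \<in> U" "x \<in> V" by auto
  obtain e where "e \<in> fst (jchart a b)" "base_t e = t" "base_x e = x" "snd (jchart a b) e = z"
    using jet_exists[OF assms(1,2), of t x y] z assms by blast
  then show "z \<in> snd (jchart a b) ` {e \<in> fst (jchart a b). base_t e \<in> U \<and> base_x e \<in> V}"
    using z by (intro image_eqI[of z _ e]) auto
next
  fix z assume "z \<in> snd (jchart a b) ` {e \<in> fst (jchart a b). base_t e \<in> U \<and> base_x e \<in> V}"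
  then show "z \<in> (snd a ` U) \<times> (snd b ` V) \<times> UNIV"
    using jet_coords[OF assms(1,2)] by auto
qed

lemma jet_domain_Int:
  "fst (jchart a b) \<inter> fst (jchart a' b') =
    {e \<in> fst (jchart a b). base_t e \<in> fst a \<inter> fst a' \<and> base_x e \<in> fst b \<inter> fst b'}"
  by (auto simp: jet_domain)

lemma jet_overlap:
  assumes "a \<in> AT" "b \<in> AM"
  shows "snd (jchart a b) ` (fst (jchart a b) \<inter> fst (jchart a' b')) =
    (snd a ` (fst a \<inter> fst a')) \<times> (snd b ` (fst b \<inter> fst b')) \<times> UNIV"
  unfolding jet_domain_Int by (rule jet_overlap_image[OF assms]) auto

lemma jet_open_overlap:
  assumes "a \<in> AT" "b \<in> AM" "a' \<in> AT" "b' \<in> AM"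
  shows "open (snd (jchart a b) ` (fst (jchart a b) \<inter> fst (jchart a' b')))"
  unfolding jet_overlap[OF assms(1,2)] using assms
  by (intro open_Times T.open_overlap M.open_overlap open_UNIV)

text \<open>The chart change as a function of coordinates alone, with no choice of representatives.
  The Jacobian on the \<open>T\<close> side belongs to the inverse change and is therefore evaluated
  at the new coordinates.\<close>

definition jet_transition ::
  "('t, real^'p) chart \<Rightarrow> ('m, real^'n) chart \<Rightarrow> ('t, real^'p) chart \<Rightarrow> ('m, real^'n) chart
    \<Rightarrow> ('p, 'n) jet_coord \<Rightarrow> ('p, 'n) jet_coord" where
  "jet_transition a b a' b' z =
     (transition a a' (fst z), transition b b' (fst (snd z)),
      matrix (frechet_derivative (transition b b') (at (fst (snd z)))) ** (snd (snd z) **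
      matrix (frechet_derivative (transition a' a) (at (transition a a' (fst z))))))"

lemma jet_transition:
  assumes "a \<in> AT" "b \<in> AM" "a' \<in> AT" "b' \<in> AM"
    and "z \<in> snd (jchart a b) ` (fst (jchart a b) \<inter> fst (jchart a' b'))"
  shows "transition (jchart a b) (jchart a' b') z = jet_transition a b a' b' z"
proof -
  obtain e where e: "e \<in> fst (jchart a b)" "e \<in> fst (jchart a' b')" "z = snd (jchart a b) e"
    using assms(5) by blast
  have J: "base_t e \<in> fst a" "base_x e \<in> fst b"
    using e unfolding jet_domain by auto
  have "cinv (jchart a b) (snd (jchart a b) e) = e"
    unfolding cinv_def by (rule inv_into_f_f[OF jet_inj[OF assms(1,2)] e(1)])
  then have "transition (jchart a b) (jchart a' b') z = snd (jchart a' b') e"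
    by (simp add: transition_def e(3))
  moreover have "snd (jchart a b) e =
      (snd a (base_t e), snd b (base_x e), snd (snd (snd (jchart a b) e)))"
    "snd (jchart a' b') e =
      (snd a' (base_t e), snd b' (base_x e), snd (snd (snd (jchart a' b') e)))"
    using jet_coords[OF assms(1,2) e(1)] jet_coords[OF assms(3,4) e(2)] by simp_all
  ultimately show ?thesis
    using jet_coords_change[OF assms(1,3,2,4) e(1,2)] J assms(1,2)
    by (metis (no_types, lifting) T.transition_chart M.transition_chart e(3) fst_conv jet_transition_def snd_conv)
qed

lemma smooth_on_matrix_derivative:
  fixes F :: "real^'a::finite \<Rightarrow> real^'b::finite"
  assumes "smooth_on T F" "smooth_on S g" "open S" "g ` S \<subseteq> T"
  shows "smooth_on S (\<lambda>z. matrix (frechet_derivative F (at (g z))) $ i $ j)"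
proof -
  have "smooth_on S (\<lambda>z. frechet_derivative F (at (g z)) (axis j 1) $ i)"
    by (intro smooth_on_vec_nth smooth_on_compose[OF smooth_on_frechet_derivative[OF assms(1)]] assms)
  then show ?thesis by (simp add: matrix_def)
qed

lemma smooth_jet_transition:
  assumes "a \<in> AT" "b \<in> AM" "a' \<in> AT" "b' \<in> AM"
  shows "smooth_on ((snd a ` (fst a \<inter> fst a')) \<times> (snd b ` (fst b \<inter> fst b')) \<times> UNIV)
    (jet_transition a b a' b')"
proof -
  let ?S = "(snd a ` (fst a \<inter> fst a')) \<times> (snd b ` (fst b \<inter> fst b')) \<times> (UNIV :: (real^'p^'n) set)"
  have op: "open ?S" using assms by (intro open_Times T.open_overlap M.open_overlap open_UNIV)
  have p1: "smooth_on ?S (\<lambda>z. fst z)" and p2: "smooth_on ?S (\<lambda>z. fst (snd z))"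
    and p3: "smooth_on ?S (\<lambda>z. snd (snd z))"
    by (intro smooth_on_fst smooth_on_snd smooth_on_ident op)+
  have t: "smooth_on ?S (\<lambda>z. transition a a' (fst z))"
    by (rule smooth_on_compose[OF T.smooth_transition[OF assms(1,3)] p1 op]) auto
  have x: "smooth_on ?S (\<lambda>z. transition b b' (fst (snd z)))"
    by (rule smooth_on_compose[OF M.smooth_transition[OF assms(2,4)] p2 op]) auto
  have X: "smooth_on ?S (\<lambda>z. matrix (frechet_derivative (transition b b') (at (fst (snd z)))) $ i $ j)" for i j
    by (rule smooth_on_matrix_derivative[OF M.smooth_transition[OF assms(2,4)] p2 op]) auto
  have Y: "smooth_on ?S (\<lambda>z. matrix (frechet_derivative (transition a' a) (at (transition a a' (fst z)))) $ i $ j)" for i j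
    by (rule smooth_on_matrix_derivative[OF T.smooth_transition[OF assms(3,1)] t op])
      (use assms in \<open>auto intro!: imageI\<close>)
  have Z: "smooth_on ?S (\<lambda>z. (matrix (frechet_derivative (transition b b') (at (fst (snd z)))) ** (snd (snd z) **
      matrix (frechet_derivative (transition a' a) (at (transition a a' (fst z)))))) $ i $ j)" for i j
    by (intro smooth_on_matrix_mult op X Y smooth_on_vec_nth p3)
  have "smooth_on ?S (\<lambda>z. \<chi> i j. (matrix (frechet_derivative (transition b b') (at (fst (snd z)))) ** (snd (snd z) **
      matrix (frechet_derivative (transition a' a) (at (transition a a' (fst z)))))) $ i $ j)"
    by (intro smooth_on_vec_lambda op Z)
  then show ?thesis
    unfolding jet_transition_def[abs_def] by (intro smooth_on_Pair op t x) simp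
qed

section \<open>The atlas of the jet bundle and its topology\<close>

lemma jet_atlasE:
  assumes "c \<in> jatlas" obtains a b where "a \<in> AT" "b \<in> AM" "c = jchart a b"
  using assms by (auto simp: jet_atlas_def)

lemma jchart_in [simp]: "a \<in> AT \<Longrightarrow> b \<in> AM \<Longrightarrow> jchart a b \<in> jatlas"
  by (auto simp: jet_atlas_def)

lemma smooth_jet_atlas: "smooth_atlas jatlas"
  unfolding smooth_atlas_def
proof (intro conjI ballI)
  fix c assume "c \<in> jatlas"
  then obtain a b where c: "a \<in> AT" "b \<in> AM" "c = jchart a b" by (rule jet_atlasE)
  show "inj_on (snd c) (fst c)" using jet_inj c by simp
  show "open (snd c ` fst c)" using jet_open_overlap[OF c(1,2,1,2)] c by simp
  fix d assume "d \<in> jatlas"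
  then obtain a' b' where d: "a' \<in> AT" "b' \<in> AM" "d = jchart a' b'" by (rule jet_atlasE)
  show op: "open (snd c ` (fst c \<inter> fst d))" using jet_open_overlap[OF c(1,2) d(1,2)] c d by simp
  show "smooth_on (snd c ` (fst c \<inter> fst d)) (transition c d)"
    by (rule smooth_on_cong[where f="jet_transition a b a' b'"])
      (use smooth_jet_transition[OF c(1,2) d(1,2)] jet_overlap[OF c(1,2)] op
        jet_transition[OF c(1,2) d(1,2)] c d in auto)
qed

sublocale E: manifold_atlas jatlas
  by unfold_locales (rule smooth_jet_atlas)

lemma points_jet_atlas: "points jatlas = J1 AT AM"
proof (intro equalityI subsetI)
  fix e assume "e \<in> J1 AT AM"
  note r = jet_rep[OF this]
  then obtain W where W: "base_t e \<in> W"
    "continuous_map (subtopology (mtopology AT) W) (mtopology AM) (jet_rep e)"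
    unfolding smooth_near_def by blast
  \<comment> \<open>That the target of a jet lies on \<open>M\<close> is implicit: a continuous map
    takes values in the topological space of its codomain.\<close>
  have "base_t e \<in> topspace (subtopology (mtopology AT) W)"
    using W(1) r(1) by (simp add: T.topspace_mtopology)
  then have "jet_rep e (base_t e) \<in> topspace (mtopology AM)"
    using W(2) by (auto simp: continuous_map_def)
  then have "base_x e \<in> points AM" using r(3) by (simp add: M.topspace_mtopology)
  with \<open>e \<in> J1 AT AM\<close> r(1) show "e \<in> points jatlas"
    unfolding points_def using jet_domain jchart_in by blast
qed (auto simp: points_def jet_atlas_def jet_domain)

lemma openin_jet_base:
  assumes U: "openin (mtopology AT) U" and V: "openin (mtopology AM) V"
  shows "openin (mtopology jatlas) {e \<in> J1 AT AM. base_t e \<in> U \<and> base_x e \<in> V}"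
  unfolding E.openin_iff points_jet_atlas
proof (intro conjI ballI)
  fix c assume "c \<in> jatlas"
  then obtain a b where c: "a \<in> AT" "b \<in> AM" "c = jchart a b" by (rule jet_atlasE)
  have "{e \<in> J1 AT AM. base_t e \<in> U \<and> base_x e \<in> V} \<inter> fst c =
      {e \<in> fst c. base_t e \<in> U \<inter> fst a \<and> base_x e \<in> V \<inter> fst b}"
    unfolding c(3) by (auto simp: jet_domain)
  then have "snd c ` ({e \<in> J1 AT AM. base_t e \<in> U \<and> base_x e \<in> V} \<inter> fst c) =
      (snd a ` (U \<inter> fst a)) \<times> (snd b ` (V \<inter> fst b)) \<times> UNIV"
    using jet_overlap_image[OF c(1,2), of "U \<inter> fst a" "V \<inter> fst b"] c by simp
  moreover have "open \<dots>"
    using T.open_image[OF U c(1)] M.open_image[OF V c(2)] by (intro open_Times open_UNIV)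
  ultimately show "open (snd c ` ({e \<in> J1 AT AM. base_t e \<in> U \<and> base_x e \<in> V} \<inter> fst c))" by simp
qed auto

lemma jet_base_points: "e \<in> J1 AT AM \<Longrightarrow> base_t e \<in> points AT \<and> base_x e \<in> points AM"
  unfolding points_jet_atlas[symmetric] by (auto simp: points_def jet_atlas_def jet_domain)

text \<open>Jets over different points of \<open>T\<close> or of \<open>M\<close> are separated by
  open sets of the base. Jets over the same pair of points lie in the same charts and are separated
  there in coordinates.\<close>

lemma hausdorff_jet_atlas: "Hausdorff_space (mtopology jatlas)"
  unfolding Hausdorff_space_def E.topspace_mtopology points_jet_atlas
proof (intro allI impI, elim conjE)
  fix e e' assume e: "e \<in> J1 AT AM" "e' \<in> J1 AT AM" "e \<noteq> e'"
  note pt = jet_base_points[OF e(1)] jet_base_points[OF e(2)]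
  let ?O = "\<lambda>U V. {e \<in> J1 AT AM. base_t e \<in> U \<and> base_x e \<in> V}"
  consider "base_t e \<noteq> base_t e'" | "base_x e \<noteq> base_x e'"
    | "base_t e = base_t e'" "base_x e = base_x e'" by blast
  then show "\<exists>U V. openin (mtopology jatlas) U \<and> openin (mtopology jatlas) V \<and> e \<in> U \<and> e' \<in> V \<and> disjnt U V"
  proof cases
    case 1
    then obtain U V where "openin (mtopology AT) U" "openin (mtopology AT) V"
      "base_t e \<in> U" "base_t e' \<in> V" "disjnt U V"
      using T.hausdorff pt unfolding Hausdorff_space_def T.topspace_mtopology by metis
    then show ?thesis
      using e pt openin_jet_base[OF _ M.openin_points]
      by (intro exI[of _ "?O U (points AM)"] exI[of _ "?O V (points AM)"]) (auto simp: disjnt_iff)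
  next
    case 2
    then obtain U V where "openin (mtopology AM) U" "openin (mtopology AM) V"
      "base_x e \<in> U" "base_x e' \<in> V" "disjnt U V"
      using M.hausdorff pt unfolding Hausdorff_space_def M.topspace_mtopology by metis
    then show ?thesis
      using e pt openin_jet_base[OF T.openin_points]
      by (intro exI[of _ "?O (points AT) U"] exI[of _ "?O (points AT) V"]) (auto simp: disjnt_iff)
  next
    case 3
    obtain c where c: "c \<in> jatlas" "e \<in> fst c"
      using e(1) unfolding points_jet_atlas[symmetric] points_def by blast
    obtain a b where ab: "a \<in> AT" "b \<in> AM" "c = jchart a b" using c(1) by (rule jet_atlasE)
    have e': "e' \<in> fst c" using 3 e c unfolding ab(3) jet_domain by simp
    have "snd c e \<noteq> snd c e'"
      using E.inj_chart[OF c(1)] c(2) e' e(3) inj_onD by metis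
    then obtain S S' where S: "open S" "open S'" "snd c e \<in> S" "snd c e' \<in> S'" "S \<inter> S' = {}"
      using hausdorff by metis
    then show ?thesis
      using E.openin_generator[OF c(1)] c(2) e'
      by (intro exI[of _ "{q \<in> fst c. snd c q \<in> S}"] exI[of _ "{q \<in> fst c. snd c q \<in> S'}"])
        (auto simp: disjnt_iff)
  qed
qed

sublocale E: hausdorff_atlas jatlas
  by unfold_locales (rule hausdorff_jet_atlas)

end

section \<open>The adapted frame of a nonlinear connection\<close>

lemma (in manifold_atlas) msmooth_vec_lambda:
  fixes f :: "'i::finite \<Rightarrow> 'a \<Rightarrow> 'b::euclidean_space"
  assumes "openin (mtopology A) U" "\<And>i. msmooth A U (f i)"
  shows "msmooth A U (\<lambda>q. \<chi> i. f i q)"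
  using assms unfolding msmooth_def
  by (intro ballI smooth_on_vec_lambda[where f="\<lambda>i u. f i (cinv c u)" for c] open_image) auto

lemma (in manifold_atlas) msmooth_Pair:
  assumes "openin (mtopology A) U" "msmooth A U f" "msmooth A U g"
  shows "msmooth A U (\<lambda>q. (f q, g q))"
  using assms unfolding msmooth_def
  by (intro ballI smooth_on_Pair[where f="\<lambda>u. f (cinv c u)" and g="\<lambda>u. g (cinv c u)" for c] open_image) auto

locale jet_connection = jet_bundle AT AM
  for AT :: "('t, real^'p::finite) chart set" and AM :: "('m, real^'n::finite) chart set" +
  fixes Mc :: "('t, 'm, 'p, 'n) nlc_M" and Nc :: "('t, 'm, 'p, 'n) nlc_N"
  assumes nlc: "nonlinear_connection AT AM Mc Nc"
begin

text \<open>\<open>shear (- 1) ab e\<close> sends components in the adapted basis to components in the coordinate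
  basis, and \<open>shear 1 ab e\<close> is its inverse.\<close>

definition shear :: "real \<Rightarrow> ('t, 'm, 'p, 'n) cpair \<Rightarrow> ('t, 'm) jet_point \<Rightarrow> ('p, 'n) jet_coord \<Rightarrow> ('p, 'n) jet_coord" where
  "shear s ab e w = (fst w, fst (snd w), snd (snd w) + s *\<^sub>R
     (\<chi> i \<alpha>. (\<Sum>\<beta>\<in>UNIV. Mc ab e i \<alpha> \<beta> * fst w $ \<beta>) + (\<Sum>j\<in>UNIV. Nc ab e i \<alpha> j * fst (snd w) $ j)))"

lemma linear_shear: "linear (shear s ab e)"
proof (rule linearI)
  show "shear s ab e (v + w) = shear s ab e v + shear s ab e w" for v w
    by (simp add: shear_def vec_eq_iff distrib_left sum.distrib)
  show "shear s ab e (k *\<^sub>R v) = k *\<^sub>R shear s ab e v" for k v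
    by (simp add: shear_def vec_eq_iff distrib_left sum_distrib_left mult.left_commute[of k])
qed

lemma shear_shear:
  assumes "s + s' = 0"
  shows "shear s ab e (shear s' ab e v) = v"
proof -
  have "s' = - s" using assms by simp
  then show ?thesis by (simp add: shear_def prod_eq_iff)
qed

lemma nlc_smooth:
  assumes "ab \<in> AT \<times> AM"
  shows "msmooth jatlas (fst (jet_chart AT AM ab)) (\<lambda>e. Mc ab e i \<alpha> \<beta>)"
    "msmooth jatlas (fst (jet_chart AT AM ab)) (\<lambda>e. Nc ab e i \<alpha> j)"
proof -
  have c: "jet_chart AT AM ab \<in> jatlas" using assms by (auto simp: jet_atlas_def)
  have "smooth_in_chart (jet_chart AT AM ab) (\<lambda>e. Mc ab e i \<alpha> \<beta>)"
    "smooth_in_chart (jet_chart AT AM ab) (\<lambda>e. Nc ab e i \<alpha> j)"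
    using conjunct1[OF nlc[unfolded nonlinear_connection_def]] assms by blast+
  then show "msmooth jatlas (fst (jet_chart AT AM ab)) (\<lambda>e. Mc ab e i \<alpha> \<beta>)"
    "msmooth jatlas (fst (jet_chart AT AM ab)) (\<lambda>e. Nc ab e i \<alpha> j)"
    by (simp_all only: E.smooth_in_chart_iff[OF c])
qed

lemma shear_smooth:
  assumes ab: "ab \<in> AT \<times> AM"
  shows "msmooth jatlas (fst (jet_chart AT AM ab)) (\<lambda>e. shear s ab e v)"
proof -
  have op: "openin (mtopology jatlas) (fst (jet_chart AT AM ab))"
    using ab by (intro E.openin_domain) (auto simp: jet_atlas_def)
  have c: "msmooth jatlas (fst (jet_chart AT AM ab)) (\<lambda>e. (\<Sum>\<beta>\<in>UNIV. Mc ab e i \<alpha> \<beta> * fst v $ \<beta>)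
      + (\<Sum>j\<in>UNIV. Nc ab e i \<alpha> j * fst (snd v) $ j))" for i \<alpha>
    by (intro E.msmooth_add E.msmooth_sum op finite E.msmooth_mult nlc_smooth[OF ab] E.msmooth_const)
  show ?thesis
    unfolding shear_def
    by (rule E.msmooth_Pair[OF op E.msmooth_const E.msmooth_Pair[OF op E.msmooth_const
          E.msmooth_add[OF op E.msmooth_const E.msmooth_scaleR[OF op E.msmooth_const
              E.msmooth_vec_lambda[OF op E.msmooth_vec_lambda[OF op c]]]]]])
qed

sublocale F: framed_atlas jatlas "AT \<times> AM" "jet_chart AT AM" "shear (- 1)" "shear 1"
proof (intro framed_atlas.intro framed_atlas_axioms.intro E.hausdorff_atlas_axioms)
  show "jatlas = jet_chart AT AM ` (AT \<times> AM)" by (rule jet_atlas_def)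
  show "linear (shear (- 1) ab e)" "linear (shear 1 ab e)" for ab e
    by (rule linear_shear)+
  show "shear 1 ab e (shear (- 1) ab e v) = v" "shear (- 1) ab e (shear 1 ab e v) = v" for ab e v
    by (rule shear_shear, simp)+
qed (rule shear_smooth, assumption)+

definition frame_block :: "('p \<Rightarrow> 'p \<Rightarrow> real) \<Rightarrow> ('n \<Rightarrow> 'n \<Rightarrow> real) \<Rightarrow> ('p \<Rightarrow> 'p \<Rightarrow> real)
    \<Rightarrow> ('p, 'n) jet_coord \<Rightarrow> ('p, 'n) jet_coord" where
  "frame_block t' x' t0 w =
     (\<chi> \<mu>. \<Sum>\<alpha>\<in>UNIV. t' \<mu> \<alpha> * fst w $ \<alpha>, \<chi> j. \<Sum>i\<in>UNIV. x' j i * fst (snd w) $ i,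
      \<chi> j \<beta>. \<Sum>i\<in>UNIV. \<Sum>\<alpha>\<in>UNIV. x' j i * t0 \<alpha> \<beta> * snd (snd w) $ i $ \<alpha>)"

lemma linear_sum_axis:
  fixes L :: "real^'a::finite \<Rightarrow> 'b::real_normed_vector"
  assumes "linear L"
  shows "L v = (\<Sum>k\<in>UNIV. (v $ k) *\<^sub>R L (axis k 1))"
proof -
  have "v = (\<Sum>k\<in>UNIV. (v $ k) *\<^sub>R axis k 1)"
    using basis_expansion[of v] by (simp add: scalar_mult_eq_scaleR)
  then have "L v = L (\<Sum>k\<in>UNIV. (v $ k) *\<^sub>R axis k 1)" by simp
  also have "\<dots> = (\<Sum>k\<in>UNIV. (v $ k) *\<^sub>R L (axis k 1))"
    by (simp add: linear_sum[OF assms] linear_scale[OF assms])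
  finally show ?thesis .
qed

text \<open>Contracts a transformation rule of the nonlinear connection with a vector. The index
  types are independent so that it serves the rule for \<open>M\<close> and the rule for
  \<open>N\<close> alike.\<close>

lemma sum_push:
  fixes P :: "'k::finite \<Rightarrow> real"
  assumes "\<And>\<alpha>. (\<Sum>\<mu>\<in>UNIV. P \<mu> * R \<mu> \<alpha>) = (\<Sum>k\<in>UNIV. \<Sum>\<gamma>\<in>UNIV. Q k \<gamma> \<alpha> * Xm k * Ym \<gamma>) - d \<alpha>"
  shows "(\<Sum>\<mu>\<in>UNIV. P \<mu> * (\<Sum>\<alpha>\<in>UNIV. R \<mu> \<alpha> * v \<alpha>)) =
    (\<Sum>k\<in>(UNIV::'k1::finite set). \<Sum>\<gamma>\<in>(UNIV::'k2::finite set). Xm k * Ym \<gamma> * (\<Sum>\<alpha>\<in>(UNIV::'k3::finite set). Q k \<gamma> \<alpha> * v \<alpha>))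
      - (\<Sum>\<alpha>\<in>UNIV. v \<alpha> * d \<alpha>)"
proof -
  have "(\<Sum>\<mu>\<in>UNIV. P \<mu> * (\<Sum>\<alpha>\<in>UNIV. R \<mu> \<alpha> * v \<alpha>)) = (\<Sum>\<alpha>\<in>UNIV. (\<Sum>\<mu>\<in>UNIV. P \<mu> * R \<mu> \<alpha>) * v \<alpha>)"
    by (simp add: sum_distrib_left sum_distrib_right mult.assoc) (rule sum.swap)
  also have "\<dots> = (\<Sum>\<alpha>\<in>UNIV. \<Sum>k\<in>UNIV. \<Sum>\<gamma>\<in>UNIV. Xm k * Ym \<gamma> * (Q k \<gamma> \<alpha> * v \<alpha>)) - (\<Sum>\<alpha>\<in>UNIV. v \<alpha> * d \<alpha>)"
    unfolding assms left_diff_distrib sum_subtractf sum_distrib_right by (simp add: mult_ac)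
  also have "(\<Sum>\<alpha>\<in>UNIV. \<Sum>k\<in>UNIV. \<Sum>\<gamma>\<in>UNIV. Xm k * Ym \<gamma> * (Q k \<gamma> \<alpha> * v \<alpha>)) =
      (\<Sum>k\<in>UNIV. \<Sum>\<alpha>\<in>UNIV. \<Sum>\<gamma>\<in>UNIV. Xm k * Ym \<gamma> * (Q k \<gamma> \<alpha> * v \<alpha>))"
    by (rule sum.swap)
  also have "\<dots> = (\<Sum>k\<in>UNIV. \<Sum>\<gamma>\<in>UNIV. \<Sum>\<alpha>\<in>UNIV. Xm k * Ym \<gamma> * (Q k \<gamma> \<alpha> * v \<alpha>))"
    by (intro sum.cong refl sum.swap)
  finally show ?thesis by (simp add: sum_distrib_left)
qed

section \<open>The Jacobian of a chart change in adapted frames\<close>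

context
  fixes a b a' b' and e :: "('t, 'm) jet_point"
  assumes a: "a \<in> AT" "a' \<in> AT" and b: "b \<in> AM" "b' \<in> AM"
    and e: "e \<in> fst (jchart a b)" "e \<in> fst (jchart a' b')"
begin

lemma base_in:
  shows "base_t e \<in> fst a" "base_t e \<in> fst a'" "base_x e \<in> fst b" "base_x e \<in> fst b'"
  using e unfolding jet_domain by auto

lemma base_coords:
  "fst (snd (jchart a b) e) = snd a (base_t e)" "fst (snd (snd (jchart a b) e)) = snd b (base_x e)"
  using jet_coords[OF a(1) b(1) e(1)] by simp_all

lemma overlap_mem:
  "snd (jchart a b) e \<in> snd (jchart a b) ` (fst (jchart a b) \<inter> fst (jchart a' b'))"
  using e by blast

text \<open>Along the base the fibre part is kept as \<open>dfib_t\<close> and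
  \<open>dfib_x\<close>, the form in which the nonlinear connection cancels it. Only its vertical
  part is computed, from the explicit chart change.\<close>

lemma jet_transition_derivative:
  fixes h :: "('p, 'n) jet_coord"
  defines "D \<equiv> frechet_derivative (transition (jchart a b) (jchart a' b')) (at (snd (jchart a b) e))"
  shows "fst (D h) $ \<mu> = (\<Sum>\<alpha>\<in>UNIV. dcoord a a' (base_t e) \<mu> \<alpha> * fst h $ \<alpha>)"
    and "fst (snd (D h)) $ j = (\<Sum>i\<in>UNIV. dcoord b b' (base_x e) j i * fst (snd h) $ i)"
    and "snd (snd (D h)) $ j $ \<beta> =
      (\<Sum>\<alpha>\<in>UNIV. fst h $ \<alpha> * dfib_t (jchart a b) (jchart a' b') e j \<beta> \<alpha>)
      + (\<Sum>i\<in>UNIV. fst (snd h) $ i * dfib_x (jchart a b) (jchart a' b') e j \<beta> i)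
      + (\<Sum>i\<in>UNIV. \<Sum>\<alpha>\<in>UNIV. dcoord b b' (base_x e) j i * dcoord a' a (base_t e) \<alpha> \<beta> * snd (snd h) $ i $ \<alpha>)"
proof -
  let ?\<Phi> = "transition (jchart a b) (jchart a' b')" and ?z = "snd (jchart a b) e"
  let ?S = "snd (jchart a b) ` (fst (jchart a b) \<inter> fst (jchart a' b'))"
  have D: "(?\<Phi> has_derivative D) (at ?z)"
    unfolding D_def by (rule E.transition_has_derivative) (use a b e in auto)
  then have lin: "linear D" by (rule has_derivative_linear)
  have op: "open ?S" by (rule jet_open_overlap) (use a b in auto)
  note \<Phi> = jet_transition[OF a(1) b(1) a(2) b(2)]
  have "((\<lambda>z. fst (?\<Phi> z)) has_derivative (\<lambda>h. fst (D h))) (at ?z)"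
    by (rule bounded_linear.has_derivative[OF bounded_linear_fst D])
  moreover have "((\<lambda>z. fst (?\<Phi> z)) has_derivative
      (\<lambda>h. frechet_derivative (transition a a') (at (snd a (base_t e))) (fst h))) (at ?z)"
  proof (rule has_derivative_transform_within_open[OF _ op overlap_mem])
    have "(transition a a' has_derivative frechet_derivative (transition a a') (at (snd a (base_t e)))) (at (fst ?z))"
      using T.transition_has_derivative a base_in base_coords by simp
    from has_derivative_compose[OF bounded_linear.has_derivative[OF bounded_linear_fst has_derivative_ident] this]
    show "((\<lambda>z. transition a a' (fst z)) has_derivative
      (\<lambda>h. frechet_derivative (transition a a') (at (snd a (base_t e))) (fst h))) (at ?z)" .
  qed (simp add: \<Phi> jet_transition_def)
  ultimately have "(\<lambda>h. fst (D h)) = (\<lambda>h. frechet_derivative (transition a a') (at (snd a (base_t e))) (fst h))"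
    by (rule has_derivative_unique)
  from fun_cong[OF this, of h] show "fst (D h) $ \<mu> = (\<Sum>\<alpha>\<in>UNIV. dcoord a a' (base_t e) \<mu> \<alpha> * fst h $ \<alpha>)"
    using T.transition_component a base_in by simp
  have "((\<lambda>z. fst (snd (?\<Phi> z))) has_derivative (\<lambda>h. fst (snd (D h)))) (at ?z)"
    by (rule bounded_linear.has_derivative[OF bounded_linear_fst bounded_linear.has_derivative[OF bounded_linear_snd D]])
  moreover have "((\<lambda>z. fst (snd (?\<Phi> z))) has_derivative
      (\<lambda>h. frechet_derivative (transition b b') (at (snd b (base_x e))) (fst (snd h)))) (at ?z)"
  proof (rule has_derivative_transform_within_open[OF _ op overlap_mem])
    have "(transition b b' has_derivative frechet_derivative (transition b b') (at (snd b (base_x e)))) (at (fst (snd ?z)))"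
      using M.transition_has_derivative b base_in base_coords by simp
    from has_derivative_compose[OF bounded_linear.has_derivative[OF bounded_linear_fst
        bounded_linear.has_derivative[OF bounded_linear_snd has_derivative_ident]] this]
    show "((\<lambda>z. transition b b' (fst (snd z))) has_derivative
      (\<lambda>h. frechet_derivative (transition b b') (at (snd b (base_x e))) (fst (snd h)))) (at ?z)" .
  qed (simp add: \<Phi> jet_transition_def)
  ultimately have "(\<lambda>h. fst (snd (D h))) =
      (\<lambda>h. frechet_derivative (transition b b') (at (snd b (base_x e))) (fst (snd h)))"
    by (rule has_derivative_unique)
  from fun_cong[OF this, of h]
  show "fst (snd (D h)) $ j = (\<Sum>i\<in>UNIV. dcoord b b' (base_x e) j i * fst (snd h) $ i)"
    using M.transition_component b base_in by simp
  let ?L = "\<lambda>h. snd (snd (D h)) $ j $ \<beta>"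
  have L: "linear ?L"
    by (rule linearI) (simp_all add: linear_add[OF lin] linear_scale[OF lin])
  have dL: "((\<lambda>z. snd (snd (?\<Phi> z)) $ j $ \<beta>) has_derivative ?L) (at ?z)"
    by (intro bounded_linear.has_derivative[OF bounded_linear_vec_nth]
        bounded_linear.has_derivative[OF bounded_linear_snd] D)
  have fr: "frechet_derivative (\<lambda>z. snd (snd (?\<Phi> z)) $ j $ \<beta>) (at ?z) = ?L"
    using frechet_derivativeI[OF dL] by simp
  have split: "?L h = ?L (fst h, 0, 0) + ?L (0, fst (snd h), 0) + ?L (0, 0, snd (snd h))"
    using linear_add[OF L, of "(fst h, 0, 0)" "(0, fst (snd h), 0)"]
      linear_add[OF L, of "(fst h, fst (snd h), 0)" "(0, 0, snd (snd h))"] by simp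
  have l1: "linear (\<lambda>v. ?L (v, 0, 0))" and l2: "linear (\<lambda>v. ?L (0, v, 0))"
    by (rule linearI, use linear_add[OF L, of "(_, 0, 0)" "(_, 0, 0)"] linear_scale[OF L, of _ "(_, 0, 0)"] in simp_all)
      (rule linearI, use linear_add[OF L, of "(0, _, 0)" "(0, _, 0)"] linear_scale[OF L, of _ "(0, _, 0)"] in simp_all)
  have p1: "?L (fst h, 0, 0) = (\<Sum>\<alpha>\<in>UNIV. fst h $ \<alpha> * dfib_t (jchart a b) (jchart a' b') e j \<beta> \<alpha>)"
    unfolding dfib_t_def fr using linear_sum_axis[OF l1, of "fst h"] by simp
  have p2: "?L (0, fst (snd h), 0) = (\<Sum>i\<in>UNIV. fst (snd h) $ i * dfib_x (jchart a b) (jchart a' b') e j \<beta> i)"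
    unfolding dfib_x_def fr using linear_sum_axis[OF l2, of "fst (snd h)"] by simp
  let ?X = "matrix (frechet_derivative (transition b b') (at (snd b (base_x e))))"
  let ?T = "matrix (frechet_derivative (transition a' a) (at (snd a' (base_t e))))"
  let ?y = "snd (snd ?z)" and ?\<eta> = "snd (snd h)"
  have p3: "?L (0, 0, ?\<eta>) = (?X ** (?\<eta> ** ?T)) $ j $ \<beta>"
  proof -
    \<comment> \<open>The vertical derivative is taken along a line in the fibre, which stays in the
      overlap for all parameters.\<close>
    have line: "((\<lambda>s. ?z + s *\<^sub>R (0, 0, ?\<eta>)) has_derivative (\<lambda>s. s *\<^sub>R (0, 0, ?\<eta>))) (at (0::real))"
      by (auto intro!: derivative_eq_intros)
    have dL': "((\<lambda>z. snd (snd (?\<Phi> z)) $ j $ \<beta>) has_derivative ?L) (at (?z + (0::real) *\<^sub>R (0, 0, ?\<eta>)))"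
      using dL by (simp add: zero_prod_def[symmetric])
    from has_derivative_compose[OF line dL']
    have c1: "((\<lambda>s. snd (snd (?\<Phi> (?z + s *\<^sub>R (0, 0, ?\<eta>)))) $ j $ \<beta>) has_derivative
        (\<lambda>s. ?L (s *\<^sub>R (0, 0, ?\<eta>)))) (at (0::real))" .
    \<comment> \<open>On this line both Jacobians are constant and the fibre coordinate is affine in
      \<open>s\<close>, so the derivative is the coefficient of \<open>s\<close>.\<close>
    have val: "snd (snd (?\<Phi> (?z + s *\<^sub>R (0, 0, ?\<eta>)))) $ j $ \<beta> =
        (?X ** (?y ** ?T)) $ j $ \<beta> + s * (?X ** (?\<eta> ** ?T)) $ j $ \<beta>" for s
    proof -
      have mem: "?z + s *\<^sub>R (0, 0, ?\<eta>) \<in> ?S"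
        using overlap_mem unfolding jet_overlap[OF a(1) b(1)] by (auto simp: mem_Times_iff)
      have "fst (?z + s *\<^sub>R (0, 0, ?\<eta>)) = snd a (base_t e)"
        "fst (snd (?z + s *\<^sub>R (0, 0, ?\<eta>))) = snd b (base_x e)"
        "snd (snd (?z + s *\<^sub>R (0, 0, ?\<eta>))) = ?y + s *\<^sub>R ?\<eta>"
        using base_coords by simp_all
      then have "snd (snd (?\<Phi> (?z + s *\<^sub>R (0, 0, ?\<eta>)))) = ?X ** ((?y + s *\<^sub>R ?\<eta>) ** ?T)"
        unfolding \<Phi>[OF mem] jet_transition_def using a base_in by simp
      then show ?thesis
        by (simp add: matrix_matrix_mult_def algebra_simps sum.distrib sum_distrib_left)
    qed
    have "((\<lambda>s. snd (snd (?\<Phi> (?z + s *\<^sub>R (0, 0, ?\<eta>)))) $ j $ \<beta>) has_derivative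
        (\<lambda>s. s * (?X ** (?\<eta> ** ?T)) $ j $ \<beta>)) (at (0::real))"
      unfolding val by (auto intro!: derivative_eq_intros)
    from fun_cong[OF has_derivative_unique[OF c1 this], of 1] show ?thesis by simp
  qed
  have "(?X ** (?\<eta> ** ?T)) $ j $ \<beta> =
      (\<Sum>i\<in>UNIV. \<Sum>\<alpha>\<in>UNIV. dcoord b b' (base_x e) j i * dcoord a' a (base_t e) \<alpha> \<beta> * ?\<eta> $ i $ \<alpha>)"
    using T.dcoord_matrix[OF a(2,1) base_in(2,1)] M.dcoord_matrix[OF b base_in(3,4)]
    by (simp add: matrix_matrix_mult_def sum_distrib_left mult_ac)
  then show "snd (snd (D h)) $ j $ \<beta> =
      (\<Sum>\<alpha>\<in>UNIV. fst h $ \<alpha> * dfib_t (jchart a b) (jchart a' b') e j \<beta> \<alpha>)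
      + (\<Sum>i\<in>UNIV. fst (snd h) $ i * dfib_x (jchart a b) (jchart a' b') e j \<beta> i)
      + (\<Sum>i\<in>UNIV. \<Sum>\<alpha>\<in>UNIV. dcoord b b' (base_x e) j i * dcoord a' a (base_t e) \<alpha> \<beta> * ?\<eta> $ i $ \<alpha>)"
    using split p1 p2 p3 by simp
qed

lemma nlc_rules:
  "(\<Sum>\<mu>\<in>UNIV. Mc (a', b') e j \<beta> \<mu> * dcoord a a' (base_t e) \<mu> \<alpha>) =
     (\<Sum>k\<in>UNIV. \<Sum>\<gamma>\<in>UNIV. Mc (a, b) e k \<gamma> \<alpha> * dcoord b b' (base_x e) j k * dcoord a' a (base_t e) \<gamma> \<beta>)
     - dfib_t (jchart a b) (jchart a' b') e j \<beta> \<alpha>"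
  "(\<Sum>k\<in>UNIV. Nc (a', b') e j \<beta> k * dcoord b b' (base_x e) k i) =
     (\<Sum>k\<in>UNIV. \<Sum>\<gamma>\<in>UNIV. Nc (a, b) e k \<gamma> i * dcoord b b' (base_x e) j k * dcoord a' a (base_t e) \<gamma> \<beta>)
     - dfib_x (jchart a b) (jchart a' b') e j \<beta> i"
  using nlc a b e unfolding nonlinear_connection_def Let_def by blast+

lemma frame_change_eq:
  "F.frame_change (a, b) (a', b') e w =
    frame_block (dcoord a a' (base_t e)) (dcoord b b' (base_x e)) (dcoord a' a (base_t e)) w"
proof -
  let ?h = "shear (- 1) (a, b) e w"
  let ?D = "frechet_derivative (transition (jchart a b) (jchart a' b')) (at (snd (jchart a b) e))"
  let ?t' = "dcoord a a' (base_t e)" and ?x' = "dcoord b b' (base_x e)" and ?t0 = "dcoord a' a (base_t e)"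
  have fc: "F.frame_change (a, b) (a', b') e w = shear 1 (a', b') e (?D ?h)"
    using a b e by (simp add: F.frame_change_def F.coords_def F.frame_def coord_vec_def)
  have h: "fst ?h = fst w" "fst (snd ?h) = fst (snd w)"
    "\<And>i \<alpha>. snd (snd ?h) $ i $ \<alpha> = snd (snd w) $ i $ \<alpha> - (\<Sum>\<beta>\<in>UNIV. Mc (a, b) e i \<alpha> \<beta> * fst w $ \<beta>)
      - (\<Sum>j\<in>UNIV. Nc (a, b) e i \<alpha> j * fst (snd w) $ j)"
    by (simp_all add: shear_def)
  \<comment> \<open>The derivatives \<open>dfib_t\<close> and \<open>dfib_x\<close> cancel against
    those produced by the new coefficients, and the terms with the old coefficients cancel those
    that the old shear brought in. Only the vertical block survives.\<close>
  have third: "snd (snd (?D ?h)) $ j $ \<beta> + (\<Sum>\<mu>\<in>UNIV. Mc (a', b') e j \<beta> \<mu> * fst (?D ?h) $ \<mu>)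
      + (\<Sum>k\<in>UNIV. Nc (a', b') e j \<beta> k * fst (snd (?D ?h)) $ k) =
      (\<Sum>i\<in>UNIV. \<Sum>\<alpha>\<in>UNIV. ?x' j i * ?t0 \<alpha> \<beta> * snd (snd w) $ i $ \<alpha>)" for j \<beta>
  proof -
    have "(\<Sum>\<mu>\<in>UNIV. Mc (a', b') e j \<beta> \<mu> * fst (?D ?h) $ \<mu>) =
        (\<Sum>k\<in>UNIV. \<Sum>\<gamma>\<in>UNIV. ?x' j k * ?t0 \<gamma> \<beta> * (\<Sum>\<alpha>\<in>UNIV. Mc (a, b) e k \<gamma> \<alpha> * fst w $ \<alpha>))
        - (\<Sum>\<alpha>\<in>UNIV. fst w $ \<alpha> * dfib_t (jchart a b) (jchart a' b') e j \<beta> \<alpha>)"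
      unfolding jet_transition_derivative(1) h by (rule sum_push[OF nlc_rules(1)])
    moreover have "(\<Sum>\<mu>\<in>UNIV. Nc (a', b') e j \<beta> \<mu> * fst (snd (?D ?h)) $ \<mu>) =
        (\<Sum>k\<in>UNIV. \<Sum>\<gamma>\<in>UNIV. ?x' j k * ?t0 \<gamma> \<beta> * (\<Sum>\<alpha>\<in>UNIV. Nc (a, b) e k \<gamma> \<alpha> * fst (snd w) $ \<alpha>))
        - (\<Sum>\<alpha>\<in>UNIV. fst (snd w) $ \<alpha> * dfib_x (jchart a b) (jchart a' b') e j \<beta> \<alpha>)"
      unfolding jet_transition_derivative(2) h by (rule sum_push[OF nlc_rules(2)])
    moreover have "snd (snd (?D ?h)) $ j $ \<beta> =
      (\<Sum>\<alpha>\<in>UNIV. fst w $ \<alpha> * dfib_t (jchart a b) (jchart a' b') e j \<beta> \<alpha>)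
      + (\<Sum>i\<in>UNIV. fst (snd w) $ i * dfib_x (jchart a b) (jchart a' b') e j \<beta> i)
      + ((\<Sum>i\<in>UNIV. \<Sum>\<alpha>\<in>UNIV. ?x' j i * ?t0 \<alpha> \<beta> * snd (snd w) $ i $ \<alpha>)
      - (\<Sum>k\<in>UNIV. \<Sum>\<gamma>\<in>UNIV. ?x' j k * ?t0 \<gamma> \<beta> * (\<Sum>\<alpha>\<in>UNIV. Mc (a, b) e k \<gamma> \<alpha> * fst w $ \<alpha>))
      - (\<Sum>k\<in>UNIV. \<Sum>\<gamma>\<in>UNIV. ?x' j k * ?t0 \<gamma> \<beta> * (\<Sum>\<alpha>\<in>UNIV. Nc (a, b) e k \<gamma> \<alpha> * fst (snd w) $ \<alpha>)))"
      unfolding jet_transition_derivative(3) h by (simp add: right_diff_distrib sum_subtractf)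
    ultimately show ?thesis by linarith
  qed
  show ?thesis
    unfolding fc frame_block_def shear_def[of 1]
    using third by (simp add: vec_eq_iff jet_transition_derivative(1,2) h add.assoc)
qed

text \<open>The chart \<open>d\<close> need not be the current chart \<open>a\<close>: entries of
  the inverse Jacobian are functions of the new coordinates, so their derivative in the old ones
  passes through the change from \<open>a\<close> to \<open>a'\<close>.\<close>

lemma base_t_has_derivative:
  fixes g :: "real^'p \<Rightarrow> real"
  assumes "d \<in> AT" "base_t e \<in> fst d" "(g has_derivative g') (at (snd d (base_t e)))"
  shows "((\<lambda>z. g (snd d (base_t (cinv (jchart a b) z)))) has_derivative
    (\<lambda>h. g' (frechet_derivative (transition a d) (at (snd a (base_t e))) (fst h)))) (at (snd (jchart a b) e))"
proof (rule has_derivative_transform_within_open)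
  let ?z = "snd (jchart a b) e"
  have "(transition a d has_derivative frechet_derivative (transition a d) (at (snd a (base_t e)))) (at (fst ?z))"
    using T.transition_has_derivative a assms base_in base_coords by simp
  from has_derivative_compose[OF bounded_linear.has_derivative[OF bounded_linear_fst has_derivative_ident] this]
  have "((\<lambda>z. transition a d (fst z)) has_derivative
      (\<lambda>h. frechet_derivative (transition a d) (at (snd a (base_t e))) (fst h))) (at ?z)" .
  from has_derivative_compose[OF this, of g g'] assms(3) base_coords a base_in
  show "((\<lambda>z. g (transition a d (fst z))) has_derivative
    (\<lambda>h. g' (frechet_derivative (transition a d) (at (snd a (base_t e))) (fst h)))) (at ?z)"
    by simp
  show "open (snd (jchart a b) ` (fst (jchart a b) \<inter> fst (jchart d b)))"
    by (rule jet_open_overlap) (use a b assms in auto)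
  show "?z \<in> snd (jchart a b) ` (fst (jchart a b) \<inter> fst (jchart d b))"
    using e(1) assms(2) base_in by (intro imageI) (simp add: jet_domain)
  fix z assume "z \<in> snd (jchart a b) ` (fst (jchart a b) \<inter> fst (jchart d b))"
  then obtain r where r: "r \<in> fst (jchart a b)" "r \<in> fst (jchart d b)" "z = snd (jchart a b) r" by blast
  have "cinv (jchart a b) z = r" using r a b by simp
  moreover have "fst z = snd a (base_t r)" "base_t r \<in> fst a"
    using r jet_coords[OF a(1) b(1) r(1)] by (auto simp: jet_domain)
  ultimately show "g (transition a d (fst z)) = g (snd d (base_t (cinv (jchart a b) z)))"
    using a by simp
qed

lemma base_x_has_derivative:
  fixes g :: "real^'n \<Rightarrow> real"
  assumes "(g has_derivative g') (at (snd b (base_x e)))"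
  shows "((\<lambda>z. g (snd b (base_x (cinv (jchart a b) z)))) has_derivative
    (\<lambda>h. g' (fst (snd h)))) (at (snd (jchart a b) e))"
proof (rule has_derivative_transform_within_open)
  let ?z = "snd (jchart a b) e"
  have "(g has_derivative g') (at (fst (snd ?z)))" using assms base_coords by simp
  from has_derivative_compose[OF bounded_linear.has_derivative[OF bounded_linear_fst
        bounded_linear.has_derivative[OF bounded_linear_snd has_derivative_ident]] this]
  show "((\<lambda>z. g (fst (snd z))) has_derivative (\<lambda>h. g' (fst (snd h)))) (at ?z)" .
  show "open (snd (jchart a b) ` fst (jchart a b))"
    by (rule E.open_chart) (use a b in auto)
  show "?z \<in> snd (jchart a b) ` fst (jchart a b)" using e(1) by blast
  fix z assume "z \<in> snd (jchart a b) ` fst (jchart a b)"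
  then obtain r where r: "r \<in> fst (jchart a b)" "z = snd (jchart a b) r" by blast
  have "cinv (jchart a b) z = r" using r a b by simp
  then show "g (fst (snd z)) = g (snd b (base_x (cinv (jchart a b) z)))"
    using jet_coords[OF a(1) b(1) r(1)] r by simp
qed

end

lemma frechet_derivative_pdv:
  fixes g :: "real^'k::finite \<Rightarrow> real"
  assumes "g differentiable (at z)"
  shows "frechet_derivative g (at z) v = (\<Sum>k\<in>UNIV. v $ k * pdv k g z)"
  using linear_sum_axis[OF linear_frechet_derivative[OF assms], of v] by (simp add: pdv_def)

text \<open>The derivative of the frame change along \<open>h\<close>. The third block follows the
  product rule; its factor \<open>t0\<close> lives on the new chart, so the direction is first
  mapped by \<open>t'\<close>. The fibre part of \<open>h\<close> does not occur, since Jacobians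
  depend on the base only.\<close>

definition frame_change_deriv ::
  "('t, real^'p) chart \<Rightarrow> ('m, real^'n) chart \<Rightarrow> ('t, real^'p) chart \<Rightarrow> ('m, real^'n) chart
    \<Rightarrow> ('t, 'm) jet_point \<Rightarrow> ('p, 'n) jet_coord \<Rightarrow> ('p, 'n) jet_coord \<Rightarrow> ('p, 'n) jet_coord" where
  "frame_change_deriv a b a' b' e h v =
    (let t' = dcoord a a' (base_t e); t0 = dcoord a' a (base_t e); x' = dcoord b b' (base_x e) in
     (\<chi> \<mu>. \<Sum>\<alpha>\<in>UNIV. (\<Sum>\<gamma>\<in>UNIV. fst h $ \<gamma> * d2coord a a' (base_t e) \<mu> \<gamma> \<alpha>) * fst v $ \<alpha>,
      \<chi> j. \<Sum>i\<in>UNIV. (\<Sum>k\<in>UNIV. fst (snd h) $ k * d2coord b b' (base_x e) j k i) * fst (snd v) $ i,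
      \<chi> j \<beta>. \<Sum>i\<in>UNIV. \<Sum>\<alpha>\<in>UNIV.
        (x' j i * (\<Sum>\<delta>\<in>UNIV. (\<Sum>\<gamma>\<in>UNIV. t' \<delta> \<gamma> * fst h $ \<gamma>) * d2coord a' a (base_t e) \<alpha> \<delta> \<beta>)
         + (\<Sum>k\<in>UNIV. fst (snd h) $ k * d2coord b b' (base_x e) j k i) * t0 \<alpha> \<beta>) * snd (snd v) $ i $ \<alpha>))"

lemma has_derivative_vec_lambda:
  fixes f :: "'i::finite \<Rightarrow> 'b::real_normed_vector \<Rightarrow> 'c::euclidean_space"
  assumes "\<And>i. (f i has_derivative f' i) F"
  shows "((\<lambda>x. \<chi> i. f i x) has_derivative (\<lambda>h. \<chi> i. f' i h)) F"
proof -
  have ax: "bounded_linear (axis i :: 'c \<Rightarrow> 'c^'i)" for i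
    unfolding linear_conv_bounded_linear[symmetric]
    by (rule linearI) (auto simp: vec_eq_iff axis_def)
  have eq: "(\<chi> i. g i) = (\<Sum>i\<in>UNIV. axis i (g i))" for g :: "'i \<Rightarrow> 'c"
    by (simp add: vec_eq_iff axis_def)
  show ?thesis
    unfolding eq by (intro has_derivative_sum bounded_linear.has_derivative[OF ax] assms)
qed

section \<open>The derivative of the frame change\<close>

context
  fixes a b a' b' and e :: "('t, 'm) jet_point"
  assumes a: "a \<in> AT" "a' \<in> AT" and b: "b \<in> AM" "b' \<in> AM"
    and e: "e \<in> fst (jchart a b)" "e \<in> fst (jchart a' b')"
begin

lemmas base_in' = base_in[OF a b e]

lemma dcoord_t'_has_derivative:
  "((\<lambda>z. dcoord a a' (base_t (cinv (jchart a b) z)) \<mu> \<alpha>) has_derivative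
    (\<lambda>h. \<Sum>\<gamma>\<in>UNIV. fst h $ \<gamma> * d2coord a a' (base_t e) \<mu> \<gamma> \<alpha>)) (at (snd (jchart a b) e))"
proof -
  have m: "snd a (base_t e) \<in> snd a ` (fst a \<inter> fst a')" using base_in' by blast
  note s = T.smooth_pdv_transition[OF a, of \<alpha> \<mu>]
  from base_t_has_derivative[OF a b e a(1) base_in'(1) smooth_on_has_derivative[OF s m]]
  show ?thesis
    using T.transition_derivative_same[OF a(1) base_in'(1)]
    by (simp add: dcoord_def d2coord_def frechet_derivative_pdv[OF smooth_on_differentiable[OF s m]])
qed

lemma dcoord_t0_has_derivative:
  "((\<lambda>z. dcoord a' a (base_t (cinv (jchart a b) z)) \<alpha> \<beta>) has_derivative
    (\<lambda>h. \<Sum>\<delta>\<in>UNIV. (\<Sum>\<gamma>\<in>UNIV. dcoord a a' (base_t e) \<delta> \<gamma> * fst h $ \<gamma>) * d2coord a' a (base_t e) \<alpha> \<delta> \<beta>))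
    (at (snd (jchart a b) e))"
proof -
  have m: "snd a' (base_t e) \<in> snd a' ` (fst a' \<inter> fst a)" using base_in' by blast
  note s = T.smooth_pdv_transition[OF a(2,1), of \<beta> \<alpha>]
  from base_t_has_derivative[OF a b e a(2) base_in'(2) smooth_on_has_derivative[OF s m]]
  show ?thesis
    using T.transition_component[OF a base_in'(1,2)]
    by (simp add: dcoord_def[of a'] d2coord_def frechet_derivative_pdv[OF smooth_on_differentiable[OF s m]])
qed

lemma dcoord_x'_has_derivative:
  "((\<lambda>z. dcoord b b' (base_x (cinv (jchart a b) z)) j i) has_derivative
    (\<lambda>h. \<Sum>k\<in>UNIV. fst (snd h) $ k * d2coord b b' (base_x e) j k i)) (at (snd (jchart a b) e))"
proof -
  have m: "snd b (base_x e) \<in> snd b ` (fst b \<inter> fst b')" using base_in' by blast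
  note s = M.smooth_pdv_transition[OF b, of i j]
  from base_x_has_derivative[OF a b e smooth_on_has_derivative[OF s m]]
  show ?thesis
    by (simp add: dcoord_def d2coord_def frechet_derivative_pdv[OF smooth_on_differentiable[OF s m]])
qed

lemma mderiv_frame_change:
  "mderiv (jchart a b) (\<lambda>r. F.frame_change (a, b) (a', b') r v) e h = frame_change_deriv a b a' b' e h v"
proof -
  let ?g = "\<lambda>z. let r = cinv (jchart a b) z in
    frame_block (dcoord a a' (base_t r)) (dcoord b b' (base_x r)) (dcoord a' a (base_t r)) v"
  have c: "cinv (jchart a b) (snd (jchart a b) e) = e" using a b e by simp
  note prod = has_derivative_mult[OF dcoord_x'_has_derivative dcoord_t0_has_derivative, unfolded c]
  have "(?g has_derivative (\<lambda>h. frame_change_deriv a b a' b' e h v)) (at (snd (jchart a b) e))"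
    unfolding frame_block_def frame_change_deriv_def Let_def
    by (intro has_derivative_Pair has_derivative_vec_lambda has_derivative_sum has_derivative_mult_left
        prod dcoord_t'_has_derivative dcoord_x'_has_derivative)
  then have "((\<lambda>z. F.frame_change (a, b) (a', b') (cinv (jchart a b) z) v) has_derivative
      (\<lambda>h. frame_change_deriv a b a' b' e h v)) (at (snd (jchart a b) e))"
  proof (rule has_derivative_transform_within_open)
    show "open (snd (jchart a b) ` (fst (jchart a b) \<inter> fst (jchart a' b')))"
      using jet_open_overlap a b by blast
    show "snd (jchart a b) e \<in> snd (jchart a b) ` (fst (jchart a b) \<inter> fst (jchart a' b'))"
      using e by blast
    fix z assume "z \<in> snd (jchart a b) ` (fst (jchart a b) \<inter> fst (jchart a' b'))"
    then obtain r where r: "r \<in> fst (jchart a b)" "r \<in> fst (jchart a' b')" "z = snd (jchart a b) r" by blast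
    then have "cinv (jchart a b) z = r" using a b by simp
    then show "?g z = F.frame_change (a, b) (a', b') (cinv (jchart a b) z) v"
      using frame_change_eq[OF a b r(1,2)] by (simp add: Let_def)
  qed
  from fun_cong[OF E.mderiv_unique[OF this], of h] show ?thesis .
qed

end

end

section \<open>The nine components as one bilinear map\<close>

lemma sum_inverse_apply:
  fixes Y :: "'a \<Rightarrow> 'b::finite \<Rightarrow> real" and X :: "'b \<Rightarrow> 'c::finite \<Rightarrow> real"
  shows "(\<Sum>m\<in>UNIV. Y k m * (\<Sum>i\<in>UNIV. X m i * F i)) = (\<Sum>i\<in>UNIV. (\<Sum>m\<in>UNIV. Y k m * X m i) * F i)"
  by (simp add: sum_distrib_left sum_distrib_right mult.assoc) (rule sum.swap)

lemma sum_delta_mult: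
  fixes F :: "'a::finite \<Rightarrow> real"
  shows "(\<Sum>i\<in>UNIV. (if k = i then 1 else 0) * F i) = F k"
    "(\<Sum>i\<in>UNIV. (if i = k then 1 else 0) * F i) = F k"
  by (simp_all add: if_distrib[of "\<lambda>x. x * _"] cong: if_cong)

text \<open>On unit vectors the identity gives the old component multiplied by a Jacobian, while
  most rules are stated solved for that component. Multiplying by the inverse Jacobian is
  reversible.\<close>

lemma solve_left:
  fixes X X0 :: "'a::finite \<Rightarrow> 'a \<Rightarrow> real"
  assumes "\<And>k i. (\<Sum>m\<in>UNIV. X0 k m * X m i) = (if k = i then 1 else 0)"
    "\<And>k i. (\<Sum>m\<in>UNIV. X k m * X0 m i) = (if k = i then 1 else 0)"
  shows "(\<forall>m. (\<Sum>k\<in>UNIV. X m k * F k) = H m) \<longleftrightarrow> (\<forall>k. F k = (\<Sum>m\<in>UNIV. X0 k m * H m))"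
proof
  assume "\<forall>m. (\<Sum>k\<in>UNIV. X m k * F k) = H m"
  then have "(\<Sum>m\<in>UNIV. X0 k m * H m) = (\<Sum>m\<in>UNIV. X0 k m * (\<Sum>i\<in>UNIV. X m i * F i))" for k by simp
  then show "\<forall>k. F k = (\<Sum>m\<in>UNIV. X0 k m * H m)"
    by (simp add: sum_inverse_apply assms sum_delta_mult)
next
  assume "\<forall>k. F k = (\<Sum>m\<in>UNIV. X0 k m * H m)"
  then have "(\<Sum>m\<in>UNIV. X k m * F m) = (\<Sum>m\<in>UNIV. X k m * (\<Sum>i\<in>UNIV. X0 m i * H i))" for k by simp
  then show "\<forall>m. (\<Sum>k\<in>UNIV. X m k * F k) = H m"
    by (simp add: sum_inverse_apply assms sum_delta_mult)
qed

text \<open>The transposed form of \<open>solve_left\<close>. It serves the rule for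
  \<open>Lb\<close>, which keeps an inverse Jacobian on the old side, attached to the direction
  index.\<close>

lemma solve_right:
  fixes X X0 :: "'a::finite \<Rightarrow> 'a \<Rightarrow> real"
  assumes "\<And>k i. (\<Sum>m\<in>UNIV. X0 k m * X m i) = (if k = i then 1 else 0)"
    "\<And>k i. (\<Sum>m\<in>UNIV. X k m * X0 m i) = (if k = i then 1 else 0)"
  shows "(\<forall>j. F j = (\<Sum>l\<in>UNIV. H l * X l j)) \<longleftrightarrow> (\<forall>l. (\<Sum>j\<in>UNIV. F j * X0 j l) = H l)"
proof -
  have 1: "(\<Sum>m\<in>UNIV. X m k * X0 i m) = (if k = i then 1 else 0)" for k i
    using assms(1)[of i k] by (simp add: mult.commute eq_commute[of k])
  have 2: "(\<Sum>m\<in>UNIV. X0 m k * X i m) = (if k = i then 1 else 0)" for k i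
    using assms(2)[of i k] by (simp add: mult.commute eq_commute[of k])
  show ?thesis
    using solve_left[of "\<lambda>k m. X m k" "\<lambda>m k. X0 k m" F H, OF 1 2] by (simp add: mult.commute)
qed

text \<open>The vertical block is a tensor product of a Jacobian and a transposed inverse Jacobian;
  it is inverted one index at a time.\<close>

lemma solve_left2:
  fixes X X0 :: "'a::finite \<Rightarrow> 'a \<Rightarrow> real" and Y Y0 :: "'b::finite \<Rightarrow> 'b \<Rightarrow> real"
  assumes X: "\<And>k i. (\<Sum>m\<in>UNIV. X0 k m * X m i) = (if k = i then 1 else 0)"
    "\<And>k i. (\<Sum>m\<in>UNIV. X k m * X0 m i) = (if k = i then 1 else 0)"
    and Y: "\<And>k i. (\<Sum>m\<in>UNIV. Y0 k m * Y m i) = (if k = i then 1 else 0)"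
    "\<And>k i. (\<Sum>m\<in>UNIV. Y k m * Y0 m i) = (if k = i then 1 else 0)"
  shows "(\<forall>p s. (\<Sum>k\<in>UNIV. \<Sum>g\<in>UNIV. X p k * Y0 g s * F k g) = H p s) \<longleftrightarrow>
    (\<forall>k g. F k g = (\<Sum>p\<in>UNIV. \<Sum>s\<in>UNIV. X0 k p * Y s g * H p s))"
proof -
  have "(\<forall>p s. (\<Sum>k\<in>UNIV. \<Sum>g\<in>UNIV. X p k * Y0 g s * F k g) = H p s) \<longleftrightarrow>
      (\<forall>s p. (\<Sum>k\<in>UNIV. X p k * (\<Sum>g\<in>UNIV. Y0 g s * F k g)) = H p s)"
    by (auto simp: sum_distrib_left mult.assoc)
  also have "\<dots> \<longleftrightarrow> (\<forall>s k. (\<Sum>g\<in>UNIV. Y0 g s * F k g) = (\<Sum>p\<in>UNIV. X0 k p * H p s))"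
    by (simp add: solve_left[OF X])
  also have "\<dots> \<longleftrightarrow> (\<forall>k s. (\<Sum>g\<in>UNIV. Y0 g s * F k g) = (\<Sum>p\<in>UNIV. X0 k p * H p s))"
    by blast
  also have "\<dots> \<longleftrightarrow> (\<forall>k g. F k g = (\<Sum>s\<in>UNIV. Y s g * (\<Sum>p\<in>UNIV. X0 k p * H p s)))"
  proof -
    have Y': "(\<Sum>m\<in>UNIV. Y m k * Y0 i m) = (if k = i then 1 else 0)"
      "(\<Sum>m\<in>UNIV. Y0 m k * Y i m) = (if k = i then 1 else 0)" for k i
      using Y(1)[of i k] Y(2)[of i k] by (auto simp: mult.commute)
    show ?thesis
      using solve_left[of "\<lambda>g s. Y s g" "\<lambda>s g. Y0 g s", OF Y'] by simp
  qed
  also have "\<dots> \<longleftrightarrow> (\<forall>k g. F k g = (\<Sum>p\<in>UNIV. \<Sum>s\<in>UNIV. X0 k p * Y s g * H p s))"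
  proof -
    have "(\<Sum>s\<in>UNIV. Y s g * (\<Sum>p\<in>UNIV. X0 k p * H p s)) =
        (\<Sum>p\<in>UNIV. \<Sum>s\<in>UNIV. X0 k p * Y s g * H p s)" for k g
      by (simp add: sum_distrib_left mult_ac) (rule sum.swap)
    then show ?thesis by simp
  qed
  finally show ?thesis .
qed

definition unit_t :: "'p::finite \<Rightarrow> ('p, 'n::finite) jet_coord" where "unit_t \<alpha> = (axis \<alpha> 1, 0, 0)"
definition unit_x :: "'n::finite \<Rightarrow> ('p::finite, 'n) jet_coord" where "unit_x i = (0, axis i 1, 0)"
definition unit_v :: "'n::finite \<Rightarrow> 'p::finite \<Rightarrow> ('p, 'n) jet_coord" where
  "unit_v i \<alpha> = (0, 0, axis i (axis \<alpha> 1))"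

lemmas unit_defs = unit_t_def unit_x_def unit_v_def

lemma jet_coord_Basis:
  assumes "u \<in> (Basis :: ('p::finite, 'n::finite) jet_coord set)"
  obtains \<alpha> where "u = unit_t \<alpha>" | i where "u = unit_x i" | i \<alpha> where "u = unit_v i \<alpha>"
  using assms by (auto simp: Basis_prod_def Basis_vec_def unit_defs zero_prod_def)

text \<open>Unit vectors come in three kinds, so pairs of them fall into nine families. These
  correspond to the nine components and, applied to the transformation identity, to the nine
  rules.\<close>

lemma bilinear_jet_eq_iff:
  fixes f g :: "('p::finite, 'n::finite) jet_coord \<Rightarrow> ('p, 'n) jet_coord \<Rightarrow> 'v::euclidean_space"
  assumes "bilinear f" "bilinear g"
  shows "f = g \<longleftrightarrow>
    (\<forall>\<gamma> \<beta>. f (unit_t \<gamma>) (unit_t \<beta>) = g (unit_t \<gamma>) (unit_t \<beta>)) \<and>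
    (\<forall>\<gamma> i. f (unit_t \<gamma>) (unit_x i) = g (unit_t \<gamma>) (unit_x i)) \<and>
    (\<forall>\<gamma> i \<beta>. f (unit_t \<gamma>) (unit_v i \<beta>) = g (unit_t \<gamma>) (unit_v i \<beta>)) \<and>
    (\<forall>j \<beta>. f (unit_x j) (unit_t \<beta>) = g (unit_x j) (unit_t \<beta>)) \<and>
    (\<forall>j i. f (unit_x j) (unit_x i) = g (unit_x j) (unit_x i)) \<and>
    (\<forall>j i \<beta>. f (unit_x j) (unit_v i \<beta>) = g (unit_x j) (unit_v i \<beta>)) \<and>
    (\<forall>j \<gamma> \<beta>. f (unit_v j \<gamma>) (unit_t \<beta>) = g (unit_v j \<gamma>) (unit_t \<beta>)) \<and>
    (\<forall>j \<gamma> i. f (unit_v j \<gamma>) (unit_x i) = g (unit_v j \<gamma>) (unit_x i)) \<and>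
    (\<forall>j \<gamma> i \<beta>. f (unit_v j \<gamma>) (unit_v i \<beta>) = g (unit_v j \<gamma>) (unit_v i \<beta>))"
    (is "_ \<longleftrightarrow> ?R")
proof
  assume R: ?R
  have "f u v = g u v" if "u \<in> Basis" "v \<in> Basis" for u v
    using that(1)
  proof (cases rule: jet_coord_Basis)
    case (1 \<gamma>)
    from that(2) show ?thesis by (cases rule: jet_coord_Basis) (use R 1 in auto)
  next
    case (2 j)
    from that(2) show ?thesis by (cases rule: jet_coord_Basis) (use R 2 in auto)
  next
    case (3 j \<gamma>)
    from that(2) show ?thesis by (cases rule: jet_coord_Basis) (use R 3 in auto)
  qed
  then show "f = g" using bilinear_eq_stdbasis[OF assms] by blast
qed auto

lemma bilinear_compose_left: "linear L \<Longrightarrow> bilinear f \<Longrightarrow> bilinear (\<lambda>u v. L (f u v))"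
  by (simp add: bilinear_def linear_iff)

lemma bilinear_compose_right: "linear L \<Longrightarrow> bilinear f \<Longrightarrow> bilinear (\<lambda>u v. f (L u) (L v))"
  by (simp add: bilinear_def linear_iff)

lemma bilinear_add: "bilinear f \<Longrightarrow> bilinear g \<Longrightarrow> bilinear (\<lambda>u v. f u v + g u v)"
  by (simp add: bilinear_def linear_iff algebra_simps)

text \<open>The sums run in the order of the transformation rules.\<close>

definition coef_map :: "('c, 'e, 'p::finite, 'n::finite) nine_components \<Rightarrow> 'c \<Rightarrow> 'e
    \<Rightarrow> ('p, 'n) jet_coord \<Rightarrow> ('p, 'n) jet_coord \<Rightarrow> ('p, 'n) jet_coord" where
  "coef_map w c e u v =
    (\<chi> \<alpha>. (\<Sum>\<beta>\<in>UNIV. \<Sum>\<gamma>\<in>UNIV. Gb w c e \<alpha> \<beta> \<gamma> * fst v $ \<beta> * fst u $ \<gamma>)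
        + (\<Sum>\<beta>\<in>UNIV. \<Sum>j\<in>UNIV. Lb w c e \<alpha> \<beta> j * fst v $ \<beta> * fst (snd u) $ j)
        + (\<Sum>\<gamma>\<in>UNIV. \<Sum>\<beta>\<in>UNIV. \<Sum>j\<in>UNIV. Cb w c e \<alpha> \<gamma> \<beta> j * fst v $ \<beta> * snd (snd u) $ j $ \<gamma>),
     \<chi> k. (\<Sum>i\<in>UNIV. \<Sum>\<gamma>\<in>UNIV. Gm w c e k i \<gamma> * fst (snd v) $ i * fst u $ \<gamma>)
        + (\<Sum>i\<in>UNIV. \<Sum>j\<in>UNIV. Lm w c e k i j * fst (snd v) $ i * fst (snd u) $ j)
        + (\<Sum>\<gamma>\<in>UNIV. \<Sum>i\<in>UNIV. \<Sum>j\<in>UNIV. Cm w c e k \<gamma> i j * fst (snd v) $ i * snd (snd u) $ j $ \<gamma>),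
     \<chi> k \<alpha>. (\<Sum>\<beta>\<in>UNIV. \<Sum>i\<in>UNIV. \<Sum>\<gamma>\<in>UNIV. Gv w c e k \<beta> \<alpha> i \<gamma> * snd (snd v) $ i $ \<beta> * fst u $ \<gamma>)
        + (\<Sum>\<beta>\<in>UNIV. \<Sum>i\<in>UNIV. \<Sum>j\<in>UNIV. Lv w c e k \<beta> \<alpha> i j * snd (snd v) $ i $ \<beta> * fst (snd u) $ j)
        + (\<Sum>\<beta>\<in>UNIV. \<Sum>\<gamma>\<in>UNIV. \<Sum>i\<in>UNIV. \<Sum>j\<in>UNIV.
             Cv w c e k \<beta> \<gamma> \<alpha> i j * snd (snd v) $ i $ \<beta> * snd (snd u) $ j $ \<gamma>))"

lemma bilinear_coef_map:
  fixes w :: "('c, 'e, 'p::finite, 'n::finite) nine_components"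
  shows "bilinear (coef_map w c e)"
  unfolding bilinear_def
proof (intro conjI allI linearI)
  fix u u' v v' :: "('p, 'n) jet_coord" and k :: real
  show "coef_map w c e u (v + v') = coef_map w c e u v + coef_map w c e u v'"
    by (simp add: coef_map_def vec_eq_iff distrib_left distrib_right sum.distrib)
  show "coef_map w c e (u + u') v = coef_map w c e u v + coef_map w c e u' v"
    by (simp add: coef_map_def vec_eq_iff distrib_left distrib_right sum.distrib)
  show "coef_map w c e u (k *\<^sub>R v) = k *\<^sub>R coef_map w c e u v"
    by (simp add: coef_map_def vec_eq_iff distrib_left sum_distrib_left mult.left_commute[of k] mult.assoc)
  show "coef_map w c e (k *\<^sub>R u) v = k *\<^sub>R coef_map w c e u v"
    by (simp add: coef_map_def vec_eq_iff distrib_left sum_distrib_left mult.left_commute[of k] mult.assoc)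
qed

lemma coef_map_blocks:
  "coef_map w c e (\<tau>, 0, 0) (\<tau>', 0, 0) =
     (\<chi> \<alpha>. \<Sum>\<beta>\<in>UNIV. \<Sum>\<gamma>\<in>UNIV. Gb w c e \<alpha> \<beta> \<gamma> * \<tau>' $ \<beta> * \<tau> $ \<gamma>, 0, 0)"
  "coef_map w c e (\<tau>, 0, 0) (0, \<xi>', 0) =
     (0, \<chi> k. \<Sum>i\<in>UNIV. \<Sum>\<gamma>\<in>UNIV. Gm w c e k i \<gamma> * \<xi>' $ i * \<tau> $ \<gamma>, 0)"
  "coef_map w c e (\<tau>, 0, 0) (0, 0, \<eta>') =
     (0, 0, \<chi> k \<alpha>. \<Sum>\<beta>\<in>UNIV. \<Sum>i\<in>UNIV. \<Sum>\<gamma>\<in>UNIV. Gv w c e k \<beta> \<alpha> i \<gamma> * \<eta>' $ i $ \<beta> * \<tau> $ \<gamma>)"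
  "coef_map w c e (0, \<xi>, 0) (\<tau>', 0, 0) =
     (\<chi> \<alpha>. \<Sum>\<beta>\<in>UNIV. \<Sum>j\<in>UNIV. Lb w c e \<alpha> \<beta> j * \<tau>' $ \<beta> * \<xi> $ j, 0, 0)"
  "coef_map w c e (0, \<xi>, 0) (0, \<xi>', 0) =
     (0, \<chi> k. \<Sum>i\<in>UNIV. \<Sum>j\<in>UNIV. Lm w c e k i j * \<xi>' $ i * \<xi> $ j, 0)"
  "coef_map w c e (0, \<xi>, 0) (0, 0, \<eta>') =
     (0, 0, \<chi> k \<alpha>. \<Sum>\<beta>\<in>UNIV. \<Sum>i\<in>UNIV. \<Sum>j\<in>UNIV. Lv w c e k \<beta> \<alpha> i j * \<eta>' $ i $ \<beta> * \<xi> $ j)"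
  "coef_map w c e (0, 0, \<eta>) (\<tau>', 0, 0) =
     (\<chi> \<alpha>. \<Sum>\<gamma>\<in>UNIV. \<Sum>\<beta>\<in>UNIV. \<Sum>j\<in>UNIV. Cb w c e \<alpha> \<gamma> \<beta> j * \<tau>' $ \<beta> * \<eta> $ j $ \<gamma>, 0, 0)"
  "coef_map w c e (0, 0, \<eta>) (0, \<xi>', 0) =
     (0, \<chi> k. \<Sum>\<gamma>\<in>UNIV. \<Sum>i\<in>UNIV. \<Sum>j\<in>UNIV. Cm w c e k \<gamma> i j * \<xi>' $ i * \<eta> $ j $ \<gamma>, 0)"
  "coef_map w c e (0, 0, \<eta>) (0, 0, \<eta>') =
     (0, 0, \<chi> k \<alpha>. \<Sum>\<beta>\<in>UNIV. \<Sum>\<gamma>\<in>UNIV. \<Sum>i\<in>UNIV. \<Sum>j\<in>UNIV.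
        Cv w c e k \<beta> \<gamma> \<alpha> i j * \<eta>' $ i $ \<beta> * \<eta> $ j $ \<gamma>)"
  by (simp_all add: coef_map_def vec_eq_iff)

lemma coef_map_units:
  "coef_map w c e (unit_t \<gamma>) (unit_t \<beta>) = (\<chi> \<alpha>. Gb w c e \<alpha> \<beta> \<gamma>, 0, 0)"
  "coef_map w c e (unit_t \<gamma>) (unit_x i) = (0, \<chi> k. Gm w c e k i \<gamma>, 0)"
  "coef_map w c e (unit_t \<gamma>) (unit_v i \<beta>) = (0, 0, \<chi> k \<alpha>. Gv w c e k \<beta> \<alpha> i \<gamma>)"
  "coef_map w c e (unit_x j) (unit_t \<beta>) = (\<chi> \<alpha>. Lb w c e \<alpha> \<beta> j, 0, 0)"
  "coef_map w c e (unit_x j) (unit_x i) = (0, \<chi> k. Lm w c e k i j, 0)"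
  "coef_map w c e (unit_x j) (unit_v i \<beta>) = (0, 0, \<chi> k \<alpha>. Lv w c e k \<beta> \<alpha> i j)"
  "coef_map w c e (unit_v j \<gamma>) (unit_t \<beta>) = (\<chi> \<alpha>. Cb w c e \<alpha> \<gamma> \<beta> j, 0, 0)"
  "coef_map w c e (unit_v j \<gamma>) (unit_x i) = (0, \<chi> k. Cm w c e k \<gamma> i j, 0)"
  "coef_map w c e (unit_v j \<gamma>) (unit_v i \<beta>) = (0, 0, \<chi> k \<alpha>. Cv w c e k \<beta> \<gamma> \<alpha> i j)"
  unfolding unit_defs coef_map_blocks by (simp_all add: delta_simps cong: if_cong)

section \<open>The transformation identity evaluated on unit vectors\<close>

context jet_connection
begin

lemma block_blocks:
  "frame_block T X Z (\<tau>, 0, 0) = (\<chi> \<mu>. \<Sum>\<alpha>\<in>UNIV. T \<mu> \<alpha> * \<tau> $ \<alpha>, 0, 0)"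
  "frame_block T X Z (0, \<xi>, 0) = (0, \<chi> j. \<Sum>i\<in>UNIV. X j i * \<xi> $ i, 0)"
  "frame_block T X Z (0, 0, \<eta>) = (0, 0, \<chi> j \<beta>. \<Sum>i\<in>UNIV. \<Sum>\<alpha>\<in>UNIV. X j i * Z \<alpha> \<beta> * \<eta> $ i $ \<alpha>)"
  by (simp_all add: frame_block_def vec_eq_iff)

lemma block_units:
  "frame_block T X Z (unit_t \<gamma>) = (\<chi> \<mu>. T \<mu> \<gamma>, 0, 0)"
  "frame_block T X Z (unit_x i) = (0, \<chi> j. X j i, 0)"
  "frame_block T X Z (unit_v i \<alpha>) = (0, 0, \<chi> j \<beta>. X j i * Z \<alpha> \<beta>)"
  unfolding unit_defs block_blocks by (simp_all add: delta_simps cong: if_cong)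

lemma linear_frame_block: "linear (frame_block T X Z)"
  by (rule linearI)
    (simp_all add: frame_block_def vec_eq_iff distrib_left sum.distrib sum_distrib_left mult.left_commute)

context
  fixes a b a' b' and e :: "('t, 'm) jet_point"
  assumes a: "a \<in> AT" "a' \<in> AT" and b: "b \<in> AM" "b' \<in> AM"
    and e: "e \<in> fst (jchart a b)" "e \<in> fst (jchart a' b')"
begin

lemma dcoord_inverses:
  "(\<Sum>m\<in>UNIV. dcoord a' a (base_t e) k m * dcoord a a' (base_t e) m i) = (if k = i then 1 else 0)"
  "(\<Sum>m\<in>UNIV. dcoord a a' (base_t e) k m * dcoord a' a (base_t e) m i) = (if k = i then 1 else 0)"
  "(\<Sum>m\<in>UNIV. dcoord b' b (base_x e) r m * dcoord b b' (base_x e) m s) = (if r = s then 1 else 0)"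
  "(\<Sum>m\<in>UNIV. dcoord b b' (base_x e) r m * dcoord b' b (base_x e) m s) = (if r = s then 1 else 0)"
  using a b base_in[OF a b e] by (simp_all only: T.dcoord_inverse M.dcoord_inverse)

lemmas dcoord_t_inverse = dcoord_inverses(1,2)
lemmas dcoord_x_inverse = dcoord_inverses(3,4)
lemmas d2coord_t_symmetric = T.d2coord_symmetric[OF a base_in(1,2)[OF a b e]]
lemmas d2coord_x_symmetric = M.d2coord_symmetric[OF b base_in(3,4)[OF a b e]]

private abbreviation (input) "t' \<equiv> dcoord a a' (base_t e)"
private abbreviation (input) "t0 \<equiv> dcoord a' a (base_t e)"
private abbreviation (input) "x' \<equiv> dcoord b b' (base_x e)"
private abbreviation (input) "x0 \<equiv> dcoord b' b (base_x e)"
private abbreviation (input) "block \<equiv> frame_block (dcoord a a' (base_t e)) (dcoord b b' (base_x e)) (dcoord a' a (base_t e))"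

private abbreviation (input) "fcd \<equiv> frame_change_deriv a b a' b' e"

lemma bilinear_frame_change_deriv: "bilinear fcd"
  unfolding bilinear_def
proof (intro conjI allI linearI)
  fix u u' v v' :: "('p, 'n) jet_coord" and k :: real
  show "fcd u (v + v') = fcd u v + fcd u v'"
    by (simp add: frame_change_deriv_def Let_def vec_eq_iff distrib_left sum.distrib)
  show "fcd (u + u') v = fcd u v + fcd u' v"
    by (simp add: frame_change_deriv_def Let_def vec_eq_iff distrib_left distrib_right sum.distrib)
  show "fcd u (k *\<^sub>R v) = k *\<^sub>R fcd u v"
    by (simp add: frame_change_deriv_def Let_def vec_eq_iff sum_distrib_left mult.left_commute[of k])
  show "fcd (k *\<^sub>R u) v = k *\<^sub>R fcd u v"
    by (simp add: frame_change_deriv_def Let_def vec_eq_iff distrib_left sum_distrib_left sum_distrib_right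
        mult.left_commute[of k] mult.assoc distrib_right)
qed

text \<open>The zeros express that each base Jacobian depends on its own factor of the base and that
  nothing depends on the fibre. They account for the homogeneous rules.\<close>

lemma frame_change_deriv_units:
  "fcd (unit_t \<gamma>) (unit_t \<beta>) = (\<chi> \<mu>. d2coord a a' (base_t e) \<mu> \<gamma> \<beta>, 0, 0)"
  "fcd (unit_t \<gamma>) (unit_x i) = 0"
  "fcd (unit_t \<gamma>) (unit_v i \<beta>) =
     (0, 0, \<chi> p \<epsilon>. x' p i * (\<Sum>\<delta>\<in>UNIV. t' \<delta> \<gamma> * d2coord a' a (base_t e) \<beta> \<delta> \<epsilon>))"
  "fcd (unit_x j) (unit_t \<beta>) = 0"
  "fcd (unit_x j) (unit_x i) = (0, \<chi> r. d2coord b b' (base_x e) r j i, 0)"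
  "fcd (unit_x j) (unit_v i \<beta>) = (0, 0, \<chi> r \<nu>. d2coord b b' (base_x e) r j i * t0 \<beta> \<nu>)"
  "fcd (unit_v j \<gamma>) v = 0"
  by (simp_all add: frame_change_deriv_def Let_def unit_defs vec_eq_iff zero_prod_def delta_simps cong: if_cong)

context
  fixes w :: "('t, 'm, 'p, 'n) ncomp"
begin

private abbreviation (input) "G \<equiv> coef_map w (a, b) e"
private abbreviation (input) "G' \<equiv> coef_map w (a', b') e"
private abbreviation (input) "compatible \<equiv> \<lambda>u v. block (G u v) = G' (block u) (block v) + fcd u v"

text \<open>Evaluation on each family of unit pairs gives a rule up to the place of the Jacobians
  and the order of the sums; the inverse Jacobians do the rest.\<close>

lemma compatible_hT:
  "(\<forall>\<gamma> \<beta>. compatible (unit_t \<gamma>) (unit_t \<beta>)) \<and> (\<forall>\<gamma> i. compatible (unit_t \<gamma>) (unit_x i)) \<and>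
    (\<forall>\<gamma> i \<beta>. compatible (unit_t \<gamma>) (unit_v i \<beta>)) \<longleftrightarrow> rules_hT w (a, b) (a', b') e"
proof -
  have 1: "(\<forall>\<gamma> \<beta>. compatible (unit_t \<gamma>) (unit_t \<beta>)) \<longleftrightarrow> (\<forall>\<alpha> \<beta> \<epsilon>.
        (\<Sum>\<delta>\<in>UNIV. Gb w (a, b) e \<delta> \<alpha> \<beta> * t' \<epsilon> \<delta>) =
        (\<Sum>\<mu>\<in>UNIV. \<Sum>\<gamma>\<in>UNIV. Gb w (a', b') e \<epsilon> \<mu> \<gamma> * t' \<mu> \<alpha> * t' \<gamma> \<beta>)
        + d2coord a a' (base_t e) \<epsilon> \<alpha> \<beta>)"
  proof -
    have "(\<forall>\<gamma> \<beta>. compatible (unit_t \<gamma>) (unit_t \<beta>)) \<longleftrightarrow> (\<forall>\<gamma> \<alpha> \<epsilon>.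
        (\<Sum>\<delta>\<in>UNIV. t' \<epsilon> \<delta> * Gb w (a, b) e \<delta> \<alpha> \<gamma>) =
        (\<Sum>\<mu>\<in>UNIV. \<Sum>\<nu>\<in>UNIV. Gb w (a', b') e \<epsilon> \<mu> \<nu> * t' \<mu> \<alpha> * t' \<nu> \<gamma>)
        + d2coord a a' (base_t e) \<epsilon> \<gamma> \<alpha>)"
      unfolding coef_map_units block_units block_blocks coef_map_blocks frame_change_deriv_units
      by (simp add: vec_eq_iff)
    \<comment> \<open>The derivative of the frame change has the direction as first differentiation
      index, the rule has it last; symmetry of second derivatives reconciles them.\<close>
    also have "\<dots> \<longleftrightarrow> (\<forall>\<gamma> \<alpha> \<epsilon>.
        (\<Sum>\<delta>\<in>UNIV. Gb w (a, b) e \<delta> \<alpha> \<gamma> * t' \<epsilon> \<delta>) =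
        (\<Sum>\<mu>\<in>UNIV. \<Sum>\<nu>\<in>UNIV. Gb w (a', b') e \<epsilon> \<mu> \<nu> * t' \<mu> \<alpha> * t' \<nu> \<gamma>)
        + d2coord a a' (base_t e) \<epsilon> \<alpha> \<gamma>)"
      by (subst d2coord_t_symmetric) (simp only: mult.commute[of "dcoord _ _ _ _ _"])
    finally show ?thesis by blast
  qed
  have 2: "(\<forall>\<gamma> i. compatible (unit_t \<gamma>) (unit_x i)) \<longleftrightarrow> (\<forall>k i \<gamma>.
        Gm w (a, b) e k i \<gamma> =
        (\<Sum>m\<in>UNIV. \<Sum>j\<in>UNIV. \<Sum>\<beta>\<in>UNIV. Gm w (a', b') e m j \<beta> * x0 k m * x' j i * t' \<beta> \<gamma>))"
  proof -
    have "(\<forall>\<gamma> i. compatible (unit_t \<gamma>) (unit_x i)) \<longleftrightarrow>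
      (\<forall>\<gamma> i m. (\<Sum>k\<in>UNIV. x' m k * Gm w (a, b) e k i \<gamma>) =
        (\<Sum>j\<in>UNIV. \<Sum>\<beta>\<in>UNIV. Gm w (a', b') e m j \<beta> * x' j i * t' \<beta> \<gamma>))"
      unfolding coef_map_units block_units block_blocks coef_map_blocks frame_change_deriv_units
      by (simp add: vec_eq_iff)
    also have "\<dots> \<longleftrightarrow> (\<forall>\<gamma> i k. Gm w (a, b) e k i \<gamma> = (\<Sum>m\<in>UNIV. x0 k m *
        (\<Sum>j\<in>UNIV. \<Sum>\<beta>\<in>UNIV. Gm w (a', b') e m j \<beta> * x' j i * t' \<beta> \<gamma>)))"
      by (simp only: solve_left[OF dcoord_x_inverse])
    also have "\<dots> \<longleftrightarrow> (\<forall>k i \<gamma>. Gm w (a, b) e k i \<gamma> =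
        (\<Sum>m\<in>UNIV. \<Sum>j\<in>UNIV. \<Sum>\<beta>\<in>UNIV. Gm w (a', b') e m j \<beta> * x0 k m * x' j i * t' \<beta> \<gamma>))"
      by (simp add: sum_distrib_left mult_ac) blast
    finally show ?thesis .
  qed
  have 3: "(\<forall>\<gamma> i \<beta>. compatible (unit_t \<gamma>) (unit_v i \<beta>)) \<longleftrightarrow> (\<forall>k \<beta> \<gamma> i \<alpha>.
        Gv w (a, b) e k \<beta> \<gamma> i \<alpha> =
        (\<Sum>p\<in>UNIV. \<Sum>\<eta>\<in>UNIV. \<Sum>\<epsilon>\<in>UNIV. \<Sum>j\<in>UNIV. \<Sum>\<mu>\<in>UNIV.
           Gv w (a', b') e p \<eta> \<epsilon> j \<mu> * x0 k p * t' \<epsilon> \<gamma> * x' j i * t0 \<beta> \<eta> * t' \<mu> \<alpha>)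
        + (if k = i then 1 else 0) *
          (\<Sum>\<mu>\<in>UNIV. \<Sum>\<epsilon>\<in>UNIV. t' \<mu> \<alpha> * t' \<epsilon> \<gamma> * d2coord a' a (base_t e) \<beta> \<mu> \<epsilon>))"
  proof -
    let ?H = "\<lambda>\<alpha> i \<beta> p \<epsilon>. (\<Sum>\<eta>\<in>UNIV. \<Sum>j\<in>UNIV. \<Sum>\<mu>\<in>UNIV. Gv w (a', b') e p \<eta> \<epsilon> j \<mu> * (x' j i * t0 \<beta> \<eta>) * t' \<mu> \<alpha>)
        + x' p i * (\<Sum>\<delta>\<in>UNIV. t' \<delta> \<alpha> * d2coord a' a (base_t e) \<beta> \<delta> \<epsilon>)"
    have "(\<forall>\<gamma> i \<beta>. compatible (unit_t \<gamma>) (unit_v i \<beta>)) \<longleftrightarrow>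
      (\<forall>\<alpha> i \<beta> p \<epsilon>. (\<Sum>k\<in>UNIV. \<Sum>\<gamma>\<in>UNIV. x' p k * t0 \<gamma> \<epsilon> * Gv w (a, b) e k \<beta> \<gamma> i \<alpha>) = ?H \<alpha> i \<beta> p \<epsilon>)"
      unfolding coef_map_units block_units block_blocks coef_map_blocks frame_change_deriv_units
      by (simp add: vec_eq_iff)
    \<comment> \<open>The vertical block, with Jacobian \<open>x'\<close> and inverse Jacobian
      \<open>t0\<close>, is inverted by \<open>x0\<close> and \<open>t'\<close>.\<close>
    also have "\<dots> \<longleftrightarrow> (\<forall>\<alpha> i \<beta> k \<gamma>. Gv w (a, b) e k \<beta> \<gamma> i \<alpha> =
        (\<Sum>p\<in>UNIV. \<Sum>\<epsilon>\<in>UNIV. x0 k p * t' \<epsilon> \<gamma> * ?H \<alpha> i \<beta> p \<epsilon>))"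
      by (simp only: solve_left2[OF dcoord_x_inverse dcoord_t_inverse])
    also have "\<dots> \<longleftrightarrow> (\<forall>\<alpha> i \<beta> k \<gamma>. Gv w (a, b) e k \<beta> \<gamma> i \<alpha> =
        (\<Sum>p\<in>UNIV. \<Sum>\<eta>\<in>UNIV. \<Sum>\<epsilon>\<in>UNIV. \<Sum>j\<in>UNIV. \<Sum>\<mu>\<in>UNIV.
           Gv w (a', b') e p \<eta> \<epsilon> j \<mu> * x0 k p * t' \<epsilon> \<gamma> * x' j i * t0 \<beta> \<eta> * t' \<mu> \<alpha>)
        + (if k = i then 1 else 0) *
          (\<Sum>\<mu>\<in>UNIV. \<Sum>\<epsilon>\<in>UNIV. t' \<mu> \<alpha> * t' \<epsilon> \<gamma> * d2coord a' a (base_t e) \<beta> \<mu> \<epsilon>))"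
    proof -
      have "(\<Sum>p\<in>UNIV. \<Sum>\<epsilon>\<in>UNIV. x0 k p * t' \<epsilon> \<gamma> * ?H \<alpha> i \<beta> p \<epsilon>) =
        (\<Sum>p\<in>UNIV. \<Sum>\<epsilon>\<in>UNIV. \<Sum>\<eta>\<in>UNIV. \<Sum>j\<in>UNIV. \<Sum>\<mu>\<in>UNIV.
           Gv w (a', b') e p \<eta> \<epsilon> j \<mu> * x0 k p * t' \<epsilon> \<gamma> * x' j i * t0 \<beta> \<eta> * t' \<mu> \<alpha>)
        + (\<Sum>p\<in>UNIV. \<Sum>\<epsilon>\<in>UNIV. (x0 k p * x' p i) * (t' \<epsilon> \<gamma> * (\<Sum>\<delta>\<in>UNIV. t' \<delta> \<alpha> * d2coord a' a (base_t e) \<beta> \<delta> \<epsilon>)))"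
        for \<alpha> i \<beta> k \<gamma>
        by (simp add: distrib_left sum.distrib sum_distrib_left mult_ac)
      moreover have "(\<Sum>p\<in>UNIV. \<Sum>\<epsilon>\<in>UNIV. \<Sum>\<eta>\<in>UNIV. \<Sum>j\<in>UNIV. \<Sum>\<mu>\<in>UNIV.
           Gv w (a', b') e p \<eta> \<epsilon> j \<mu> * x0 k p * t' \<epsilon> \<gamma> * x' j i * t0 \<beta> \<eta> * t' \<mu> \<alpha>) =
         (\<Sum>p\<in>UNIV. \<Sum>\<eta>\<in>UNIV. \<Sum>\<epsilon>\<in>UNIV. \<Sum>j\<in>UNIV. \<Sum>\<mu>\<in>UNIV.
           Gv w (a', b') e p \<eta> \<epsilon> j \<mu> * x0 k p * t' \<epsilon> \<gamma> * x' j i * t0 \<beta> \<eta> * t' \<mu> \<alpha>)"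
        for \<alpha> i \<beta> k \<gamma>
        by (rule sum.cong[OF refl], rule sum.swap)
      \<comment> \<open>In the inhomogeneous term \<open>x0\<close> meets \<open>x'\<close> and
        leaves the Kronecker delta. Of the two factors \<open>t'\<close>, one comes from inverting
        the block and the other from the chain rule for \<open>t0\<close>.\<close>
      moreover have "(\<Sum>p\<in>UNIV. \<Sum>\<epsilon>\<in>UNIV. (x0 k p * x' p i) * (t' \<epsilon> \<gamma> * (\<Sum>\<delta>\<in>UNIV. t' \<delta> \<alpha> * d2coord a' a (base_t e) \<beta> \<delta> \<epsilon>))) =
        (if k = i then 1 else 0) *
          (\<Sum>\<mu>\<in>UNIV. \<Sum>\<epsilon>\<in>UNIV. t' \<mu> \<alpha> * t' \<epsilon> \<gamma> * d2coord a' a (base_t e) \<beta> \<mu> \<epsilon>)"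
        for \<alpha> i \<beta> k \<gamma>
      proof -
        have "(\<Sum>\<epsilon>\<in>UNIV. t' \<epsilon> \<gamma> * (\<Sum>\<delta>\<in>UNIV. t' \<delta> \<alpha> * d2coord a' a (base_t e) \<beta> \<delta> \<epsilon>)) =
          (\<Sum>\<mu>\<in>UNIV. \<Sum>\<epsilon>\<in>UNIV. t' \<mu> \<alpha> * t' \<epsilon> \<gamma> * d2coord a' a (base_t e) \<beta> \<mu> \<epsilon>)"
          by (subst sum.swap) (simp add: sum_distrib_left mult_ac)
        then show ?thesis
          by (simp only: sum_distrib_left[symmetric] sum_distrib_right[symmetric] dcoord_x_inverse)
      qed
      ultimately show ?thesis by simp
    qed
    finally show ?thesis by blast
  qed
  show ?thesis unfolding 1 2 3 rules_hT_def Let_def by simp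
qed

lemma compatible_hM:
  "(\<forall>j \<beta>. compatible (unit_x j) (unit_t \<beta>)) \<and> (\<forall>j i. compatible (unit_x j) (unit_x i)) \<and>
    (\<forall>j i \<beta>. compatible (unit_x j) (unit_v i \<beta>)) \<longleftrightarrow> rules_hM w (a, b) (a', b') e"
proof -
  have 1: "(\<forall>j \<beta>. compatible (unit_x j) (unit_t \<beta>)) \<longleftrightarrow> (\<forall>\<gamma> \<beta> l.
        (\<Sum>j\<in>UNIV. Lb w (a, b) e \<gamma> \<beta> j * x0 j l) =
        (\<Sum>\<eta>\<in>UNIV. \<Sum>\<mu>\<in>UNIV. Lb w (a', b') e \<eta> \<mu> l * t0 \<gamma> \<eta> * t' \<mu> \<beta>))"
  proof -
    let ?H = "\<lambda>\<gamma> \<beta> l. \<Sum>\<eta>\<in>UNIV. \<Sum>\<mu>\<in>UNIV. Lb w (a', b') e \<eta> \<mu> l * t0 \<gamma> \<eta> * t' \<mu> \<beta>"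
    have "(\<forall>j \<beta>. compatible (unit_x j) (unit_t \<beta>)) \<longleftrightarrow>
      (\<forall>j \<beta> \<eta>. (\<Sum>\<gamma>\<in>UNIV. t' \<eta> \<gamma> * Lb w (a, b) e \<gamma> \<beta> j) =
        (\<Sum>\<mu>\<in>UNIV. \<Sum>l\<in>UNIV. Lb w (a', b') e \<eta> \<mu> l * t' \<mu> \<beta> * x' l j))"
      unfolding coef_map_units block_units block_blocks coef_map_blocks frame_change_deriv_units
      by (simp add: vec_eq_iff)
    also have "\<dots> \<longleftrightarrow> (\<forall>j \<beta> \<gamma>. Lb w (a, b) e \<gamma> \<beta> j = (\<Sum>\<eta>\<in>UNIV. t0 \<gamma> \<eta> *
        (\<Sum>\<mu>\<in>UNIV. \<Sum>l\<in>UNIV. Lb w (a', b') e \<eta> \<mu> l * t' \<mu> \<beta> * x' l j)))"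
      by (simp only: solve_left[OF dcoord_t_inverse])
    \<comment> \<open>Reordering the sums isolates \<open>x'\<close> as the outermost factor, so
      that it can be moved to the other side by \<open>solve_right\<close>.\<close>
    also have "\<dots> \<longleftrightarrow> (\<forall>\<gamma> \<beta> j. Lb w (a, b) e \<gamma> \<beta> j = (\<Sum>l\<in>UNIV. ?H \<gamma> \<beta> l * x' l j))"
    proof -
      have "(\<Sum>\<eta>\<in>UNIV. t0 \<gamma> \<eta> * (\<Sum>\<mu>\<in>UNIV. \<Sum>l\<in>UNIV. Lb w (a', b') e \<eta> \<mu> l * t' \<mu> \<beta> * x' l j)) =
          (\<Sum>l\<in>UNIV. ?H \<gamma> \<beta> l * x' l j)" for \<gamma> \<beta> j
      proof -
        have "(\<Sum>\<eta>\<in>UNIV. t0 \<gamma> \<eta> * (\<Sum>\<mu>\<in>UNIV. \<Sum>l\<in>UNIV. Lb w (a', b') e \<eta> \<mu> l * t' \<mu> \<beta> * x' l j)) =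
          (\<Sum>\<eta>\<in>UNIV. \<Sum>\<mu>\<in>UNIV. \<Sum>l\<in>UNIV. Lb w (a', b') e \<eta> \<mu> l * t0 \<gamma> \<eta> * t' \<mu> \<beta> * x' l j)"
          by (simp add: sum_distrib_left mult_ac)
        also have "\<dots> = (\<Sum>\<eta>\<in>UNIV. \<Sum>l\<in>UNIV. \<Sum>\<mu>\<in>UNIV. Lb w (a', b') e \<eta> \<mu> l * t0 \<gamma> \<eta> * t' \<mu> \<beta> * x' l j)"
          by (rule sum.cong[OF refl], rule sum.swap)
        also have "\<dots> = (\<Sum>l\<in>UNIV. \<Sum>\<eta>\<in>UNIV. \<Sum>\<mu>\<in>UNIV. Lb w (a', b') e \<eta> \<mu> l * t0 \<gamma> \<eta> * t' \<mu> \<beta> * x' l j)"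
          by (rule sum.swap)
        finally show ?thesis by (simp add: sum_distrib_right)
      qed
      then show ?thesis by (simp only:) blast
    qed
    also have "\<dots> \<longleftrightarrow> (\<forall>\<gamma> \<beta> l. (\<Sum>j\<in>UNIV. Lb w (a, b) e \<gamma> \<beta> j * x0 j l) = ?H \<gamma> \<beta> l)"
      by (simp only: solve_right[OF dcoord_x_inverse])
    finally show ?thesis .
  qed
  have 2: "(\<forall>j i. compatible (unit_x j) (unit_x i)) \<longleftrightarrow> (\<forall>i j r.
        (\<Sum>m\<in>UNIV. Lm w (a, b) e m i j * x' r m) =
        (\<Sum>p\<in>UNIV. \<Sum>q\<in>UNIV. Lm w (a', b') e r p q * x' p i * x' q j)
        + d2coord b b' (base_x e) r i j)"
  proof -
    have "(\<forall>j i. compatible (unit_x j) (unit_x i)) \<longleftrightarrow> (\<forall>j i r.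
        (\<Sum>m\<in>UNIV. x' r m * Lm w (a, b) e m i j) =
        (\<Sum>p\<in>UNIV. \<Sum>q\<in>UNIV. Lm w (a', b') e r p q * x' p i * x' q j)
        + d2coord b b' (base_x e) r j i)"
      unfolding coef_map_units block_units block_blocks coef_map_blocks frame_change_deriv_units
      by (simp add: vec_eq_iff)
    also have "\<dots> \<longleftrightarrow> (\<forall>j i r.
        (\<Sum>m\<in>UNIV. Lm w (a, b) e m i j * x' r m) =
        (\<Sum>p\<in>UNIV. \<Sum>q\<in>UNIV. Lm w (a', b') e r p q * x' p i * x' q j)
        + d2coord b b' (base_x e) r i j)"
      by (subst d2coord_x_symmetric) (simp only: mult.commute[of "dcoord _ _ _ _ _"])
    finally show ?thesis by blast
  qed
  have 3: "(\<forall>j i \<beta>. compatible (unit_x j) (unit_v i \<beta>)) \<longleftrightarrow> (\<forall>k \<beta> \<gamma> i j.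
        Lv w (a, b) e k \<beta> \<gamma> i j =
        (\<Sum>r\<in>UNIV. \<Sum>\<eta>\<in>UNIV. \<Sum>\<nu>\<in>UNIV. \<Sum>p\<in>UNIV. \<Sum>l\<in>UNIV.
           Lv w (a', b') e r \<eta> \<nu> p l * x0 k r * t' \<nu> \<gamma> * x' p i * t0 \<beta> \<eta> * x' l j)
        + (if \<beta> = \<gamma> then 1 else 0) *
          (\<Sum>r\<in>UNIV. x0 k r * d2coord b b' (base_x e) r i j))"
  proof -
    let ?H = "\<lambda>j i \<beta> r \<nu>. (\<Sum>\<eta>\<in>UNIV. \<Sum>p\<in>UNIV. \<Sum>l\<in>UNIV. Lv w (a', b') e r \<eta> \<nu> p l * (x' p i * t0 \<beta> \<eta>) * x' l j)
        + d2coord b b' (base_x e) r j i * t0 \<beta> \<nu>"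
    have "(\<forall>j i \<beta>. compatible (unit_x j) (unit_v i \<beta>)) \<longleftrightarrow>
      (\<forall>j i \<beta> r \<nu>. (\<Sum>k\<in>UNIV. \<Sum>\<gamma>\<in>UNIV. x' r k * t0 \<gamma> \<nu> * Lv w (a, b) e k \<beta> \<gamma> i j) = ?H j i \<beta> r \<nu>)"
      unfolding coef_map_units block_units block_blocks coef_map_blocks frame_change_deriv_units
      by (simp add: vec_eq_iff)
    also have "\<dots> \<longleftrightarrow> (\<forall>j i \<beta> k \<gamma>. Lv w (a, b) e k \<beta> \<gamma> i j =
        (\<Sum>r\<in>UNIV. \<Sum>\<nu>\<in>UNIV. x0 k r * t' \<nu> \<gamma> * ?H j i \<beta> r \<nu>))"
      by (simp only: solve_left2[OF dcoord_x_inverse dcoord_t_inverse])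
    also have "\<dots> \<longleftrightarrow> (\<forall>j i \<beta> k \<gamma>. Lv w (a, b) e k \<beta> \<gamma> i j =
        (\<Sum>r\<in>UNIV. \<Sum>\<eta>\<in>UNIV. \<Sum>\<nu>\<in>UNIV. \<Sum>p\<in>UNIV. \<Sum>l\<in>UNIV.
           Lv w (a', b') e r \<eta> \<nu> p l * x0 k r * t' \<nu> \<gamma> * x' p i * t0 \<beta> \<eta> * x' l j)
        + (if \<beta> = \<gamma> then 1 else 0) *
          (\<Sum>r\<in>UNIV. x0 k r * d2coord b b' (base_x e) r i j))"
    proof -
      have "(\<Sum>r\<in>UNIV. \<Sum>\<nu>\<in>UNIV. x0 k r * t' \<nu> \<gamma> * ?H j i \<beta> r \<nu>) =
        (\<Sum>r\<in>UNIV. \<Sum>\<nu>\<in>UNIV. \<Sum>\<eta>\<in>UNIV. \<Sum>p\<in>UNIV. \<Sum>l\<in>UNIV.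
           Lv w (a', b') e r \<eta> \<nu> p l * x0 k r * t' \<nu> \<gamma> * x' p i * t0 \<beta> \<eta> * x' l j)
        + (\<Sum>r\<in>UNIV. \<Sum>\<nu>\<in>UNIV. (x0 k r * d2coord b b' (base_x e) r j i) * (t0 \<beta> \<nu> * t' \<nu> \<gamma>))"
        for j i \<beta> k \<gamma>
        by (simp add: distrib_left sum.distrib sum_distrib_left mult_ac)
      moreover have "(\<Sum>r\<in>UNIV. \<Sum>\<nu>\<in>UNIV. \<Sum>\<eta>\<in>UNIV. \<Sum>p\<in>UNIV. \<Sum>l\<in>UNIV.
           Lv w (a', b') e r \<eta> \<nu> p l * x0 k r * t' \<nu> \<gamma> * x' p i * t0 \<beta> \<eta> * x' l j) =
         (\<Sum>r\<in>UNIV. \<Sum>\<eta>\<in>UNIV. \<Sum>\<nu>\<in>UNIV. \<Sum>p\<in>UNIV. \<Sum>l\<in>UNIV.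
           Lv w (a', b') e r \<eta> \<nu> p l * x0 k r * t' \<nu> \<gamma> * x' p i * t0 \<beta> \<eta> * x' l j)"
        for j i \<beta> k \<gamma>
        by (rule sum.cong[OF refl], rule sum.swap)
      \<comment> \<open>Here the roles are exchanged compared with \<open>Gv\<close>:
        \<open>t0\<close> meets \<open>t'\<close> and gives the delta, while \<open>x0\<close> stays
        with the second derivative.\<close>
      moreover have "(\<Sum>r\<in>UNIV. \<Sum>\<nu>\<in>UNIV. (x0 k r * d2coord b b' (base_x e) r j i) * (t0 \<beta> \<nu> * t' \<nu> \<gamma>)) =
        (if \<beta> = \<gamma> then 1 else 0) * (\<Sum>r\<in>UNIV. x0 k r * d2coord b b' (base_x e) r i j)"
        for j i \<beta> k \<gamma>
        by (simp only: sum_distrib_left[symmetric] sum_distrib_right[symmetric] dcoord_t_inverse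
            d2coord_x_symmetric[of _ j i]) (rule mult.commute)
      ultimately show ?thesis by simp
    qed
    finally show ?thesis by blast
  qed
  show ?thesis unfolding 1 2 3 rules_hM_def Let_def by simp
qed

text \<open>Vertical directions do not move the base point, so the frame change has no derivative
  there and all three rules are tensorial.\<close>

lemma compatible_v:
  "(\<forall>j \<gamma> \<beta>. compatible (unit_v j \<gamma>) (unit_t \<beta>)) \<and> (\<forall>j \<gamma> i. compatible (unit_v j \<gamma>) (unit_x i)) \<and>
    (\<forall>j \<gamma> i \<beta>. compatible (unit_v j \<gamma>) (unit_v i \<beta>)) \<longleftrightarrow> rules_v w (a, b) (a', b') e"
proof -
  have 1: "(\<forall>j \<gamma> \<beta>. compatible (unit_v j \<gamma>) (unit_t \<beta>)) \<longleftrightarrow> (\<forall>\<gamma> \<alpha> \<beta> i.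
        Cb w (a, b) e \<gamma> \<alpha> \<beta> i =
        (\<Sum>\<mu>\<in>UNIV. \<Sum>\<delta>\<in>UNIV. \<Sum>\<epsilon>\<in>UNIV. \<Sum>j\<in>UNIV.
           Cb w (a', b') e \<mu> \<delta> \<epsilon> j * t0 \<gamma> \<mu> * t' \<epsilon> \<beta> * x' j i * t0 \<alpha> \<delta>))"
  proof -
    have "(\<forall>j \<gamma> \<beta>. compatible (unit_v j \<gamma>) (unit_t \<beta>)) \<longleftrightarrow>
      (\<forall>i \<alpha> \<beta> \<mu>. (\<Sum>\<gamma>\<in>UNIV. t' \<mu> \<gamma> * Cb w (a, b) e \<gamma> \<alpha> \<beta> i) =
        (\<Sum>\<delta>\<in>UNIV. \<Sum>\<epsilon>\<in>UNIV. \<Sum>j\<in>UNIV. Cb w (a', b') e \<mu> \<delta> \<epsilon> j * t' \<epsilon> \<beta> * (x' j i * t0 \<alpha> \<delta>)))"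
      unfolding coef_map_units block_units block_blocks coef_map_blocks frame_change_deriv_units
      by (simp add: vec_eq_iff)
    also have "\<dots> \<longleftrightarrow> (\<forall>i \<alpha> \<beta> \<gamma>. Cb w (a, b) e \<gamma> \<alpha> \<beta> i = (\<Sum>\<mu>\<in>UNIV. t0 \<gamma> \<mu> *
        (\<Sum>\<delta>\<in>UNIV. \<Sum>\<epsilon>\<in>UNIV. \<Sum>j\<in>UNIV. Cb w (a', b') e \<mu> \<delta> \<epsilon> j * t' \<epsilon> \<beta> * (x' j i * t0 \<alpha> \<delta>))))"
      by (simp only: solve_left[OF dcoord_t_inverse])
    also have "\<dots> \<longleftrightarrow> (\<forall>\<gamma> \<alpha> \<beta> i. Cb w (a, b) e \<gamma> \<alpha> \<beta> i =
        (\<Sum>\<mu>\<in>UNIV. \<Sum>\<delta>\<in>UNIV. \<Sum>\<epsilon>\<in>UNIV. \<Sum>j\<in>UNIV.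
           Cb w (a', b') e \<mu> \<delta> \<epsilon> j * t0 \<gamma> \<mu> * t' \<epsilon> \<beta> * x' j i * t0 \<alpha> \<delta>))"
    proof -
      have "(\<Sum>\<mu>\<in>UNIV. t0 \<gamma> \<mu> *
        (\<Sum>\<delta>\<in>UNIV. \<Sum>\<epsilon>\<in>UNIV. \<Sum>j\<in>UNIV. Cb w (a', b') e \<mu> \<delta> \<epsilon> j * t' \<epsilon> \<beta> * (x' j i * t0 \<alpha> \<delta>))) =
        (\<Sum>\<mu>\<in>UNIV. \<Sum>\<delta>\<in>UNIV. \<Sum>\<epsilon>\<in>UNIV. \<Sum>j\<in>UNIV.
           Cb w (a', b') e \<mu> \<delta> \<epsilon> j * t0 \<gamma> \<mu> * t' \<epsilon> \<beta> * x' j i * t0 \<alpha> \<delta>)" for i \<alpha> \<beta> \<gamma>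
        by (simp add: sum_distrib_left mult_ac)
      then show ?thesis by (simp only:) blast
    qed
    finally show ?thesis .
  qed
  have 2: "(\<forall>j \<gamma> i. compatible (unit_v j \<gamma>) (unit_x i)) \<longleftrightarrow> (\<forall>k \<alpha> i j.
        Cm w (a, b) e k \<alpha> i j =
        (\<Sum>s\<in>UNIV. \<Sum>\<beta>\<in>UNIV. \<Sum>p\<in>UNIV. \<Sum>r\<in>UNIV.
           Cm w (a', b') e s \<beta> p r * x0 k s * x' p i * x' r j * t0 \<alpha> \<beta>))"
  proof -
    have "(\<forall>j \<gamma> i. compatible (unit_v j \<gamma>) (unit_x i)) \<longleftrightarrow>
      (\<forall>j \<alpha> i s. (\<Sum>k\<in>UNIV. x' s k * Cm w (a, b) e k \<alpha> i j) =
        (\<Sum>\<beta>\<in>UNIV. \<Sum>p\<in>UNIV. \<Sum>r\<in>UNIV. Cm w (a', b') e s \<beta> p r * x' p i * (x' r j * t0 \<alpha> \<beta>)))"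
      unfolding coef_map_units block_units block_blocks coef_map_blocks frame_change_deriv_units
      by (simp add: vec_eq_iff)
    also have "\<dots> \<longleftrightarrow> (\<forall>j \<alpha> i k. Cm w (a, b) e k \<alpha> i j = (\<Sum>s\<in>UNIV. x0 k s *
        (\<Sum>\<beta>\<in>UNIV. \<Sum>p\<in>UNIV. \<Sum>r\<in>UNIV. Cm w (a', b') e s \<beta> p r * x' p i * (x' r j * t0 \<alpha> \<beta>))))"
      by (simp only: solve_left[OF dcoord_x_inverse])
    also have "\<dots> \<longleftrightarrow> (\<forall>k \<alpha> i j. Cm w (a, b) e k \<alpha> i j =
        (\<Sum>s\<in>UNIV. \<Sum>\<beta>\<in>UNIV. \<Sum>p\<in>UNIV. \<Sum>r\<in>UNIV.
           Cm w (a', b') e s \<beta> p r * x0 k s * x' p i * x' r j * t0 \<alpha> \<beta>))"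
      by (simp add: sum_distrib_left mult_ac) blast
    finally show ?thesis .
  qed
  have 3: "(\<forall>j \<gamma> i \<beta>. compatible (unit_v j \<gamma>) (unit_v i \<beta>)) \<longleftrightarrow> (\<forall>k \<beta> \<alpha> \<gamma> i j.
        Cv w (a, b) e k \<beta> \<alpha> \<gamma> i j =
        (\<Sum>r\<in>UNIV. \<Sum>\<mu>\<in>UNIV. \<Sum>\<nu>\<in>UNIV. \<Sum>\<epsilon>\<in>UNIV. \<Sum>p\<in>UNIV. \<Sum>q\<in>UNIV.
           Cv w (a', b') e r \<mu> \<nu> \<epsilon> p q
           * x0 k r * t' \<epsilon> \<gamma> * x' p i * t0 \<beta> \<mu> * x' q j * t0 \<alpha> \<nu>))"
  proof -
    let ?H = "\<lambda>j \<alpha> i \<beta> r \<epsilon>. \<Sum>\<mu>\<in>UNIV. \<Sum>\<nu>\<in>UNIV. \<Sum>p\<in>UNIV. \<Sum>q\<in>UNIV.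
           Cv w (a', b') e r \<mu> \<nu> \<epsilon> p q * (x' p i * t0 \<beta> \<mu>) * (x' q j * t0 \<alpha> \<nu>)"
    have "(\<forall>j \<gamma> i \<beta>. compatible (unit_v j \<gamma>) (unit_v i \<beta>)) \<longleftrightarrow>
      (\<forall>j \<alpha> i \<beta> r \<epsilon>. (\<Sum>k\<in>UNIV. \<Sum>\<gamma>\<in>UNIV. x' r k * t0 \<gamma> \<epsilon> * Cv w (a, b) e k \<beta> \<alpha> \<gamma> i j) = ?H j \<alpha> i \<beta> r \<epsilon>)"
      unfolding coef_map_units block_units block_blocks coef_map_blocks frame_change_deriv_units
      by (simp add: vec_eq_iff)
    also have "\<dots> \<longleftrightarrow> (\<forall>j \<alpha> i \<beta> k \<gamma>. Cv w (a, b) e k \<beta> \<alpha> \<gamma> i j =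
        (\<Sum>r\<in>UNIV. \<Sum>\<epsilon>\<in>UNIV. x0 k r * t' \<epsilon> \<gamma> * ?H j \<alpha> i \<beta> r \<epsilon>))"
      by (simp only: solve_left2[OF dcoord_x_inverse dcoord_t_inverse])
    also have "\<dots> \<longleftrightarrow> (\<forall>j \<alpha> i \<beta> k \<gamma>. Cv w (a, b) e k \<beta> \<alpha> \<gamma> i j =
        (\<Sum>r\<in>UNIV. \<Sum>\<mu>\<in>UNIV. \<Sum>\<nu>\<in>UNIV. \<Sum>\<epsilon>\<in>UNIV. \<Sum>p\<in>UNIV. \<Sum>q\<in>UNIV.
           Cv w (a', b') e r \<mu> \<nu> \<epsilon> p q
           * x0 k r * t' \<epsilon> \<gamma> * x' p i * t0 \<beta> \<mu> * x' q j * t0 \<alpha> \<nu>))"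
    proof -
      let ?f = "\<lambda>j \<alpha> i \<beta> k \<gamma> r \<mu> \<nu> \<epsilon> p q. Cv w (a', b') e r \<mu> \<nu> \<epsilon> p q
           * x0 k r * t' \<epsilon> \<gamma> * x' p i * t0 \<beta> \<mu> * x' q j * t0 \<alpha> \<nu>"
      have "(\<Sum>r\<in>UNIV. \<Sum>\<epsilon>\<in>UNIV. x0 k r * t' \<epsilon> \<gamma> * ?H j \<alpha> i \<beta> r \<epsilon>) =
        (\<Sum>r\<in>UNIV. \<Sum>\<mu>\<in>UNIV. \<Sum>\<nu>\<in>UNIV. \<Sum>\<epsilon>\<in>UNIV. \<Sum>p\<in>UNIV. \<Sum>q\<in>UNIV. ?f j \<alpha> i \<beta> k \<gamma> r \<mu> \<nu> \<epsilon> p q)"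
        for j \<alpha> i \<beta> k \<gamma>
      proof -
        have "(\<Sum>r\<in>UNIV. \<Sum>\<epsilon>\<in>UNIV. x0 k r * t' \<epsilon> \<gamma> * ?H j \<alpha> i \<beta> r \<epsilon>) =
          (\<Sum>r\<in>UNIV. \<Sum>\<epsilon>\<in>UNIV. \<Sum>\<mu>\<in>UNIV. \<Sum>\<nu>\<in>UNIV. \<Sum>p\<in>UNIV. \<Sum>q\<in>UNIV. ?f j \<alpha> i \<beta> k \<gamma> r \<mu> \<nu> \<epsilon> p q)"
          by (simp add: sum_distrib_left mult_ac)
        also have "\<dots> = (\<Sum>r\<in>UNIV. \<Sum>\<mu>\<in>UNIV. \<Sum>\<epsilon>\<in>UNIV. \<Sum>\<nu>\<in>UNIV. \<Sum>p\<in>UNIV. \<Sum>q\<in>UNIV. ?f j \<alpha> i \<beta> k \<gamma> r \<mu> \<nu> \<epsilon> p q)"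
          by (rule sum.cong[OF refl], rule sum.swap)
        also have "\<dots> = (\<Sum>r\<in>UNIV. \<Sum>\<mu>\<in>UNIV. \<Sum>\<nu>\<in>UNIV. \<Sum>\<epsilon>\<in>UNIV. \<Sum>p\<in>UNIV. \<Sum>q\<in>UNIV. ?f j \<alpha> i \<beta> k \<gamma> r \<mu> \<nu> \<epsilon> p q)"
          by (rule sum.cong[OF refl], rule sum.cong[OF refl], rule sum.swap)
        finally show ?thesis .
      qed
      then show ?thesis by (simp only:)
    qed
    finally show ?thesis by blast
  qed
  show ?thesis unfolding 1 2 3 rules_v_def Let_def by simp
qed

text \<open>Both sides of the identity are bilinear in \<open>u\<close> and \<open>v\<close>, so
  unit pairs suffice; grouped by the kind of the direction \<open>u\<close> they give the three sets
  of rules.\<close>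

lemma change_iff_rules:
  "(\<forall>u v. F.frame_change (a, b) (a', b') e (G u v) =
      G' (F.frame_change (a, b) (a', b') e u) (F.frame_change (a, b) (a', b') e v)
      + mderiv (jchart a b) (\<lambda>r. F.frame_change (a, b) (a', b') r v) e (shear (- 1) (a, b) e u)) \<longleftrightarrow>
    rules_hT w (a, b) (a', b') e \<and> rules_hM w (a, b) (a', b') e \<and> rules_v w (a, b) (a', b') e"
proof -
  have fc: "F.frame_change (a, b) (a', b') e = block"
    using frame_change_eq[OF a b e] by blast
  \<comment> \<open>The shear alters only the fibre part of the direction, which the derivative of
    the frame change does not see.\<close>
  have fd: "mderiv (jchart a b) (\<lambda>r. F.frame_change (a, b) (a', b') r v) e (shear (- 1) (a, b) e u) = fcd u v" for u v
    unfolding mderiv_frame_change[OF a b e] frame_change_deriv_def by (simp add: shear_def)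
  have bL: "bilinear (\<lambda>u v. block (G u v))"
    by (rule bilinear_compose_left[OF linear_frame_block bilinear_coef_map])
  have bR: "bilinear (\<lambda>u v. G' (block u) (block v) + fcd u v)"
    by (rule bilinear_add[OF bilinear_compose_right[OF linear_frame_block bilinear_coef_map]
          bilinear_frame_change_deriv])
  have "(\<forall>u v. compatible u v) \<longleftrightarrow> (\<lambda>u v. block (G u v)) = (\<lambda>u v. G' (block u) (block v) + fcd u v)"
    by (simp add: fun_eq_iff)
  also have "\<dots> \<longleftrightarrow> rules_hT w (a, b) (a', b') e \<and> rules_hM w (a, b) (a', b') e \<and> rules_v w (a, b) (a', b') e"
    unfolding bilinear_jet_eq_iff[OF bL bR] compatible_hT[symmetric] compatible_hM[symmetric] compatible_v[symmetric]
    by (simp only: conj_assoc)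
  finally show ?thesis unfolding fc fd .
qed

end

end

end

section \<open>Connections and their nine components\<close>

text \<open>Values off the chart domains are irrelevant to the condition. This allows
  \<open>conn_coef\<close> to be replaced by the map built from components that are cut off to
  zero.\<close>

lemma (in framed_atlas) christoffel_cong:
  assumes "christoffel G" "\<And>i q. i \<in> I \<Longrightarrow> q \<in> cdom i \<Longrightarrow> G i q = G' i q"
  shows "christoffel G'"
proof -
  have "msmooth A (cdom i) (\<lambda>q. G' i q u v)" if i: "i \<in> I" for i u v
  proof (rule msmooth_cong)
    show "msmooth A (cdom i) (\<lambda>q. G i q u v)"
      using assms(1) i unfolding christoffel_def by blast
  qed (use assms(2) i dom_open in auto)
  then show ?thesis
    using assms unfolding christoffel_def by simp
qed

definition proj_t :: "('p::finite, 'n::finite) jet_coord \<Rightarrow> ('p, 'n) jet_coord" where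
  "proj_t w = (fst w, 0, 0)"
definition proj_x :: "('p::finite, 'n::finite) jet_coord \<Rightarrow> ('p, 'n) jet_coord" where
  "proj_x w = (0, fst (snd w), 0)"
definition proj_y :: "('p::finite, 'n::finite) jet_coord \<Rightarrow> ('p, 'n) jet_coord" where
  "proj_y w = (0, 0, snd (snd w))"

lemmas proj_defs = proj_t_def proj_x_def proj_y_def

lemma linear_proj: "linear proj_t" "linear proj_x" "linear proj_y"
  by (rule linearI; simp add: proj_defs)+

definition block_preserving ::
  "(('p::finite, 'n::finite) jet_coord \<Rightarrow> ('p, 'n) jet_coord \<Rightarrow> ('p, 'n) jet_coord) \<Rightarrow> bool" where
  "block_preserving g \<longleftrightarrow> (\<forall>u v. g u (proj_t v) = proj_t (g u v)) \<and>
     (\<forall>u v. g u (proj_x v) = proj_x (g u v)) \<and> (\<forall>u v. g u (proj_y v) = proj_y (g u v))"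

lemma block_preserving_coef_map: "block_preserving (coef_map w c e)"
  by (simp add: block_preserving_def proj_defs coef_map_def vec_eq_iff)

lemma unit_sums:
  "(\<Sum>\<alpha>\<in>UNIV. k \<alpha> *\<^sub>R unit_t \<alpha>) = (\<chi> \<alpha>. k \<alpha>, 0, 0)"
  "(\<Sum>i\<in>UNIV. l i *\<^sub>R unit_x i) = (0, \<chi> i. l i, 0)"
  "(\<Sum>i\<in>UNIV. \<Sum>\<alpha>\<in>UNIV. m i \<alpha> *\<^sub>R unit_v i \<alpha>) = (0, 0, \<chi> i \<alpha>. m i \<alpha>)"
  by (simp_all add: prod_eq_iff fst_sum snd_sum unit_defs vec_eq_iff delta_simps cong: if_cong)

context jet_connection
begin

text \<open>The cut-off enforces the convention of \<open>supported_on_charts\<close>. From each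
  value on unit vectors a single block is kept, which loses information unless the map preserves the
  blocks.\<close>

definition comps_of ::
  "(('t, 'm, 'p, 'n) cpair \<Rightarrow> ('t, 'm) jet_point \<Rightarrow> ('p, 'n) jet_coord \<Rightarrow> ('p, 'n) jet_coord \<Rightarrow> ('p, 'n) jet_coord)
    \<Rightarrow> ('t, 'm, 'p, 'n) ncomp" where
  "comps_of G0 = (let G = (\<lambda>c e u v. if c \<in> AT \<times> AM \<and> e \<in> F.cdom c then G0 c e u v else 0) in
     \<lparr>Gb = (\<lambda>c e \<alpha> \<beta> \<gamma>. fst (G c e (unit_t \<gamma>) (unit_t \<beta>)) $ \<alpha>),
      Gm = (\<lambda>c e k i \<gamma>. fst (snd (G c e (unit_t \<gamma>) (unit_x i))) $ k),
      Gv = (\<lambda>c e k \<beta> \<alpha> i \<gamma>. snd (snd (G c e (unit_t \<gamma>) (unit_v i \<beta>))) $ k $ \<alpha>),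
      Lb = (\<lambda>c e \<alpha> \<beta> j. fst (G c e (unit_x j) (unit_t \<beta>)) $ \<alpha>),
      Lm = (\<lambda>c e k i j. fst (snd (G c e (unit_x j) (unit_x i))) $ k),
      Lv = (\<lambda>c e k \<beta> \<alpha> i j. snd (snd (G c e (unit_x j) (unit_v i \<beta>))) $ k $ \<alpha>),
      Cb = (\<lambda>c e \<alpha> \<gamma> \<beta> j. fst (G c e (unit_v j \<gamma>) (unit_t \<beta>)) $ \<alpha>),
      Cm = (\<lambda>c e k \<gamma> i j. fst (snd (G c e (unit_v j \<gamma>) (unit_x i))) $ k),
      Cv = (\<lambda>c e k \<beta> \<gamma> \<alpha> i j. snd (snd (G c e (unit_v j \<gamma>) (unit_v i \<beta>))) $ k $ \<alpha>)\<rparr>)"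

lemma supported_comps_of: "supported_on_charts AT AM (comps_of G)"
  unfolding supported_on_charts_def comps_of_def Let_def by auto

text \<open>A value fixed by one of the projections has its other two blocks zero, so the nine
  families of entries retain every value on unit vectors.\<close>

lemma coef_map_comps_of:
  assumes c: "c \<in> AT \<times> AM" "e \<in> F.cdom c" and G: "bilinear (G c e)" "block_preserving (G c e)"
  shows "coef_map (comps_of G) c e = G c e"
proof -
  have p: "proj_t (unit_t \<alpha>) = unit_t \<alpha>" "proj_x (unit_x i) = unit_x i" "proj_y (unit_v i \<alpha>) = unit_v i \<alpha>"
    for i :: 'n and \<alpha> :: 'p by (simp_all add: proj_defs unit_defs)
  have fixed: "x = proj_t x \<Longrightarrow> fst (snd x) = 0 \<and> snd (snd x) = 0" "x = proj_x x \<Longrightarrow> fst x = 0 \<and> snd (snd x) = 0"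
    "x = proj_y x \<Longrightarrow> fst x = 0 \<and> fst (snd x) = 0" for x :: "('p, 'n) jet_coord"
    by (simp_all add: proj_defs prod_eq_iff)
  have "G c e u (unit_t \<alpha>) = proj_t (G c e u (unit_t \<alpha>))" "G c e u (unit_x i) = proj_x (G c e u (unit_x i))"
    "G c e u (unit_v i \<alpha>) = proj_y (G c e u (unit_v i \<alpha>))" for u i \<alpha>
    using G(2) p unfolding block_preserving_def by metis+
  then have z: "fst (snd (G c e u (unit_t \<alpha>))) = 0" "snd (snd (G c e u (unit_t \<alpha>))) = 0"
    "fst (G c e u (unit_x i)) = 0" "snd (snd (G c e u (unit_x i))) = 0"
    "fst (G c e u (unit_v i \<alpha>)) = 0" "fst (snd (G c e u (unit_v i \<alpha>))) = 0" for u i \<alpha>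
    using fixed by blast+
  show ?thesis
    unfolding bilinear_jet_eq_iff[OF bilinear_coef_map G(1)] coef_map_units
    using c by (simp add: comps_of_def prod_eq_iff z)
qed

text \<open>Components supported on their charts are recovered from their bilinear maps by
  \<open>comps_of\<close>, which reads those maps on the chart domains only.\<close>

lemma components_eqI:
  fixes w w' :: "('t, 'm, 'p, 'n) ncomp"
  assumes w: "supported_on_charts AT AM w" "supported_on_charts AT AM w'"
    and eq: "\<And>c e. c \<in> AT \<times> AM \<Longrightarrow> e \<in> F.cdom c \<Longrightarrow> coef_map w c e = coef_map w' c e"
  shows "w = w'"
proof -
  have u: "w'' = comps_of (coef_map w'')" if "supported_on_charts AT AM w''" for w'' :: "('t, 'm, 'p, 'n) ncomp"
  proof (rule nine_components.equality)
    show "Gb w'' = Gb (comps_of (coef_map w''))" "Gm w'' = Gm (comps_of (coef_map w''))"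
      "Gv w'' = Gv (comps_of (coef_map w''))" "Lb w'' = Lb (comps_of (coef_map w''))"
      "Lm w'' = Lm (comps_of (coef_map w''))" "Lv w'' = Lv (comps_of (coef_map w''))"
      "Cb w'' = Cb (comps_of (coef_map w''))" "Cm w'' = Cm (comps_of (coef_map w''))"
      "Cv w'' = Cv (comps_of (coef_map w''))"
      using that unfolding supported_on_charts_def
      by (auto simp: comps_of_def fun_eq_iff coef_map_units)
  qed simp
  have "comps_of (coef_map w) = comps_of (coef_map w')"
    unfolding comps_of_def Let_def using eq by (simp cong: if_cong conj_cong)
  then show ?thesis using u[OF w(1)] u[OF w(2)] by simp
qed

section \<open>The adapted basis, its distributions and projections in frame coordinates\<close>

lemma basis_v_eq: "basis_v AT AM c i \<alpha> = F.frame c (unit_v i \<alpha>)"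
proof
  fix e
  have "shear (- 1) c e (unit_v i \<alpha>) = unit_v i \<alpha>" by (simp add: shear_def unit_defs vec_eq_iff)
  then show "basis_v AT AM c i \<alpha> e = F.frame c (unit_v i \<alpha>) e"
    by (simp add: basis_v_def F.frame_def unit_v_def)
qed

lemma coord_vec_shear:
  assumes c: "c \<in> AT \<times> AM" and s: "shear (- 1) c e u = u - (\<Sum>j\<in>UNIV. \<Sum>\<beta>\<in>UNIV. k j \<beta> *\<^sub>R unit_v j \<beta>)"
  shows "F.frame c u e d = coord_vec jatlas (jet_chart AT AM c) u e d
    - (\<Sum>j\<in>UNIV. \<Sum>\<beta>\<in>UNIV. k j \<beta> *\<^sub>R basis_v AT AM c j \<beta> e d)"
proof -
  have lin: "linear (\<lambda>w. coord_vec jatlas (jet_chart AT AM c) w e d)"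
    using c F.ch_in by (intro E.linear_coord_vec) auto
  show ?thesis
    unfolding F.frame_def s basis_v_def unit_v_def[symmetric]
    by (simp add: linear_diff[OF lin] linear_sum[OF lin] linear_scale[OF lin])
qed

lemma basis_t_eq:
  assumes "c \<in> AT \<times> AM"
  shows "basis_t AT AM Mc c \<alpha> = F.frame c (unit_t \<alpha>)"
proof (intro ext)
  fix e d
  have "shear (- 1) c e (unit_t \<alpha>) = unit_t \<alpha> - (\<Sum>j\<in>UNIV. \<Sum>\<beta>\<in>UNIV. Mc c e j \<beta> \<alpha> *\<^sub>R unit_v j \<beta>)"
    unfolding unit_sums by (simp add: shear_def unit_t_def vec_eq_iff delta_simps cong: if_cong)
  from coord_vec_shear[OF assms this] show "basis_t AT AM Mc c \<alpha> e d = F.frame c (unit_t \<alpha>) e d"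
    by (simp add: basis_t_def unit_t_def)
qed

lemma basis_x_eq:
  assumes "c \<in> AT \<times> AM"
  shows "basis_x AT AM Nc c i = F.frame c (unit_x i)"
proof (intro ext)
  fix e d
  have "shear (- 1) c e (unit_x i) = unit_x i - (\<Sum>j\<in>UNIV. \<Sum>\<beta>\<in>UNIV. Nc c e j \<beta> i *\<^sub>R unit_v j \<beta>)"
    unfolding unit_sums by (simp add: shear_def unit_x_def vec_eq_iff delta_simps cong: if_cong)
  from coord_vec_shear[OF assms this] show "basis_x AT AM Nc c i e d = F.frame c (unit_x i) e d"
    by (simp add: basis_x_def unit_x_def)
qed

lemma frame_sums:
  assumes "c \<in> AT \<times> AM"
  shows "(\<lambda>d. \<Sum>\<alpha>\<in>UNIV. k \<alpha> *\<^sub>R F.frame c (unit_t \<alpha>) e d) = F.frame c (\<chi> \<alpha>. k \<alpha>, 0, 0) e"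
    "(\<lambda>d. \<Sum>i\<in>UNIV. l i *\<^sub>R F.frame c (unit_x i) e d) = F.frame c (0, \<chi> i. l i, 0) e"
    "(\<lambda>d. \<Sum>i\<in>UNIV. \<Sum>\<alpha>\<in>UNIV. m i \<alpha> *\<^sub>R F.frame c (unit_v i \<alpha>) e d) = F.frame c (0, 0, \<chi> i \<alpha>. m i \<alpha>) e"
  unfolding unit_sums[symmetric]
  by (simp_all add: fun_eq_iff linear_sum[OF F.linear_frame[OF assms]] linear_scale[OF F.linear_frame[OF assms]])

lemma frame_inject: "c \<in> AT \<times> AM \<Longrightarrow> e \<in> F.cdom c \<Longrightarrow> F.frame c u e = F.frame c v e \<longleftrightarrow> u = v"
  using F.coords_frame by (metis F.coords_def)

lemma conn_local_frame:
  assumes lc: "linear_connection jatlas nab" and c: "c \<in> AT \<times> AM" "e \<in> F.cdom c"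
  shows "conn_local jatlas nab (F.frame c u) (F.frame c v) e = F.frame c (F.conn_coef nab c e u v) e"
proof -
  obtain V E where "e \<in> V" "F.extends_frame c V E" using F.frame_extension[OF c] .
  note VE = this(1) F.extends_frameD(3,5)[OF this(2)]
  have "conn_local jatlas nab (F.frame c u) (F.frame c v) e = nab (E u) (E v) e"
    by (rule F.conn_local_eq[OF lc VE(3)[OF VE(1)] VE(3)[OF VE(1)]])
  also have "\<dots> = F.frame c (F.coords c (nab (E u) (E v)) e) e"
    using F.frame_coords[OF F.VF_tangent[OF F.conn_VF[OF lc VE(2) VE(2)]] c] by simp
  also have "F.coords c (nab (E u) (E v)) e = F.conn_coef nab c e u v"
    using F.conn_coef_eq[OF lc VE(3)[OF VE(1)] VE(3)[OF VE(1)]] by simp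
  finally show ?thesis .
qed

text \<open>At a point of the chart frame vectors determine their coordinates, so the nine defining
  equations compare two bilinear maps on the nine families of unit pairs.\<close>

lemma is_local_components_iff:
  assumes lc: "linear_connection jatlas nab"
  shows "is_local_components AT AM Mc Nc nab w \<longleftrightarrow> supported_on_charts AT AM w \<and>
    (\<forall>c\<in>AT \<times> AM. \<forall>e\<in>F.cdom c. F.conn_coef nab c e = coef_map w c e)"
  unfolding is_local_components_def Let_def
proof (intro conj_cong ball_cong refl)
  fix c e assume c: "c \<in> AT \<times> AM" "e \<in> F.cdom c"
  note eqs = basis_t_eq[OF c(1)] basis_x_eq[OF c(1)] basis_v_eq conn_local_frame[OF lc c]
    frame_sums[OF c(1)] frame_inject[OF c]
  show "((\<forall>\<gamma> \<beta>. conn_local jatlas nab (basis_t AT AM Mc c \<gamma>) (basis_t AT AM Mc c \<beta>) e =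
          (\<lambda>d. \<Sum>\<alpha>\<in>UNIV. Gb w c e \<alpha> \<beta> \<gamma> *\<^sub>R basis_t AT AM Mc c \<alpha> e d)) \<and>
        (\<forall>\<gamma> i. conn_local jatlas nab (basis_t AT AM Mc c \<gamma>) (basis_x AT AM Nc c i) e =
          (\<lambda>d. \<Sum>k\<in>UNIV. Gm w c e k i \<gamma> *\<^sub>R basis_x AT AM Nc c k e d)) \<and>
        (\<forall>\<gamma> i \<beta>. conn_local jatlas nab (basis_t AT AM Mc c \<gamma>) (basis_v AT AM c i \<beta>) e =
          (\<lambda>d. \<Sum>k\<in>UNIV. \<Sum>\<alpha>\<in>UNIV. Gv w c e k \<beta> \<alpha> i \<gamma> *\<^sub>R basis_v AT AM c k \<alpha> e d)) \<and>
        (\<forall>j \<beta>. conn_local jatlas nab (basis_x AT AM Nc c j) (basis_t AT AM Mc c \<beta>) e =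
          (\<lambda>d. \<Sum>\<alpha>\<in>UNIV. Lb w c e \<alpha> \<beta> j *\<^sub>R basis_t AT AM Mc c \<alpha> e d)) \<and>
        (\<forall>j i. conn_local jatlas nab (basis_x AT AM Nc c j) (basis_x AT AM Nc c i) e =
          (\<lambda>d. \<Sum>k\<in>UNIV. Lm w c e k i j *\<^sub>R basis_x AT AM Nc c k e d)) \<and>
        (\<forall>j i \<beta>. conn_local jatlas nab (basis_x AT AM Nc c j) (basis_v AT AM c i \<beta>) e =
          (\<lambda>d. \<Sum>k\<in>UNIV. \<Sum>\<alpha>\<in>UNIV. Lv w c e k \<beta> \<alpha> i j *\<^sub>R basis_v AT AM c k \<alpha> e d)) \<and>
        (\<forall>j \<gamma> \<beta>. conn_local jatlas nab (basis_v AT AM c j \<gamma>) (basis_t AT AM Mc c \<beta>) e =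
          (\<lambda>d. \<Sum>\<alpha>\<in>UNIV. Cb w c e \<alpha> \<gamma> \<beta> j *\<^sub>R basis_t AT AM Mc c \<alpha> e d)) \<and>
        (\<forall>j \<gamma> i. conn_local jatlas nab (basis_v AT AM c j \<gamma>) (basis_x AT AM Nc c i) e =
          (\<lambda>d. \<Sum>k\<in>UNIV. Cm w c e k \<gamma> i j *\<^sub>R basis_x AT AM Nc c k e d)) \<and>
        (\<forall>j \<gamma> i \<beta>. conn_local jatlas nab (basis_v AT AM c j \<gamma>) (basis_v AT AM c i \<beta>) e =
          (\<lambda>d. \<Sum>k\<in>UNIV. \<Sum>\<alpha>\<in>UNIV. Cv w c e k \<beta> \<gamma> \<alpha> i j *\<^sub>R basis_v AT AM c k \<alpha> e d))) \<longleftrightarrow>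
      F.conn_coef nab c e = coef_map w c e"
    unfolding eqs bilinear_jet_eq_iff[OF F.conn_coef_bilinear[OF lc c] bilinear_coef_map] coef_map_units
    by (rule refl)
qed

text \<open>The distributions admit combinations in any chart around the point; since frame changes
  are block diagonal, one fixed chart already gives all of them.\<close>

lemma dist_eq:
  assumes c: "c \<in> AT \<times> AM" "e \<in> F.cdom c"
  shows "dist_T AT AM Mc e = range (\<lambda>w. F.frame c (proj_t w) e)"
    "dist_M AT AM Nc e = range (\<lambda>w. F.frame c (proj_x w) e)"
    "dist_V AT AM e = range (\<lambda>w. F.frame c (proj_y w) e)"
proof -
  have chg: "F.frame c' u e = F.frame c (F.frame_change c' c e u) e"
    if "c' \<in> AT \<times> AM" "e \<in> F.cdom c'" for c' u
    using F.frame_frame_change[OF that(1) c(1) that(2) c(2)] by simp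
  have fc: "F.frame_change c' c e (proj_t w) = proj_t (F.frame_change c' c e w)"
    "F.frame_change c' c e (proj_x w) = proj_x (F.frame_change c' c e w)"
    "F.frame_change c' c e (proj_y w) = proj_y (F.frame_change c' c e w)"
    if "c' \<in> AT \<times> AM" "e \<in> F.cdom c'" for c' w
    using frame_change_eq[of "fst c'" "fst c" "snd c'" "snd c" e] c that
    by (auto simp: frame_block_def proj_defs vec_eq_iff mem_Times_iff)
  show "dist_T AT AM Mc e = range (\<lambda>w. F.frame c (proj_t w) e)"
  proof (intro equalityI subsetI)
    fix u assume "u \<in> dist_T AT AM Mc e"
    then obtain c' k where c': "c' \<in> AT \<times> AM" "e \<in> F.cdom c'"
      and u: "u = (\<lambda>d. \<Sum>\<alpha>\<in>UNIV. k \<alpha> *\<^sub>R basis_t AT AM Mc c' \<alpha> e d)"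
      unfolding dist_T_def by blast
    have "u = F.frame c' (proj_t (\<chi> \<alpha>. k \<alpha>, 0, 0)) e"
      unfolding u basis_t_eq[OF c'(1)] frame_sums[OF c'(1)] by (simp add: proj_defs)
    then show "u \<in> range (\<lambda>w. F.frame c (proj_t w) e)" using chg[OF c'] fc[OF c'] by auto
  next
    fix u assume "u \<in> range (\<lambda>w. F.frame c (proj_t w) e)"
    then obtain w where "u = F.frame c (\<chi> \<alpha>. fst w $ \<alpha>, 0, 0) e" by (auto simp: proj_defs)
    then have "u = (\<lambda>d. \<Sum>\<alpha>\<in>UNIV. fst w $ \<alpha> *\<^sub>R basis_t AT AM Mc c \<alpha> e d)"
      unfolding basis_t_eq[OF c(1)] frame_sums[OF c(1)] .
    then show "u \<in> dist_T AT AM Mc e" unfolding dist_T_def using c by blast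
  qed
  show "dist_M AT AM Nc e = range (\<lambda>w. F.frame c (proj_x w) e)"
  proof (intro equalityI subsetI)
    fix u assume "u \<in> dist_M AT AM Nc e"
    then obtain c' k where c': "c' \<in> AT \<times> AM" "e \<in> F.cdom c'"
      and u: "u = (\<lambda>d. \<Sum>i\<in>UNIV. k i *\<^sub>R basis_x AT AM Nc c' i e d)"
      unfolding dist_M_def by blast
    have "u = F.frame c' (proj_x (0, \<chi> i. k i, 0)) e"
      unfolding u basis_x_eq[OF c'(1)] frame_sums[OF c'(1)] by (simp add: proj_defs)
    then show "u \<in> range (\<lambda>w. F.frame c (proj_x w) e)" using chg[OF c'] fc[OF c'] by auto
  next
    fix u assume "u \<in> range (\<lambda>w. F.frame c (proj_x w) e)"
    then obtain w where "u = F.frame c (0, \<chi> i. fst (snd w) $ i, 0) e" by (auto simp: proj_defs)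
    then have "u = (\<lambda>d. \<Sum>i\<in>UNIV. fst (snd w) $ i *\<^sub>R basis_x AT AM Nc c i e d)"
      unfolding basis_x_eq[OF c(1)] frame_sums[OF c(1)] .
    then show "u \<in> dist_M AT AM Nc e" unfolding dist_M_def using c by blast
  qed
  show "dist_V AT AM e = range (\<lambda>w. F.frame c (proj_y w) e)"
  proof (intro equalityI subsetI)
    fix u assume "u \<in> dist_V AT AM e"
    then obtain c' k where c': "c' \<in> AT \<times> AM" "e \<in> F.cdom c'"
      and u: "u = (\<lambda>d. \<Sum>i\<in>UNIV. \<Sum>\<alpha>\<in>UNIV. k i \<alpha> *\<^sub>R basis_v AT AM c' i \<alpha> e d)"
      unfolding dist_V_def by blast
    have "u = F.frame c' (proj_y (0, 0, \<chi> i \<alpha>. k i \<alpha>)) e"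
      unfolding u basis_v_eq frame_sums[OF c'(1)] by (simp add: proj_defs)
    then show "u \<in> range (\<lambda>w. F.frame c (proj_y w) e)" using chg[OF c'] fc[OF c'] by auto
  next
    fix u assume "u \<in> range (\<lambda>w. F.frame c (proj_y w) e)"
    then obtain w where "u = F.frame c (0, 0, \<chi> i \<alpha>. snd (snd w) $ i $ \<alpha>) e" by (auto simp: proj_defs)
    then have "u = (\<lambda>d. \<Sum>i\<in>UNIV. \<Sum>\<alpha>\<in>UNIV. snd (snd w) $ i $ \<alpha> *\<^sub>R basis_v AT AM c i \<alpha> e d)"
      unfolding basis_v_eq frame_sums[OF c(1)] .
    then show "u \<in> dist_V AT AM e" unfolding dist_V_def
      using c by (auto intro!: exI[of _ c] exI[of _ "\<lambda>i \<alpha>. snd (snd w) $ i $ \<alpha>"])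
  qed
qed

text \<open>The frame transports a splitting of the coordinate space to the tangent space. The
  second condition on \<open>Q1\<close>, \<open>Q2\<close>, \<open>Q3\<close> is the uniqueness
  behind the definite description, and the abstract form covers all three projections.\<close>

lemma dsum_proj_frame:
  assumes c: "c \<in> AT \<times> AM" "e \<in> F.cdom c"
    and Q: "\<And>w. Q1 w + Q2 w + Q3 w = w"
    and inj: "\<And>x y z w. Q1 x + Q2 y + Q3 z = w \<Longrightarrow> Q1 x = Q1 w"
  shows "dsum_proj (range (\<lambda>w. F.frame c (Q1 w) e)) (range (\<lambda>w. F.frame c (Q2 w) e))
    (range (\<lambda>w. F.frame c (Q3 w) e)) (F.frame c w e) = F.frame c (Q1 w) e"
proof -
  have add: "(\<lambda>d. F.frame c x e d + F.frame c y e d + F.frame c z e d) = F.frame c (x + y + z) e" for x y z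
    by (simp add: fun_eq_iff linear_add[OF F.linear_frame[OF c(1)]])
  show ?thesis
    unfolding dsum_proj_def
  proof (rule the_equality)
    show "F.frame c (Q1 w) e \<in> range (\<lambda>w. F.frame c (Q1 w) e) \<and>
      (\<exists>y\<in>range (\<lambda>w. F.frame c (Q2 w) e). \<exists>z\<in>range (\<lambda>w. F.frame c (Q3 w) e).
        F.frame c w e = (\<lambda>d. F.frame c (Q1 w) e d + y d + z d))"
    proof (intro conjI rangeI)
      show "\<exists>y\<in>range (\<lambda>w. F.frame c (Q2 w) e). \<exists>z\<in>range (\<lambda>w. F.frame c (Q3 w) e).
        F.frame c w e = (\<lambda>d. F.frame c (Q1 w) e d + y d + z d)"
        by (rule bexI[where x="F.frame c (Q2 w) e"], rule bexI[where x="F.frame c (Q3 w) e"])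
          (simp_all add: add Q)
    qed
    fix u assume "u \<in> range (\<lambda>w. F.frame c (Q1 w) e) \<and>
      (\<exists>y\<in>range (\<lambda>w. F.frame c (Q2 w) e). \<exists>z\<in>range (\<lambda>w. F.frame c (Q3 w) e).
        F.frame c w e = (\<lambda>d. u d + y d + z d))"
    then obtain x y z where u: "u = F.frame c (Q1 x) e"
      and "F.frame c w e = (\<lambda>d. F.frame c (Q1 x) e d + F.frame c (Q2 y) e d + F.frame c (Q3 z) e d)"
      by blast
    then have "Q1 x + Q2 y + Q3 z = w" unfolding add frame_inject[OF c] by simp
    then show "u = F.frame c (Q1 w) e" using inj u by metis
  qed
qed

lemma proj_fields:
  assumes c: "c \<in> AT \<times> AM" "e \<in> F.cdom c" and X: "X \<in> F.VF"
  shows "proj_hT AT AM Mc Nc X e = F.frame c (proj_t (F.coords c X e)) e"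
    "proj_hM AT AM Mc Nc X e = F.frame c (proj_x (F.coords c X e)) e"
    "proj_v AT AM Mc Nc X e = F.frame c (proj_y (F.coords c X e)) e"
proof -
  have J: "e \<in> J1 AT AM" using c jet_domain[of e "fst c" "snd c"] by simp
  have Xe: "X e = F.frame c (F.coords c X e) e"
    using F.frame_coords[OF F.VF_tangent[OF X] c] by simp
  show "proj_hT AT AM Mc Nc X e = F.frame c (proj_t (F.coords c X e)) e"
    unfolding proj_hT_def dist_eq[OF c] using J
    by (subst Xe) (auto intro!: dsum_proj_frame[OF c] simp: proj_defs)
  show "proj_hM AT AM Mc Nc X e = F.frame c (proj_x (F.coords c X e)) e"
    unfolding proj_hM_def dist_eq[OF c] using J
    by (subst Xe) (auto intro!: dsum_proj_frame[OF c] simp: proj_defs)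
  show "proj_v AT AM Mc Nc X e = F.frame c (proj_y (F.coords c X e)) e"
    unfolding proj_v_def dist_eq[OF c] using J
    by (subst Xe) (auto intro!: dsum_proj_frame[OF c] simp: proj_defs)
qed

lemma proj_fields_tangent:
  assumes X: "X \<in> F.VF"
  shows "proj_hT AT AM Mc Nc X e \<in> tangent_space jatlas e"
    "proj_hM AT AM Mc Nc X e \<in> tangent_space jatlas e"
    "proj_v AT AM Mc Nc X e \<in> tangent_space jatlas e"
proof -
  have "proj_hT AT AM Mc Nc X e \<in> tangent_space jatlas e \<and>
    proj_hM AT AM Mc Nc X e \<in> tangent_space jatlas e \<and>
    proj_v AT AM Mc Nc X e \<in> tangent_space jatlas e"
  proof (cases "e \<in> J1 AT AM")
    case True
    then obtain c where c: "c \<in> AT \<times> AM" "e \<in> F.cdom c"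
      unfolding points_jet_atlas[symmetric] by (rule F.in_pointsE)
    show ?thesis unfolding proj_fields[OF c X] using F.frame_tangent[OF c(1)] by blast
  next
    case False
    then show ?thesis by (simp add: proj_hT_def proj_hM_def proj_v_def E.tangent_zero)
  qed
  then show "proj_hT AT AM Mc Nc X e \<in> tangent_space jatlas e"
    "proj_hM AT AM Mc Nc X e \<in> tangent_space jatlas e"
    "proj_v AT AM Mc Nc X e \<in> tangent_space jatlas e" by auto
qed

text \<open>In adapted frames the three projections are linear maps that do not depend on the point,
  so \<open>parallel_iff\<close> applies to each of them.\<close>

lemma Gamma_linear_iff:
  "Gamma_linear_connection AT AM Mc Nc nab \<longleftrightarrow> linear_connection jatlas nab \<and>
    (\<forall>c\<in>AT \<times> AM. \<forall>e\<in>F.cdom c. block_preserving (F.conn_coef nab c e))"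
proof (cases "linear_connection jatlas nab")
  case lc: True
  have 1: "F.coords c (proj_hT AT AM Mc Nc X) e = proj_t (F.coords c X e)"
    "F.coords c (proj_hM AT AM Mc Nc X) e = proj_x (F.coords c X e)"
    "F.coords c (proj_v AT AM Mc Nc X) e = proj_y (F.coords c X e)"
    if "X \<in> F.VF" "c \<in> AT \<times> AM" "e \<in> F.cdom c" for X c e
    using proj_fields[OF that(2,3,1)] F.frame_self[OF that(2,3)] by (simp_all add: F.coords_def)
  have p: "(\<forall>X\<in>F.VF. \<forall>Y\<in>F.VF. nab X (proj_hT AT AM Mc Nc Y) = proj_hT AT AM Mc Nc (nab X Y)) \<longleftrightarrow>
      (\<forall>c\<in>AT \<times> AM. \<forall>e\<in>F.cdom c. \<forall>u v. F.conn_coef nab c e u (proj_t v) = proj_t (F.conn_coef nab c e u v))"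
    "(\<forall>X\<in>F.VF. \<forall>Y\<in>F.VF. nab X (proj_hM AT AM Mc Nc Y) = proj_hM AT AM Mc Nc (nab X Y)) \<longleftrightarrow>
      (\<forall>c\<in>AT \<times> AM. \<forall>e\<in>F.cdom c. \<forall>u v. F.conn_coef nab c e u (proj_x v) = proj_x (F.conn_coef nab c e u v))"
    "(\<forall>X\<in>F.VF. \<forall>Y\<in>F.VF. nab X (proj_v AT AM Mc Nc Y) = proj_v AT AM Mc Nc (nab X Y)) \<longleftrightarrow>
      (\<forall>c\<in>AT \<times> AM. \<forall>e\<in>F.cdom c. \<forall>u v. F.conn_coef nab c e u (proj_y v) = proj_y (F.conn_coef nab c e u v))"
    by (rule F.parallel_iff[OF lc linear_proj(1)], erule proj_fields_tangent, rule 1, assumption+)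
      (rule F.parallel_iff[OF lc linear_proj(2)], erule proj_fields_tangent, rule 1, assumption+,
       rule F.parallel_iff[OF lc linear_proj(3)], erule proj_fields_tangent, rule 1, assumption+)
  have "Gamma_linear_connection AT AM Mc Nc nab \<longleftrightarrow>
     (\<forall>X\<in>F.VF. \<forall>Y\<in>F.VF. nab X (proj_hT AT AM Mc Nc Y) = proj_hT AT AM Mc Nc (nab X Y)) \<and>
     (\<forall>X\<in>F.VF. \<forall>Y\<in>F.VF. nab X (proj_hM AT AM Mc Nc Y) = proj_hM AT AM Mc Nc (nab X Y)) \<and>
     (\<forall>X\<in>F.VF. \<forall>Y\<in>F.VF. nab X (proj_v AT AM Mc Nc Y) = proj_v AT AM Mc Nc (nab X Y))"
    unfolding Gamma_linear_connection_def using lc by blast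
  also have "\<dots> \<longleftrightarrow> (\<forall>c\<in>AT \<times> AM. \<forall>e\<in>F.cdom c. block_preserving (F.conn_coef nab c e))"
    unfolding p block_preserving_def by blast
  finally show ?thesis using lc by simp
qed (simp add: Gamma_linear_connection_def)

lemma smooth_coef_map_iff:
  "(\<forall>c\<in>AT \<times> AM. \<forall>u v. msmooth jatlas (F.cdom c) (\<lambda>e. coef_map w c e u v)) \<longleftrightarrow> smooth_components AT AM w"
  unfolding smooth_components_def Let_def
proof (intro ball_cong refl)
  fix c assume c: "c \<in> AT \<times> AM"
  have op: "openin (mtopology jatlas) (F.cdom c)" by (rule F.dom_open[OF c])
  note sm = E.smooth_in_chart_iff[OF F.ch_in[OF c]]
  let ?S = "\<lambda>f. smooth_in_chart (jet_chart AT AM c) f"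
  let ?M = "\<lambda>f. msmooth jatlas (F.cdom c) f"
  show "(\<forall>u v. msmooth jatlas (F.cdom c) (\<lambda>e. coef_map w c e u v)) \<longleftrightarrow>
    (\<forall>\<alpha> \<beta> \<gamma>. ?S (\<lambda>e. Gb w c e \<alpha> \<beta> \<gamma>)) \<and> (\<forall>k i \<gamma>. ?S (\<lambda>e. Gm w c e k i \<gamma>)) \<and>
    (\<forall>k \<beta> \<alpha> i \<gamma>. ?S (\<lambda>e. Gv w c e k \<beta> \<alpha> i \<gamma>)) \<and> (\<forall>\<alpha> \<beta> j. ?S (\<lambda>e. Lb w c e \<alpha> \<beta> j)) \<and>
    (\<forall>k i j. ?S (\<lambda>e. Lm w c e k i j)) \<and> (\<forall>k \<beta> \<alpha> i j. ?S (\<lambda>e. Lv w c e k \<beta> \<alpha> i j)) \<and>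
    (\<forall>\<alpha> \<gamma> \<beta> j. ?S (\<lambda>e. Cb w c e \<alpha> \<gamma> \<beta> j)) \<and> (\<forall>k \<gamma> i j. ?S (\<lambda>e. Cm w c e k \<gamma> i j)) \<and>
    (\<forall>k \<beta> \<gamma> \<alpha> i j. ?S (\<lambda>e. Cv w c e k \<beta> \<gamma> \<alpha> i j))" (is "?L \<longleftrightarrow> ?R")
  proof
    assume L: ?L
    have f: "?M (\<lambda>e. fst (coef_map w c e u v) $ \<alpha>)" "?M (\<lambda>e. fst (snd (coef_map w c e u v)) $ k)"
      "?M (\<lambda>e. snd (snd (coef_map w c e u v)) $ k $ \<alpha>)" for u v k \<alpha>
    proof -
      have L': "?M (\<lambda>e. coef_map w c e u v)" using L by blast
      note f = E.msmooth_bounded_linear[OF bounded_linear_fst op]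
        and s = E.msmooth_bounded_linear[OF bounded_linear_snd op]
        and n = E.msmooth_bounded_linear[OF bounded_linear_vec_nth op]
      show "?M (\<lambda>e. fst (coef_map w c e u v) $ \<alpha>)" by (rule n[OF f[OF L']])
      show "?M (\<lambda>e. fst (snd (coef_map w c e u v)) $ k)" by (rule n[OF f[OF s[OF L']]])
      show "?M (\<lambda>e. snd (snd (coef_map w c e u v)) $ k $ \<alpha>)" by (rule n[OF n[OF s[OF s[OF L']]]])
    qed
    show ?R
      unfolding sm
      using f(1)[of "unit_t _" "unit_t _"] f(2)[of "unit_t _" "unit_x _"] f(3)[of "unit_t _" "unit_v _ _"]
        f(1)[of "unit_x _" "unit_t _"] f(2)[of "unit_x _" "unit_x _"] f(3)[of "unit_x _" "unit_v _ _"]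
        f(1)[of "unit_v _ _" "unit_t _"] f(2)[of "unit_v _ _" "unit_x _"] f(3)[of "unit_v _ _" "unit_v _ _"]
      by (simp add: coef_map_units)
  next
    assume ?R
    then have R: "\<And>\<alpha> \<beta> \<gamma>. ?M (\<lambda>e. Gb w c e \<alpha> \<beta> \<gamma>)" "\<And>k i \<gamma>. ?M (\<lambda>e. Gm w c e k i \<gamma>)"
      "\<And>k \<beta> \<alpha> i \<gamma>. ?M (\<lambda>e. Gv w c e k \<beta> \<alpha> i \<gamma>)" "\<And>\<alpha> \<beta> j. ?M (\<lambda>e. Lb w c e \<alpha> \<beta> j)"
      "\<And>k i j. ?M (\<lambda>e. Lm w c e k i j)" "\<And>k \<beta> \<alpha> i j. ?M (\<lambda>e. Lv w c e k \<beta> \<alpha> i j)"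
      "\<And>\<alpha> \<gamma> \<beta> j. ?M (\<lambda>e. Cb w c e \<alpha> \<gamma> \<beta> j)" "\<And>k \<gamma> i j. ?M (\<lambda>e. Cm w c e k \<gamma> i j)"
      "\<And>k \<beta> \<gamma> \<alpha> i j. ?M (\<lambda>e. Cv w c e k \<beta> \<gamma> \<alpha> i j)"
      unfolding sm by simp_all
    show ?L
      unfolding coef_map_def
      by (intro allI E.msmooth_Pair op E.msmooth_vec_lambda)
        (intro E.msmooth_add E.msmooth_sum E.msmooth_mult op finite R E.msmooth_const)+
  qed
qed

text \<open>Bilinearity is automatic for \<open>coef_map\<close>; of the three clauses of
  \<open>christoffel\<close> there remain smoothness of the entries and the change of frames, which
  is the content of the rules.\<close>

lemma christoffel_coef_map_iff:
  "F.christoffel (coef_map w) \<longleftrightarrow> smooth_components AT AM w \<and> transformation_rules AT AM w"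
proof -
  have "(\<forall>c\<in>AT \<times> AM. \<forall>c'\<in>AT \<times> AM. \<forall>e\<in>F.cdom c \<inter> F.cdom c'. \<forall>u v.
      F.frame_change c c' e (coef_map w c e u v) =
      coef_map w c' e (F.frame_change c c' e u) (F.frame_change c c' e v)
      + mderiv (jet_chart AT AM c) (\<lambda>r. F.frame_change c c' r v) e (shear (- 1) c e u)) \<longleftrightarrow>
    transformation_rules AT AM w"
    unfolding transformation_rules_def
  proof (intro ball_cong refl)
    fix c c' e assume "c \<in> AT \<times> AM" "c' \<in> AT \<times> AM" "e \<in> F.cdom c \<inter> F.cdom c'"
    then show "(\<forall>u v. F.frame_change c c' e (coef_map w c e u v) =
      coef_map w c' e (F.frame_change c c' e u) (F.frame_change c c' e v)
      + mderiv (jet_chart AT AM c) (\<lambda>r. F.frame_change c c' r v) e (shear (- 1) c e u)) \<longleftrightarrow>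
      rules_hT w c c' e \<and> rules_hM w c c' e \<and> rules_v w c c' e"
      using change_iff_rules[of "fst c" "fst c'" "snd c" "snd c'" e w] by (simp add: mem_Times_iff)
  qed
  then show ?thesis
    unfolding F.christoffel_def smooth_coef_map_iff by (simp add: bilinear_coef_map)
qed

section \<open>The correspondence between connections and lawful components\<close>

definition connection_components where
  "connection_components nab = comps_of (F.conn_coef nab)"

abbreviation "lawful_components \<equiv>
  {w. supported_on_charts AT AM w \<and> smooth_components AT AM w \<and> transformation_rules AT AM w}"

lemma coef_map_connection_components:
  assumes "Gamma_linear_connection AT AM Mc Nc nab" "c \<in> AT \<times> AM" "e \<in> F.cdom c"
  shows "coef_map (connection_components nab) c e = F.conn_coef nab c e"
  using assms F.conn_coef_bilinear
  unfolding Gamma_linear_iff connection_components_def by (intro coef_map_comps_of) auto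

lemma is_local_components_unique:
  assumes "Gamma_linear_connection AT AM Mc Nc nab"
  shows "is_local_components AT AM Mc Nc nab w \<longleftrightarrow> w = connection_components nab"
proof -
  have s: "supported_on_charts AT AM (connection_components nab)"
    unfolding connection_components_def by (rule supported_comps_of)
  have lc: "linear_connection jatlas nab" using assms by (simp add: Gamma_linear_iff)
  show ?thesis
    unfolding is_local_components_iff[OF lc]
    using s coef_map_connection_components[OF assms] components_eqI[OF _ s, of w] by auto
qed

lemma connection_components_lawful:
  assumes "Gamma_linear_connection AT AM Mc Nc nab"
  shows "connection_components nab \<in> lawful_components"
proof -
  have "linear_connection jatlas nab" using assms by (simp add: Gamma_linear_iff)
  then have "F.christoffel (F.conn_coef nab)" by (rule F.christoffel_conn_coef)
  then have "F.christoffel (coef_map (connection_components nab))"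
    by (rule F.christoffel_cong) (simp add: coef_map_connection_components[OF assms])
  then show ?thesis
    using supported_comps_of[of "F.conn_coef nab"]
    by (simp add: christoffel_coef_map_iff connection_components_def)
qed

text \<open>The connection is \<open>conn_of\<close> applied to the bilinear maps of
  \<open>w\<close>. It has these maps as coefficients, and they preserve the blocks by construction,
  so it is compatible with the projections.\<close>

lemma connection_components_surj:
  assumes "w \<in> lawful_components"
  obtains nab where "Gamma_linear_connection AT AM Mc Nc nab" "connection_components nab = w"
proof -
  have G: "F.christoffel (coef_map w)" using assms by (simp add: christoffel_coef_map_iff)
  let ?nab = "F.conn_of (coef_map w)"
  have lc: "linear_connection jatlas ?nab" by (rule F.linear_connection_conn_of[OF G])
  have coef: "F.conn_coef ?nab c e = coef_map w c e" if "c \<in> AT \<times> AM" "e \<in> F.cdom c" for c e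
    using F.conn_coef_conn_of[OF G that] by (intro ext)
  have Gl: "Gamma_linear_connection AT AM Mc Nc ?nab"
    unfolding Gamma_linear_iff
  proof (intro conjI ballI lc)
    show "block_preserving (F.conn_coef ?nab c e)" if "c \<in> AT \<times> AM" "e \<in> F.cdom c" for c e
      unfolding coef[OF that] by (rule block_preserving_coef_map)
  qed
  have "is_local_components AT AM Mc Nc ?nab w"
    unfolding is_local_components_iff[OF lc] using assms coef by simp
  then show thesis using that Gl is_local_components_unique[OF Gl] by simp
qed

lemma connection_components_inj:
  assumes "Gamma_linear_connection AT AM Mc Nc nab" "Gamma_linear_connection AT AM Mc Nc nab'"
    and "connection_components nab = connection_components nab'"
  shows "nab = nab'"
proof (rule F.conn_eqI)
  show "F.conn_coef nab c e = F.conn_coef nab' c e" if "c \<in> AT \<times> AM" "e \<in> F.cdom c" for c e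
    using coef_map_connection_components[OF assms(1) that] coef_map_connection_components[OF assms(2) that]
      assms(3) by simp
qed (use assms in \<open>simp_all add: Gamma_linear_iff\<close>)

end

theorem theorem1p3:
  fixes AT :: "('t, real^'p::finite) chart set"
    and AM :: "('m, real^'n::finite) chart set"
    and M :: "('t, 'm, 'p, 'n) nlc_M"
    and N :: "('t, 'm, 'p, 'n) nlc_N"
  assumes "smooth_manifold AT"
    and "smooth_manifold AM"
    and "nonlinear_connection AT AM M N"
  shows "(\<forall>nab w. Gamma_linear_connection AT AM M N nab \<and> is_local_components AT AM M N nab w
            \<longrightarrow> transformation_rules AT AM w)
    \<and> (\<exists>F. bij_betw F {nab. Gamma_linear_connection AT AM M N nab}
               {w. supported_on_charts AT AM w \<and> smooth_components AT AM w
                   \<and> transformation_rules AT AM w}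
         \<and> (\<forall>nab w. Gamma_linear_connection AT AM M N nab \<longrightarrow>
               (is_local_components AT AM M N nab w \<longleftrightarrow> w = F nab)))"
proof -
  interpret jet_connection AT AM M N
    using assms by unfold_locales
  have "bij_betw connection_components {nab. Gamma_linear_connection AT AM M N nab} lawful_components"
    unfolding bij_betw_def inj_on_def
    using connection_components_inj connection_components_lawful connection_components_surj
    by (auto simp: image_iff) metis
  \<comment> \<open>The transformation law for given components needs no separate argument: they
    equal \<open>connection_components nab\<close>, a member of the target of the bijection.\<close>
  then show ?thesis
    using is_local_components_unique connection_components_lawful
    by (intro conjI allI impI exI[of _ connection_components]) auto
qed

end
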